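(* Let $m\geq 1$ and suppose $Z=\{CI(d_1,\ldots,d_n);m\}\subseteq\mathbb{P}^n$ is a homogeneous scheme of fat points of multiplicity $m$ supported on a complete intersection $X=CI(d_1,\ldots,d_n)$ of points, with defining ideal $I_Z\subseteq R$. Then the graded minimal free resolution of $I_Z$ has the form \[ 0 \rightarrow \mathcal{H}_{n-1} \rightarrow \mathcal{H}_{n-2} \rightarrow \cdots \rightarrow \mathcal{H}_{0} \rightarrow I_Z \rightarrow 0 \] where \[ \mathcal{H}_0 = \bigoplus_{(a_1,\ldots,a_n) \in \mathcal{M}_{n,m,1}} R(-a_1d_1-\cdots-a_nd_n) \] and, for $i=1,\ldots,n-1$, \[ \mathcal{H}_i = \bigoplus_{l_1 = i+1}^n \left[\bigoplus_{l_2=l_1}^{n}\left[\cdots \left[ \bigoplus_{l_i=l_{i-1}}^n \left[\bigoplus_{(a_1,\ldots,a_n) \in \mathcal{M}_{n,m+i,l_i}} R(-a_1d_1-\cdots-a_nd_n)\right]\right]\cdots\right]\right]. \] Moreover, the Hilbert function of $R/I_Z$ is given for all $i$ by \[ H_{R/I_Z}(i)=\sum_{(a_1,\ldots,a_n)\in\mathcal{L}_{n,m}} H_{R/I_X}(i-a_1d_1-\cdots-a_nd_n). \]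
   Context: $k$ is an algebraically closed field of characteristic $0$, $R=k[x_0,\ldots,x_n]$ has the standard grading, $\mathbb{P}^n=\mathbb{P}^n_k$, and $R(-d)$ is the graded free module of rank one with generator in degree $d$. A complete intersection of points $X=CI(d_1,\ldots,d_n)\subseteq\mathbb{P}^n$ is a set of $\prod_{i=1}^n d_i$ reduced points whose defining ideal is $I_X=(F_1,\ldots,F_n)$, where $F_1,\ldots,F_n$ is a regular sequence of homogeneous forms with $\deg F_i=d_i$ and $I_X=\sqrt{I_X}$; the type is ordered so that $d_1\leq\cdots\leq d_n$. For $m\geq 1$, $\{X;m\}$ denotes the subscheme $Z$ of $\mathbb{P}^n$ defined by $I_Z=\bigcap_{P\in X}\wp_P^{m}$, where $\wp_P\subseteq R$ is the defining ideal of the point $P$. For a homogeneous ideal $J\subseteq R$, $H_{R/J}(i):=\dim_k(R/J)_i$, which is $0$ for $i<0$. With $\mathbb{N}$ the non-negative integers, \[ \mathcal{M}_{r,s,t} := \{(a_1,\ldots,a_r)\in\mathbb{N}^r \mid a_1+\cdots+a_r=s \text{ and at least } t \text{ of the } a_i\text{'s are non-zero}\}, \] \[ \mathcal{L}_{r,s} := \{(a_1,\ldots,a_r)\in\mathbb{N}^r \mid a_1+\cdots+a_r\leq s-1\}. \] In the formula for $\mathcal{H}_i$ the outer direct sum is over all integer sequences $(l_1,\ldots,l_i)$ with $i+1\leq l_1\leq l_2\leq\cdots\leq l_i\leq n$. *)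

theory Defs
  imports "HOL-Library.Poly_Mapping" "HOL-Computational_Algebra.Polynomial"
begin

section \<open>The polynomial ring and its ideals\<close>

text \<open>The variables \<open>x\<^sub>0, \<dots>, x\<^sub>n\<close> are indexed by a finite type \<open>'v\<close> with \<open>n + 1\<close> elements;
  a polynomial is a finitely supported map from exponent vectors to coefficients, with the
  convolution product of \<^theory>\<open>HOL-Library.Poly_Mapping\<close>.\<close>

type_synonym ('v, 'k) mpoly_ring = "('v \<Rightarrow>\<^sub>0 nat) \<Rightarrow>\<^sub>0 'k"

definition var :: "'v \<Rightarrow> ('v, 'k::comm_ring_1) mpoly_ring" where
  "var i = Poly_Mapping.single (Poly_Mapping.single i 1) 1"

definition const :: "'k \<Rightarrow> ('v, 'k::comm_ring_1) mpoly_ring" where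
  "const c = Poly_Mapping.single 0 c"

definition mon_degree :: "('v::finite \<Rightarrow>\<^sub>0 nat) \<Rightarrow> nat" where
  "mon_degree t = (\<Sum>i\<in>UNIV. Poly_Mapping.lookup t i)"

text \<open>The graded piece \<open>R\<^sub>e\<close>, which is zero for negative \<open>e\<close>.\<close>

definition homog_part :: "int \<Rightarrow> ('v::finite, 'k::comm_ring_1) mpoly_ring set" where
  "homog_part e = {f. \<forall>t\<in>Poly_Mapping.keys f. int (mon_degree t) = e}"

definition eval_at :: "('v::finite \<Rightarrow> 'k) \<Rightarrow> ('v, 'k::comm_ring_1) mpoly_ring \<Rightarrow> 'k" where
  "eval_at v f = (\<Sum>t\<in>Poly_Mapping.keys f. Poly_Mapping.lookup f t * (\<Prod>i\<in>UNIV. v i ^ Poly_Mapping.lookup t i))"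

text \<open>Ideals of a commutative ring are the submodules of the ring over itself. The module locale is
  deliberately not interpreted for multiplication: its simp rules would reassociate all products.\<close>

abbreviation ideal_gen :: "'a::comm_ring_1 set \<Rightarrow> 'a set" where
  "ideal_gen \<equiv> module.span (*)"

lemma module_mult: "module ((*) :: 'a::comm_ring_1 \<Rightarrow> 'a \<Rightarrow> 'a)"
  by unfold_locales (simp_all only: distrib_left distrib_right mult.assoc mult_1_left)

fun ideal_power :: "'a::comm_ring_1 set \<Rightarrow> nat \<Rightarrow> 'a set" where
  "ideal_power I 0 = UNIV"
| "ideal_power I (Suc m) = ideal_gen {a * b | a b. a \<in> I \<and> b \<in> ideal_power I m}"

definition ideal_radical :: "'a::comm_ring_1 set \<Rightarrow> 'a set" where
  "ideal_radical I = {f. \<exists>m. f ^ m \<in> I}"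

definition irrelevant_ideal :: "('v, 'k::comm_ring_1) mpoly_ring set" where
  "irrelevant_ideal = ideal_gen (range var)"

definition regular_sequence :: "'a::comm_ring_1 list \<Rightarrow> bool" where
  "regular_sequence Fs \<longleftrightarrow>
     (\<forall>i<length Fs. \<forall>g. Fs ! i * g \<in> ideal_gen (set (take i Fs))
        \<longrightarrow> g \<in> ideal_gen (set (take i Fs))) \<and>
     ideal_gen (set Fs) \<noteq> UNIV"


section \<open>Points of projective space, complete intersections, fat points\<close>

text \<open>A point of \<open>\<P>\<^sup>n\<close> is the set of all its (nonzero) homogeneous coordinate vectors.\<close>

definition proj_space :: "('v \<Rightarrow> 'k::field) set set" where
  "proj_space = {{w. \<exists>c. c \<noteq> 0 \<and> w = (\<lambda>i. c * v i)} | v. v \<noteq> (\<lambda>_. 0)}"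

definition vanishing_ideal ::
    "('v::finite \<Rightarrow> 'k::field) set set \<Rightarrow> ('v, 'k) mpoly_ring set" where
  "vanishing_ideal X =
     ideal_gen {f. (\<exists>e. f \<in> homog_part e) \<and> (\<forall>P\<in>X. \<forall>v\<in>P. eval_at v f = 0)}"

text \<open>\<open>X\<close> is a complete intersection of points \<open>CI(d\<^sub>1, \<dots>, d\<^sub>n)\<close>, with \<open>ds = [d\<^sub>1, \<dots>, d\<^sub>n]\<close>.\<close>

definition CI_points :: "nat list \<Rightarrow> ('v::finite \<Rightarrow> 'k::field) set set \<Rightarrow> bool" where
  "CI_points ds X \<longleftrightarrow>
     card (UNIV :: 'v set) = length ds + 1 \<and> sorted ds \<and>
     X \<subseteq> proj_space \<and> finite X \<and> card X = prod_list ds \<and>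
     (\<exists>Fs :: ('v, 'k) mpoly_ring list.
        length Fs = length ds \<and>
        (\<forall>i<length ds. Fs ! i \<in> homog_part (int (ds ! i))) \<and>
        regular_sequence Fs \<and>
        vanishing_ideal X = ideal_gen (set Fs) \<and>
        vanishing_ideal X = ideal_radical (vanishing_ideal X))"

text \<open>The defining ideal of \<open>{X; m}\<close>.\<close>

definition fat_points_ideal ::
    "('v::finite \<Rightarrow> 'k::field) set set \<Rightarrow> nat \<Rightarrow> ('v, 'k) mpoly_ring set" where
  "fat_points_ideal X m = (\<Inter>P\<in>X. ideal_power (vanishing_ideal {P}) m)"


section \<open>Hilbert functions\<close>

text \<open>\<open>B \<subseteq> V\<close> consists of representatives of a finite \<open>k\<close>-basis of \<open>V / (V \<inter> W)\<close>: modulo \<open>W\<close>, each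
  element of \<open>V\<close> is a linear combination of \<open>B\<close> with unique coefficients.\<close>

definition basis_modulo ::
    "('v, 'k::field) mpoly_ring set \<Rightarrow> ('v, 'k) mpoly_ring set \<Rightarrow> ('v, 'k) mpoly_ring set \<Rightarrow> bool"
  where
  "basis_modulo W V B \<longleftrightarrow> finite B \<and> B \<subseteq> V \<and>
     (\<forall>f\<in>V. \<exists>!c. (\<forall>b. b \<notin> B \<longrightarrow> c b = 0) \<and> f - (\<Sum>b\<in>B. const (c b) * b) \<in> W)"

definition quotient_dim ::
    "('v, 'k::field) mpoly_ring set \<Rightarrow> ('v, 'k) mpoly_ring set \<Rightarrow> nat" where
  "quotient_dim V W = card (SOME B. basis_modulo W V B)"

text \<open>For a homogeneous ideal \<open>J\<close>, the degree \<open>i\<close> piece of \<open>R/J\<close> is \<open>R\<^sub>i / (R\<^sub>i \<inter> J)\<close>.\<close>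

definition hilbert_function ::
    "('v::finite, 'k::field) mpoly_ring set \<Rightarrow> int \<Rightarrow> nat" where
  "hilbert_function J i = quotient_dim (homog_part i) J"


section \<open>Graded free modules and minimal graded free resolutions\<close>

text \<open>A pair \<open>(J, s)\<close> represents the graded free module \<open>\<Oplus>\<^bsub>j\<in>J\<^esub> R(-s j)\<close>. Its elements are the
  families of polynomials with support in \<open>J\<close>.\<close>

type_synonym 'j graded_free = "'j set \<times> ('j \<Rightarrow> int)"

definition fscale ::
    "'r::comm_ring_1 \<Rightarrow> ('j \<Rightarrow>\<^sub>0 'r) \<Rightarrow> ('j \<Rightarrow>\<^sub>0 'r)" where
  "fscale r v = Poly_Mapping.map (\<lambda>x. r * x) v"

lemma lookup_fscale [simp]: "Poly_Mapping.lookup (fscale r v) j = r * Poly_Mapping.lookup v j"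
  unfolding fscale_def by (simp add: Poly_Mapping.map.rep_eq when_def)

lemma module_fscale: "module (fscale :: 'r::comm_ring_1 \<Rightarrow> ('j \<Rightarrow>\<^sub>0 'r) \<Rightarrow> _)"
  by unfold_locales
    (rule poly_mapping_eqI, simp only: lookup_fscale lookup_add distrib_left distrib_right
       mult.assoc mult_1_left)+

definition gf_elements :: "'j graded_free \<Rightarrow> ('j \<Rightarrow>\<^sub>0 'r::comm_ring_1) set" where
  "gf_elements M = {v. Poly_Mapping.keys v \<subseteq> fst M}"

text \<open>The degree \<open>e\<close> piece, using \<open>R(-s)\<^sub>e = R\<^bsub>e - s\<^esub>\<close>.\<close>

definition gf_part ::
    "'j graded_free \<Rightarrow> int \<Rightarrow> ('j \<Rightarrow>\<^sub>0 ('v::finite, 'k::comm_ring_1) mpoly_ring) set" where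
  "gf_part M e = {v \<in> gf_elements M. \<forall>j\<in>fst M. Poly_Mapping.lookup v j \<in> homog_part (e - snd M j)}"

text \<open>\<open>0 \<rightarrow> F\<^bsub>l-1\<^esub> \<rightarrow> \<dots> \<rightarrow> F\<^sub>0 \<rightarrow> I \<rightarrow> 0\<close> is a minimal graded free resolution of \<open>I \<subseteq> R\<close>, where \<open>F\<^sub>i = 0\<close>
  for \<open>i \<ge> l\<close>, with augmentation \<open>\<epsilon> : F\<^sub>0 \<rightarrow> I\<close> and differentials \<open>\<phi> i : F\<^bsub>i+1\<^esub> \<rightarrow> F\<^sub>i\<close> of degree \<open>0\<close>.
  The maps are total on the ambient free modules on the whole index type; only their restrictions
  to the \<open>F\<^sub>i\<close> matter.\<close>

definition minimal_graded_free_resolution ::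
    "('v::finite, 'k::field) mpoly_ring set \<Rightarrow> nat \<Rightarrow> (nat \<Rightarrow> 'j graded_free) \<Rightarrow>
     (('j \<Rightarrow>\<^sub>0 ('v, 'k) mpoly_ring) \<Rightarrow> ('v, 'k) mpoly_ring) \<Rightarrow>
     (nat \<Rightarrow> ('j \<Rightarrow>\<^sub>0 ('v, 'k) mpoly_ring) \<Rightarrow> ('j \<Rightarrow>\<^sub>0 ('v, 'k) mpoly_ring)) \<Rightarrow> bool" where
  "minimal_graded_free_resolution I l F \<epsilon> \<phi> \<longleftrightarrow>
     (\<forall>i. finite (fst (F i))) \<and> (\<forall>i\<ge>l. fst (F i) = {}) \<and>
     module_hom fscale (*) \<epsilon> \<and> (\<forall>e. \<epsilon> ` gf_part (F 0) e \<subseteq> homog_part e) \<and>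
     (\<forall>i. module_hom fscale fscale (\<phi> i) \<and>
          (\<forall>e. \<phi> i ` gf_part (F (Suc i)) e \<subseteq> gf_part (F i) e)) \<and>
     \<epsilon> ` gf_elements (F 0) = I \<and>
     \<phi> 0 ` gf_elements (F 1) = {v \<in> gf_elements (F 0). \<epsilon> v = 0} \<and>
     (\<forall>i. \<phi> (Suc i) ` gf_elements (F (Suc (Suc i))) =
          {v \<in> gf_elements (F (Suc i)). \<phi> i v = 0}) \<and>
     (\<forall>i. \<phi> i ` gf_elements (F (Suc i)) \<subseteq>
          module.span fscale {fscale r v | r v. r \<in> irrelevant_ideal \<and> v \<in> gf_elements (F i)})"


section \<open>The modules of the resolution\<close>

definition MM :: "nat \<Rightarrow> nat \<Rightarrow> nat \<Rightarrow> nat list set" where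
  "MM r s t = {as. length as = r \<and> sum_list as = s \<and> t \<le> card {j. j < r \<and> as ! j \<noteq> 0}}"

definition LL :: "nat \<Rightarrow> nat \<Rightarrow> nat list set" where
  "LL r s = {as. length as = r \<and> int (sum_list as) \<le> int s - 1}"

definition weighted_degree :: "nat list \<Rightarrow> nat list \<Rightarrow> int" where
  "weighted_degree ds as = (\<Sum>j<length ds. int (as ! j) * int (ds ! j))"

text \<open>The summands of \<open>\<H>\<^sub>i\<close> are indexed by pairs \<open>(ls, as)\<close> with \<open>ls = [l\<^sub>1, \<dots>, l\<^sub>i]\<close>,
  so equal \<open>as\<close> for different \<open>ls\<close> give different summands; \<open>ls\<close> is empty for \<open>i = 0\<close>.\<close>

definition HH :: "nat list \<Rightarrow> nat \<Rightarrow> nat \<Rightarrow> (nat list \<times> nat list) graded_free" where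
  "HH ds m i = (let n = length ds in
     (if i = 0 then {[]} \<times> MM n m 1
      else {(ls, as). length ls = i \<and> sorted ls \<and> set ls \<subseteq> {i + 1..n} \<and>
                      as \<in> MM n (m + i) (last ls)},
      \<lambda>(ls, as). weighted_degree ds as))"

end

theory Submission
  imports Defs "HOL-Library.Multiset" "Jordan_Normal_Form.Determinant"
begin

text \<open>Let \<open>F\<^sub>1, \<dots>, F\<^sub>n\<close> be the generators of \<open>I = I\<^sub>X\<close>. At each point \<open>P\<close> of \<open>X\<close> the
  differentials of the \<open>F\<^sub>i\<close> are linearly independent: if \<open>g\<close> vanishes on the other points of \<open>X\<close> but not at \<open>P\<close>, then \<open>g \<wp>\<^sub>P \<subseteq> I\<close>, and one
  differentiates. Expanding along lines through \<open>P\<close> shows that if a sum \<open>\<Sum> c\<^sub>a F\<^sup>a\<close> over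
  \<open>|a| = m\<close> lies in the ideal of \<open>{X; m + 1}\<close>, then all \<open>c\<^sub>a \<in> I\<close>. By induction on \<open>m\<close> the ideal of
  \<open>{X; m}\<close> is \<open>I\<^sup>m\<close>, and \<open>I\<^sup>m / I\<^bsup>m+1\<^esup>\<close> is the direct sum of the \<open>F\<^sup>a R / I\<close> with \<open>|a| = m\<close>, which gives the Hilbert function.

  For the resolution, consider \<open>\<And>\<^sup>i \<otimes> Sym\<^sup>p \<otimes> R\<close> with the Koszul differential \<open>d\<close> of \<open>F\<^sub>1, \<dots>, F\<^sub>n\<close> on
  \<open>\<And>\<^sup>i \<otimes> R\<close> and the scalar Koszul differential \<open>\<partial>\<close> on \<open>\<And>\<^sup>i \<otimes> Sym\<^sup>p\<close>; they anticommute. Then \<open>\<H>\<^sub>i\<close> is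
  \<open>ker \<partial>\<close> for \<open>p = m\<close>, with differential \<open>d\<close>. Exactness is a diagram chase from the exactness of \<open>d\<close> and
  \<open>\<partial>\<close>. In total exponent \<open>a\<close>, \<open>\<partial>\<close> is the boundary of the simplex on the support of \<open>a\<close>, so that \<open>ker \<partial>\<close>
  has a basis of \<open>t - 1\<close> choose \<open>i\<close> elements if \<open>t\<close> entries of \<open>a\<close> are nonzero; this is also the number
  of sequences \<open>(l\<^sub>1, \<dots>, l\<^sub>i)\<close> with \<open>l\<^sub>i \<le> t\<close>.\<close>


section \<open>Polynomials\<close>

text \<open>The geometric half rests on a square Jacobian. After dropping a coordinate
  \<open>j0\<close> that is nonzero at P, there are n coordinate directions against n generators, so
  the relations found by differentiating provide a left inverse, hence a right inverse, and the F_i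
  attain any prescribed derivatives along a suitable direction. As these values are arbitrary in an
  infinite field, a leading form that vanishes on all lines through P has zero coefficients at P.
  The diagram chase passes from p to p + 1 at each step and needs a reason to stop: all degrees d_j
  are positive, so an element of internal degree at most E is zero once p > E. This is why degree
  bounds accompany exactness. At i = 0 the chase needs the F^u with |u| = p to be independent modulo
  I; this is the statement on sums of c_a F^a, applied to the zero sum. Minimality comes for free:
  the coordinates of a cycle are simply some of its entries, and d makes every entry a combination
  of the F_s, which have positive degree. The count of basis elements is made separately for each
  exponent a, because the degree shifts have to match as well.\<close>

lemma mpoly_eq_sum_single:
  "(\<Sum>t\<in>Poly_Mapping.keys f. Poly_Mapping.single t (Poly_Mapping.lookup f t)) = f"
  by (rule poly_mapping_eqI)
    (auto simp: lookup_sum lookup_single when_def in_keys_iff if_distrib sum.delta cong: if_cong)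

lemma var_times_single:
  "var i * Poly_Mapping.single t c = Poly_Mapping.single (Poly_Mapping.single i 1 + t) c"
  by (simp add: var_def mult_single)

lemma mon_degree_add: "mon_degree (s + t) = mon_degree s + mon_degree t"
  by (simp add: mon_degree_def lookup_add sum.distrib)

lemma mon_degree_zero [simp]: "mon_degree 0 = 0"
  by (simp add: mon_degree_def)

lemma mon_degree_single [simp]: "mon_degree (Poly_Mapping.single i k) = k"
  by (simp add: mon_degree_def lookup_single when_def)

lemma mon_degree_pos_split:
  assumes "mon_degree t > 0"
  obtains i s where "t = Poly_Mapping.single i 1 + s"
proof -
  obtain i where i: "Poly_Mapping.lookup t i > 0"
    using assms unfolding mon_degree_def by (metis gr0I sum.neutral)
  have "t = Poly_Mapping.single i 1 + (t - Poly_Mapping.single i 1)"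
    using i by (intro poly_mapping_eqI) (auto simp: lookup_add lookup_minus lookup_single when_def)
  then show ?thesis using that by blast
qed

text \<open>Every monomial is reached by multiplying with one variable at a time, so a product rule
  for a single variable is enough; this is used for \<open>dir_deriv_linear\<close>.\<close>

lemma mpoly_induct [case_names const var add]:
  fixes f :: "('v::finite, 'k::comm_ring_1) mpoly_ring"
  assumes const: "\<And>c. P (const c)"
    and var: "\<And>i f. P f \<Longrightarrow> P (var i * f)"
    and add: "\<And>f g. P f \<Longrightarrow> P g \<Longrightarrow> P (f + g)"
  shows "P f"
proof -
  have single: "P (Poly_Mapping.single t c)" for t c
  proof (induction "mon_degree t" arbitrary: t)
    case 0
    then have "t = 0" by (intro poly_mapping_eqI) (simp add: mon_degree_def)
    then show ?case using const[of c] by (simp add: const_def)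
  next
    case (Suc d)
    then obtain i s where t: "t = Poly_Mapping.single i 1 + s"
      by (metis mon_degree_pos_split zero_less_Suc)
    with Suc have "P (Poly_Mapping.single s c)" by (simp add: mon_degree_add)
    then show ?case using var[of "Poly_Mapping.single s c" i] t by (simp add: var_times_single)
  qed
  have "P (\<Sum>t\<in>A. Poly_Mapping.single t (Poly_Mapping.lookup f t))" if "finite A" for A
    using that
  proof (induction A rule: finite_induct)
    case empty
    show ?case using const[of 0] by (simp add: const_def)
  next
    case (insert t A)
    then show ?case by (simp add: add single)
  qed
  from this[of "Poly_Mapping.keys f"] show ?thesis by (simp add: mpoly_eq_sum_single)
qed

lemma const_add: "const (c + d) = const c + const d"
  by (simp add: const_def single_add)

lemma const_minus: "const (c - d) = const c - const d"
  by (simp add: const_def single_diff)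

lemma const_mult: "const (c * d) = const c * const d"
  by (simp add: const_def mult_single)

lemma const_one [simp]: "const 1 = 1"
  by (simp add: const_def)

lemma const_zero [simp]: "const 0 = 0"
  by (simp add: const_def)

section \<open>Homogeneous parts\<close>

text \<open>A predicate instead of a degree, so that one notion covers homogeneous components
  (\<open>d = e\<close>) and truncation (\<open>d \<le> E\<close>), which bounds the degrees in the
  exactness proof.\<close>

definition restrict_degrees ::
    "(int \<Rightarrow> bool) \<Rightarrow> ('v::finite, 'k::comm_ring_1) mpoly_ring \<Rightarrow> ('v, 'k) mpoly_ring" where
  "restrict_degrees Q f = Poly_Mapping.mapp (\<lambda>t c. if Q (int (mon_degree t)) then c else 0) f"

definition degrees_in :: "(int \<Rightarrow> bool) \<Rightarrow> ('v::finite, 'k::comm_ring_1) mpoly_ring set" where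
  "degrees_in Q = {f. \<forall>t\<in>Poly_Mapping.keys f. Q (int (mon_degree t))}"

lemma homog_part_eq: "homog_part e = degrees_in (\<lambda>d. d = e)"
  by (simp add: homog_part_def degrees_in_def)

lemma lookup_restrict_degrees [simp]:
  "Poly_Mapping.lookup (restrict_degrees Q f) t =
    (if Q (int (mon_degree t)) then Poly_Mapping.lookup f t else 0)"
  by (simp add: restrict_degrees_def lookup_mapp when_def in_keys_iff)

lemma restrict_degrees_add: "restrict_degrees Q (f + g) = restrict_degrees Q f + restrict_degrees Q g"
  by (rule poly_mapping_eqI) (simp add: lookup_add)

lemma restrict_degrees_zero [simp]: "restrict_degrees Q 0 = 0"
  by (rule poly_mapping_eqI) simp

lemma restrict_degrees_uminus: "restrict_degrees Q (- f) = - restrict_degrees Q f"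
  by (rule poly_mapping_eqI) simp

lemma restrict_degrees_sum:
  "restrict_degrees Q (\<Sum>a\<in>A. f a) = (\<Sum>a\<in>A. restrict_degrees Q (f a))"
  by (induction A rule: infinite_finite_induct) (auto simp: restrict_degrees_add)

lemma restrict_degrees_in: "restrict_degrees Q f \<in> degrees_in Q"
  by (auto simp: degrees_in_def in_keys_iff split: if_splits)

lemma restrict_degrees_id: "f \<in> degrees_in Q \<Longrightarrow> restrict_degrees Q f = f"
  by (rule poly_mapping_eqI) (auto simp: degrees_in_def in_keys_iff)

lemma restrict_degrees_eq_0: "f \<in> degrees_in (\<lambda>d. \<not> Q d) \<Longrightarrow> restrict_degrees Q f = 0"
  by (rule poly_mapping_eqI) (auto simp: degrees_in_def in_keys_iff)

lemma degrees_in_zero [simp]: "0 \<in> degrees_in Q"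
  by (simp add: degrees_in_def)

lemma degrees_in_add: "f \<in> degrees_in Q \<Longrightarrow> g \<in> degrees_in Q \<Longrightarrow> f + g \<in> degrees_in Q"
  using keys_add[of f g] by (auto simp: degrees_in_def)

lemma degrees_in_uminus: "f \<in> degrees_in Q \<Longrightarrow> - f \<in> degrees_in Q"
  by (auto simp: degrees_in_def in_keys_iff)

lemma degrees_in_sum: "(\<And>a. a \<in> A \<Longrightarrow> f a \<in> degrees_in Q) \<Longrightarrow> (\<Sum>a\<in>A. f a) \<in> degrees_in Q"
  by (induction A rule: infinite_finite_induct) (auto simp: degrees_in_add)

lemma degrees_in_mult:
  assumes "F \<in> homog_part d" "f \<in> degrees_in (\<lambda>e. Q (e + d))"
  shows "F * f \<in> degrees_in Q"
  using keys_mult[of F f] assms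
  by (fastforce simp: degrees_in_def homog_part_def mon_degree_add add.commute)

lemma restrict_degrees_mult:
  assumes "F \<in> homog_part d"
  shows "restrict_degrees Q (F * f) = F * restrict_degrees (\<lambda>e. Q (e + d)) f"
proof -
  let ?Q = "\<lambda>e. Q (e + d)"
  have f: "f = restrict_degrees ?Q f + restrict_degrees (\<lambda>e. \<not> ?Q e) f"
    by (rule poly_mapping_eqI) (simp add: lookup_add)
  have "restrict_degrees Q (F * restrict_degrees ?Q f) = F * restrict_degrees ?Q f"
    by (intro restrict_degrees_id degrees_in_mult[OF assms] restrict_degrees_in)
  moreover have "restrict_degrees Q (F * restrict_degrees (\<lambda>e. \<not> ?Q e) f) = 0"
    by (intro restrict_degrees_eq_0 degrees_in_mult[OF assms] restrict_degrees_in)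
  ultimately show ?thesis
    by (subst f) (simp add: distrib_left restrict_degrees_add)
qed

lemma homog_part_mult:
  "f \<in> homog_part d \<Longrightarrow> g \<in> homog_part e \<Longrightarrow> f * g \<in> homog_part (d + e)"
  using degrees_in_mult[of f d g "\<lambda>c. c = d + e"] by (simp add: homog_part_eq add.commute)

lemma const_homog: "const c \<in> homog_part 0"
  by (simp add: const_def homog_part_def)

lemma one_homog: "1 \<in> homog_part 0"
  using const_homog[of 1] by simp

lemma homog_part_prod:
  assumes "finite A" "\<And>i. i \<in> A \<Longrightarrow> f i \<in> homog_part (d i)"
  shows "(\<Prod>i\<in>A. f i) \<in> homog_part (\<Sum>i\<in>A. d i)"
  using assms by (induction A rule: finite_induct) (auto simp: one_homog homog_part_mult)

lemma homog_part_power: "f \<in> homog_part d \<Longrightarrow> f ^ k \<in> homog_part (int k * d)"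
  by (induction k) (auto simp: one_homog homog_part_mult distrib_right)

lemma sum_homogeneous_parts:
  "(\<Sum>e\<in>(\<lambda>t. int (mon_degree t)) ` Poly_Mapping.keys f. restrict_degrees (\<lambda>d. d = e) f) = f"
  by (rule poly_mapping_eqI) (auto simp: lookup_sum in_keys_iff sum.delta)


section \<open>Restriction of polynomials to lines\<close>

text \<open>The substitution x = v + t w, a ring homomorphism to k[t]. Its constant coefficient is
  evaluation at v, its linear one the derivative in direction w, and its t-order detects
  multiplicity at v; the rules for all three come from polynomial multiplication.\<close>

definition on_line :: "('v::finite \<Rightarrow> 'k) \<Rightarrow> ('v \<Rightarrow> 'k) \<Rightarrow> ('v, 'k::field) mpoly_ring \<Rightarrow> 'k poly" where
  "on_line v w f = (\<Sum>t\<in>Poly_Mapping.keys f.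
     [:Poly_Mapping.lookup f t:] * (\<Prod>i\<in>UNIV. [:v i, w i:] ^ Poly_Mapping.lookup t i))"

lemma on_line_superset:
  assumes "finite A" "Poly_Mapping.keys f \<subseteq> A"
  shows "on_line v w f = (\<Sum>t\<in>A.
     [:Poly_Mapping.lookup f t:] * (\<Prod>i\<in>UNIV. [:v i, w i:] ^ Poly_Mapping.lookup t i))"
  unfolding on_line_def using assms by (intro sum.mono_neutral_left) (auto simp: in_keys_iff)

lemma on_line_single:
  "on_line v w (Poly_Mapping.single t c) = [:c:] * (\<Prod>i\<in>UNIV. [:v i, w i:] ^ Poly_Mapping.lookup t i)"
  by (subst on_line_superset[of "{t}"]) auto

lemma on_line_add: "on_line v w (f + g) = on_line v w f + on_line v w g"
proof -
  let ?A = "Poly_Mapping.keys f \<union> Poly_Mapping.keys g"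
  show ?thesis
    using keys_add[of f g]
    by (subst (1 2 3) on_line_superset[of ?A])
      (auto simp: lookup_add sum.distrib[symmetric] distrib_right[symmetric] simp del: mult_pCons_left)
qed

lemma on_line_zero [simp]: "on_line v w 0 = 0"
  by (simp add: on_line_def)

lemma on_line_sum: "on_line v w (\<Sum>a\<in>A. f a) = (\<Sum>a\<in>A. on_line v w (f a))"
  by (induction A rule: infinite_finite_induct) (auto simp: on_line_add)

lemma on_line_mult:
  fixes f g :: "('v::finite, 'k::field) mpoly_ring"
  shows "on_line v w (f * g) = on_line v w f * on_line v w g"
proof -
  let ?s = "\<lambda>(f::('v, 'k) mpoly_ring) t. Poly_Mapping.single t (Poly_Mapping.lookup f t)"
  have *: "on_line v w (?s f s * ?s g t) = on_line v w (?s f s) * on_line v w (?s g t)" for s t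
    by (simp add: mult_single on_line_single lookup_add power_add prod.distrib ac_simps
        del: mult_pCons_left mult_pCons_right) (simp add: ac_simps)
  have "on_line v w (f * g) =
      on_line v w ((\<Sum>s\<in>Poly_Mapping.keys f. ?s f s) * (\<Sum>t\<in>Poly_Mapping.keys g. ?s g t))"
    by (simp add: mpoly_eq_sum_single)
  also have "\<dots> = on_line v w (\<Sum>s\<in>Poly_Mapping.keys f. ?s f s) * on_line v w (\<Sum>t\<in>Poly_Mapping.keys g. ?s g t)"
    by (simp only: sum_product on_line_sum *)
  finally show ?thesis by (simp add: mpoly_eq_sum_single)
qed

lemma on_line_const: "on_line v w (const c) = [:c:]"
  by (simp add: const_def on_line_single)

lemma on_line_one [simp]: "on_line v w 1 = 1"
  using on_line_const[of v w 1] by (simp add: one_pCons)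

lemma on_line_power: "on_line v w (f ^ k) = on_line v w f ^ k"
  by (induction k) (auto simp: on_line_mult)

lemma on_line_prod: "on_line v w (\<Prod>i\<in>A. f i) = (\<Prod>i\<in>A. on_line v w (f i))"
  by (induction A rule: infinite_finite_induct) (auto simp: on_line_mult)

lemma on_line_var:
  fixes v w :: "'v::finite \<Rightarrow> 'k::field"
  shows "on_line v w (var i) = [:v i, w i:]"
proof -
  have "(\<Prod>j\<in>UNIV. [:v j, w j:] ^ Poly_Mapping.lookup (Poly_Mapping.single i 1 :: 'v \<Rightarrow>\<^sub>0 nat) j)
      = (\<Prod>j\<in>UNIV. if j = i then [:v i, w i:] else 1)"
    by (intro prod.cong) (auto simp: lookup_single when_def)
  then show ?thesis by (simp add: var_def on_line_single)
qed

lemma poly_on_line: "poly (on_line v w f) c = eval_at (\<lambda>i. v i + c * w i) f"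
  by (simp add: on_line_def eval_at_def poly_sum poly_prod)

lemma eval_at_eq_on_line: "eval_at v f = poly (on_line v (\<lambda>_. 0) f) 0"
  by (simp add: poly_on_line)

lemma eval_at_eq_coeff: "eval_at v f = coeff (on_line v w f) 0"
  using poly_on_line[of v w f 0] by (simp add: poly_0_coeff_0)

lemma eval_at_add: "eval_at v (f + g) = eval_at v f + eval_at v (g :: ('v::finite, 'k::field) mpoly_ring)"
  by (simp add: eval_at_eq_on_line on_line_add)

lemma eval_at_mult: "eval_at v (f * g) = eval_at v f * eval_at v (g :: ('v::finite, 'k::field) mpoly_ring)"
  by (simp add: eval_at_eq_on_line on_line_mult)

lemma eval_at_sum:
  "eval_at v (\<Sum>a\<in>A. f a) = (\<Sum>a\<in>A. eval_at v (f a :: ('v::finite, 'k::field) mpoly_ring))"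
  by (simp add: eval_at_eq_on_line on_line_sum poly_sum)

lemma eval_at_prod:
  "eval_at v (\<Prod>a\<in>A. f a) = (\<Prod>a\<in>A. eval_at v (f a :: ('v::finite, 'k::field) mpoly_ring))"
  by (simp add: eval_at_eq_on_line on_line_prod poly_prod)

lemma eval_at_zero [simp]: "eval_at v 0 = 0"
  by (simp add: eval_at_def)

lemma eval_at_const: "eval_at v (const c) = (c :: 'k::field)"
  by (simp add: eval_at_eq_on_line on_line_const)

lemma eval_at_var: "eval_at v (var i) = (v i :: 'k::field)"
  by (simp add: eval_at_eq_on_line on_line_var)

lemma eval_at_uminus: "eval_at v (- f) = - eval_at v (f :: ('v::finite, 'k::field) mpoly_ring)"
  using eval_at_add[of v f "- f"] by (simp add: eq_neg_iff_add_eq_0 add.commute)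

lemma eval_at_minus: "eval_at v (f - g) = eval_at v f - eval_at v (g :: ('v::finite, 'k::field) mpoly_ring)"
  using eval_at_add[of v f "- g"] by (simp add: eval_at_uminus)

definition dir_deriv :: "('v::finite \<Rightarrow> 'k) \<Rightarrow> ('v \<Rightarrow> 'k) \<Rightarrow> ('v, 'k::field) mpoly_ring \<Rightarrow> 'k" where
  "dir_deriv v w f = coeff (on_line v w f) 1"

lemma dir_deriv_add: "dir_deriv v w (f + g) = dir_deriv v w f + dir_deriv v w g"
  by (simp add: dir_deriv_def on_line_add)

lemma dir_deriv_zero [simp]: "dir_deriv v w 0 = 0"
  by (simp add: dir_deriv_def)

lemma dir_deriv_sum: "dir_deriv v w (\<Sum>a\<in>A. f a) = (\<Sum>a\<in>A. dir_deriv v w (f a))"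
  by (induction A rule: infinite_finite_induct) (auto simp: dir_deriv_add)

lemma dir_deriv_mult: "dir_deriv v w (f * g) = eval_at v f * dir_deriv v w g + dir_deriv v w f * eval_at v g"
  by (simp add: dir_deriv_def on_line_mult coeff_mult eval_at_eq_coeff[of v _ w])

lemma dir_deriv_var: "dir_deriv v w (var i) = w i"
  by (simp add: dir_deriv_def on_line_var)

lemma dir_deriv_const: "dir_deriv v w (const c) = 0"
  by (simp add: dir_deriv_def on_line_const)

text \<open>The t-coefficient of f(v + t w) is not visibly linear in \<open>w\<close>; the product
  rule carries linearity over from the variables. It lets derivatives be written through the
  Jacobian matrix.\<close>

lemma dir_deriv_linear:
  fixes f :: "('v::finite, 'k::field) mpoly_ring"
  shows "dir_deriv v w f = (\<Sum>i\<in>UNIV. w i * dir_deriv v (\<lambda>j. of_bool (j = i)) f)"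
proof (induction f rule: mpoly_induct)
  case (const c)
  then show ?case by (simp add: dir_deriv_const)
next
  case (var i f)
  have "(\<Sum>j\<in>UNIV. w j * (of_bool (i = j) * eval_at v f)) = w i * eval_at v f"
    by (simp add: of_bool_def if_distrib[of "\<lambda>x. _ * x"] if_distrib[of "\<lambda>x. x * _"] cong: if_cong)
  then show ?case using var
    by (simp add: dir_deriv_mult dir_deriv_var eval_at_var distrib_left sum.distrib sum_distrib_left ac_simps)
next
  case (add f g)
  then show ?case by (simp add: dir_deriv_add distrib_left sum.distrib)
qed

lemma homog_part_eval_at_scale:
  fixes f :: "('v::finite, 'k::field) mpoly_ring"
  shows "eval_at (\<lambda>i. c * v i) f =
    (\<Sum>e\<in>mon_degree ` Poly_Mapping.keys f. c ^ e * eval_at v (restrict_degrees (\<lambda>d. d = int e) f))"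
proof -
  have h: "eval_at (\<lambda>i. c * v i) g = c ^ e * eval_at v g"
    if "g \<in> homog_part (int e)" for g :: "('v, 'k) mpoly_ring" and e
  proof -
    have "(\<Prod>i\<in>UNIV. (c * v i) ^ Poly_Mapping.lookup t i) = c ^ e * (\<Prod>i\<in>UNIV. v i ^ Poly_Mapping.lookup t i)"
      if "t \<in> Poly_Mapping.keys g" for t
    proof -
      have "(\<Prod>i\<in>UNIV. c ^ Poly_Mapping.lookup t i) = c ^ mon_degree t"
        by (simp add: mon_degree_def power_sum)
      moreover have "mon_degree t = e"
        using that \<open>g \<in> homog_part (int e)\<close> by (simp add: homog_part_def)
      ultimately show ?thesis by (simp add: power_mult_distrib prod.distrib)
    qed
    then show ?thesis
      by (simp add: eval_at_def sum_distrib_left ac_simps)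
  qed
  have "f = (\<Sum>e\<in>mon_degree ` Poly_Mapping.keys f. restrict_degrees (\<lambda>d. d = int e) f)"
    by (rule poly_mapping_eqI) (auto simp: lookup_sum in_keys_iff sum.delta)
  then have "eval_at (\<lambda>i. c * v i) f =
      (\<Sum>e\<in>mon_degree ` Poly_Mapping.keys f. eval_at (\<lambda>i. c * v i) (restrict_degrees (\<lambda>d. d = int e) f))"
    by (metis eval_at_sum)
  also have "\<dots> = (\<Sum>e\<in>mon_degree ` Poly_Mapping.keys f. c ^ e * eval_at v (restrict_degrees (\<lambda>d. d = int e) f))"
    by (intro sum.cong refl h) (simp add: homog_part_eq restrict_degrees_in)
  finally show ?thesis .
qed


section \<open>Monomials in a family of ring elements\<close>

text \<open>Functions vanishing from \<open>n\<close> on, so that raising or lowering one exponent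
  is a function update; the lists of the statement enter only through
  \<open>exponent_of\<close>.\<close>

definition exponents :: "nat \<Rightarrow> nat \<Rightarrow> (nat \<Rightarrow> nat) set" where
  "exponents n m = {a. (\<forall>i\<ge>n. a i = 0) \<and> sum a {..<n} = m}"

definition monomial_in :: "nat \<Rightarrow> (nat \<Rightarrow> 'r::comm_ring_1) \<Rightarrow> (nat \<Rightarrow> nat) \<Rightarrow> 'r" where
  "monomial_in n F a = (\<Prod>i<n. F i ^ a i)"

text \<open>The m-th power of the ideal of the \<open>F i\<close>, written with explicit coefficient
  families because the later arguments are about these coefficients.\<close>

definition monomial_ideal :: "nat \<Rightarrow> (nat \<Rightarrow> 'r::comm_ring_1) \<Rightarrow> nat \<Rightarrow> 'r set" where
  "monomial_ideal n F m = {\<Sum>a\<in>exponents n m. c a * monomial_in n F a | c. True}"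

lemma finite_exponents: "finite (exponents n m)"
proof (rule finite_subset)
  show "exponents n m \<subseteq> {a. \<forall>i. (i \<in> {..<n} \<longrightarrow> a i \<in> {..m}) \<and> (i \<notin> {..<n} \<longrightarrow> a i = 0)}"
    by (auto simp: exponents_def intro: member_le_sum)
qed (intro finite_set_of_finite_funs; simp)

lemma exponents_Suc_iff:
  assumes "i < n"
  shows "a(i := Suc (a i)) \<in> exponents n (Suc m) \<longleftrightarrow> a \<in> exponents n m"
proof -
  have "sum (a(i := Suc (a i))) {..<n} = Suc (sum a {..<n})"
    using assms by (simp add: sum.remove[of "{..<n}" i])
  then show ?thesis using assms by (auto simp: exponents_def)
qed

lemma exponents_pos:
  assumes "a \<in> exponents n (Suc m)"
  obtains i where "i < n" "a i > 0"
  using assms unfolding exponents_def by (metis (mono_tags, lifting) lessThan_iff mem_Collect_eq neq0_conv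
      sum.neutral old.nat.distinct(2))

lemma exponents_0: "exponents n 0 = {\<lambda>_. 0}"
  by (auto simp: exponents_def not_le[symmetric] fun_eq_iff) (meson lessThan_iff not_le)

lemma monomial_in_Suc: "i < n \<Longrightarrow> monomial_in n F (a(i := Suc (a i))) = F i * monomial_in n F a"
  by (simp add: monomial_in_def prod.remove[of "{..<n}" i] mult.assoc)

lemma monomial_in_zero [simp]: "monomial_in n F (\<lambda>_. 0) = 1"
  by (simp add: monomial_in_def)

lemma monomial_ideal_zero [simp]: "0 \<in> monomial_ideal n F m"
  unfolding monomial_ideal_def by (auto intro!: exI[of _ "\<lambda>_. 0"])

lemma monomial_ideal_add:
  assumes "f \<in> monomial_ideal n F m" "g \<in> monomial_ideal n F m"
  shows "f + g \<in> monomial_ideal n F m"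
proof -
  obtain c d where "f = (\<Sum>a\<in>exponents n m. c a * monomial_in n F a)"
    "g = (\<Sum>a\<in>exponents n m. d a * monomial_in n F a)"
    using assms by (auto simp: monomial_ideal_def)
  then have "f + g = (\<Sum>a\<in>exponents n m. (c a + d a) * monomial_in n F a)"
    by (simp add: sum.distrib distrib_right)
  then show ?thesis by (auto simp: monomial_ideal_def)
qed

lemma monomial_ideal_mult:
  assumes "f \<in> monomial_ideal n F m"
  shows "r * f \<in> monomial_ideal n F m"
proof -
  obtain c where "f = (\<Sum>a\<in>exponents n m. c a * monomial_in n F a)"
    using assms by (auto simp: monomial_ideal_def)
  then have "r * f = (\<Sum>a\<in>exponents n m. (r * c a) * monomial_in n F a)"
    by (simp add: sum_distrib_left mult.assoc)
  then show ?thesis unfolding monomial_ideal_def by (auto intro!: exI[of _ "\<lambda>a. r * c a"])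
qed

lemma monomial_ideal_sum:
  "(\<And>i. i \<in> A \<Longrightarrow> f i \<in> monomial_ideal n F m) \<Longrightarrow> (\<Sum>i\<in>A. f i) \<in> monomial_ideal n F m"
  by (induction A rule: infinite_finite_induct) (auto simp: monomial_ideal_add)

lemma monomial_in_mem:
  assumes "a \<in> exponents n m"
  shows "monomial_in n F a \<in> monomial_ideal n F m"
proof -
  have "monomial_in n F a = (\<Sum>b\<in>exponents n m. of_bool (b = a) * monomial_in n F b)"
    using assms finite_exponents by (simp add: of_bool_def if_distrib[of "\<lambda>x. x * _"] cong: if_cong)
  then show ?thesis by (auto simp: monomial_ideal_def)
qed

lemma monomial_ideal_0 [simp]: "monomial_ideal n F 0 = UNIV"
  by (auto simp: monomial_ideal_def exponents_0 intro!: exI[of _ "\<lambda>_. x" for x])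

lemma mult_mem_monomial_ideal_Suc:
  assumes "i < n" "f \<in> monomial_ideal n F m"
  shows "F i * f \<in> monomial_ideal n F (Suc m)"
proof -
  obtain c where f: "f = (\<Sum>a\<in>exponents n m. c a * monomial_in n F a)"
    using assms by (auto simp: monomial_ideal_def)
  have "F i * f = (\<Sum>a\<in>exponents n m. c a * monomial_in n F (a(i := Suc (a i))))"
    by (simp add: f sum_distrib_left monomial_in_Suc assms ac_simps)
  also have "\<dots> \<in> monomial_ideal n F (Suc m)"
    using assms by (intro monomial_ideal_sum monomial_ideal_mult monomial_in_mem) (simp add: exponents_Suc_iff)
  finally show ?thesis .
qed

lemma ideal_gen_nth:
  "ideal_gen (set Fs) = {\<Sum>i<length Fs. b i * Fs ! i | b. True}" (is "?L = ?R")
proof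
  have "module.subspace (*) ?R"
    unfolding module.subspace_def[OF module_mult]
  proof safe
    show "\<exists>b. 0 = (\<Sum>i<length Fs. b i * Fs ! i) \<and> True"
      by (intro exI[of _ "\<lambda>_. 0"]) simp
  next
    fix b c
    show "\<exists>d. (\<Sum>i<length Fs. b i * Fs ! i) + (\<Sum>i<length Fs. c i * Fs ! i)
        = (\<Sum>i<length Fs. d i * Fs ! i) \<and> True"
      by (intro exI[of _ "\<lambda>i. b i + c i"]) (simp add: sum.distrib distrib_right)
  next
    fix r b
    show "\<exists>d. r * (\<Sum>i<length Fs. b i * Fs ! i) = (\<Sum>i<length Fs. d i * Fs ! i) \<and> True"
      by (intro exI[of _ "\<lambda>i. r * b i"]) (simp add: sum_distrib_left mult.assoc)
  qed
  moreover have "set Fs \<subseteq> ?R"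
  proof
    fix x assume "x \<in> set Fs"
    then obtain j where "j < length Fs" "x = Fs ! j" by (auto simp: in_set_conv_nth)
    then have "x = (\<Sum>i<length Fs. of_bool (i = j) * Fs ! i)"
      by (simp add: of_bool_def if_distrib[of "\<lambda>x. x * _"] cong: if_cong)
    then show "x \<in> ?R" by (auto intro!: exI[of _ "\<lambda>i. of_bool (i = j)"])
  qed
  ultimately show "?L \<subseteq> ?R" by (intro module.span_minimal[OF module_mult])
  show "?R \<subseteq> ?L"
  proof safe
    fix b
    show "(\<Sum>i<length Fs. b i * Fs ! i) \<in> ?L"
      by (intro module.span_sum[OF module_mult] module.span_scale[OF module_mult]
          module.span_base[OF module_mult]) simp
  qed
qed

lemma sum_monomial_in_mem_Suc:
  assumes "length Fs = n" "\<And>a. a \<in> exponents n m \<Longrightarrow> c a \<in> ideal_gen (set Fs)"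
  shows "(\<Sum>a\<in>exponents n m. c a * monomial_in n ((!) Fs) a) \<in> monomial_ideal n ((!) Fs) (Suc m)"
proof (rule monomial_ideal_sum)
  fix a assume a: "a \<in> exponents n m"
  then obtain b where "c a = (\<Sum>i<n. b i * Fs ! i)"
    using assms unfolding ideal_gen_nth by blast
  then have "c a * monomial_in n ((!) Fs) a = (\<Sum>i<n. b i * (Fs ! i * monomial_in n ((!) Fs) a))"
    by (simp add: sum_distrib_right mult.assoc)
  also have "\<dots> \<in> monomial_ideal n ((!) Fs) (Suc m)"
    using a by (intro monomial_ideal_sum monomial_ideal_mult mult_mem_monomial_ideal_Suc monomial_in_mem) auto
  finally show "c a * monomial_in n ((!) Fs) a \<in> monomial_ideal n ((!) Fs) (Suc m)" .
qed


section \<open>Ideals of points\<close>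

text \<open>A polynomial function that is zero on an infinite field has zero coefficients, shown one
  variable at a time. Exponents in \<open>A\<close> may still agree on all of \<open>I\<close>,
  hence the sum over a fibre.\<close>

lemma sum_monomials_eq_0:
  fixes c :: "('i \<Rightarrow> nat) \<Rightarrow> 'k::field_char_0"
  assumes "finite I" "finite A" "\<And>y. (\<Sum>a\<in>A. c a * (\<Prod>i\<in>I. y i ^ a i)) = 0"
  shows "(\<Sum>a | a \<in> A \<and> (\<forall>i\<in>I. a i = b i). c a) = 0"
  using assms
proof (induction I arbitrary: A rule: finite_induct)
  case empty
  then show ?case by simp
next
  case (insert i I)
  let ?A = "{a \<in> A. a i = b i}"
  have "(\<Sum>a\<in>?A. c a * (\<Prod>j\<in>I. y j ^ a j)) = 0" for y
  proof -
    \<comment> \<open>The sum seen as a polynomial in the new variable alone; its coefficient at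
      \<open>b i\<close> is the sum over \<open>?A\<close> in the remaining variables.\<close>
    let ?p = "\<Sum>a\<in>A. monom (c a * (\<Prod>j\<in>I. y j ^ a j)) (a i)"
    have "poly ?p z = 0" for z
    proof -
      have "(\<Prod>j\<in>I. (y(i := z)) j ^ a j) = (\<Prod>j\<in>I. y j ^ a j)" for a :: "'i \<Rightarrow> nat"
        using insert.hyps by (intro prod.cong) auto
      then show ?thesis
        using insert.prems(2)[of "y(i := z)"] insert.hyps by (simp add: poly_sum poly_monom ac_simps)
    qed
    then have "?p = 0" using poly_all_0_iff_0 by blast
    then have "coeff ?p (b i) = 0" by simp
    then show ?thesis
      using \<open>finite A\<close> by (simp add: coeff_sum sum.inter_filter[symmetric])
  qed
  then have "(\<Sum>a | a \<in> ?A \<and> (\<forall>j\<in>I. a j = b j). c a) = 0"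
    using insert.prems(1) by (intro insert.IH) auto
  moreover have "{a \<in> ?A. \<forall>j\<in>I. a j = b j} = {a \<in> A. \<forall>j\<in>insert i I. a j = b j}"
    by auto
  ultimately show ?case by simp
qed

section \<open>Homogeneous coordinates, vanishing ideals and separation of points\<close>

lemma proj_space_nonzero: "P \<in> proj_space \<Longrightarrow> v \<in> P \<Longrightarrow> \<exists>j. v j \<noteq> 0"
  unfolding proj_space_def by (auto simp: fun_eq_iff)

lemma proj_space_eqI:
  assumes "P \<in> proj_space" "v \<in> P"
  shows "P = {w. \<exists>c. c \<noteq> 0 \<and> w = (\<lambda>i. c * v i)}"
proof -
  obtain u where P: "P = {w. \<exists>c. c \<noteq> 0 \<and> w = (\<lambda>i. c * u i)}"
    using assms by (auto simp: proj_space_def)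
  then obtain d where d: "d \<noteq> 0" "v = (\<lambda>i. d * u i)" using assms by auto
  show ?thesis unfolding P
  proof safe
    fix c :: 'b assume "c \<noteq> 0"
    then show "\<exists>e. e \<noteq> 0 \<and> (\<lambda>i. c * u i) = (\<lambda>i. e * v i)"
      using d by (intro exI[of _ "c / d"]) auto
  next
    fix c :: 'b assume "c \<noteq> 0"
    then show "\<exists>e. e \<noteq> 0 \<and> (\<lambda>i. c * v i) = (\<lambda>i. e * u i)"
      using d by (intro exI[of _ "c * d"]) (auto simp: mult.assoc)
  qed
qed

lemma eval_at_vanishing_ideal:
  fixes X :: "('v::finite \<Rightarrow> 'k::field) set set"
  assumes "f \<in> vanishing_ideal X" "P \<in> X" "v \<in> P"
  shows "eval_at v f = 0"
proof -
  have "module.subspace (*) {f. eval_at v f = 0}"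
    by (auto simp: module.subspace_def[OF module_mult] eval_at_add eval_at_mult)
  then have "vanishing_ideal X \<subseteq> {f. eval_at v f = 0}"
    unfolding vanishing_ideal_def using assms by (intro module.span_minimal[OF module_mult]) auto
  with assms show ?thesis by auto
qed

text \<open>The ideal is generated by homogeneous forms only. An arbitrary f that vanishes on P
  vanishes at c v for all nonzero c; as a polynomial in c it has infinitely many roots, so each
  homogeneous component of f vanishes at v.\<close>

lemma vanishing_ideal_iff:
  fixes X :: "('v::finite \<Rightarrow> 'k::field_char_0) set set"
  assumes X: "X \<subseteq> proj_space"
  shows "f \<in> vanishing_ideal X \<longleftrightarrow> (\<forall>P\<in>X. \<forall>v\<in>P. eval_at v f = 0)"
proof safe
  assume f: "\<forall>P\<in>X. \<forall>v\<in>P. eval_at v f = 0"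
  let ?h = "\<lambda>e. restrict_degrees (\<lambda>d. d = e) f"
  have comp: "eval_at v (?h (int e)) = 0" if P: "P \<in> X" "v \<in> P" for P v e
  proof -
    let ?E = "mon_degree ` Poly_Mapping.keys f"
    let ?p = "\<Sum>e\<in>?E. monom (eval_at v (?h (int e))) e"
    have "poly ?p c = 0" if "c \<noteq> 0" for c
    proof -
      have "(\<lambda>i. c * v i) \<in> P"
        using proj_space_eqI[of P v] X P that by auto
      then have "eval_at (\<lambda>i. c * v i) f = 0" using f P by auto
      then show ?thesis by (simp add: homog_part_eval_at_scale poly_sum poly_monom ac_simps)
    qed
    then have "- {0} \<subseteq> {c. poly ?p c = 0}" by auto
    moreover have "infinite (- {0 :: 'k})"
      by (simp add: Compl_eq_Diff_UNIV infinite_UNIV_char_0)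
    ultimately have "?p = 0" using poly_roots_finite infinite_super by blast
    then have "coeff ?p e = 0" by simp
    then have "e \<in> ?E \<Longrightarrow> ?thesis" by (simp add: coeff_sum)
    moreover have "?h (int e) = 0" if "e \<notin> ?E"
      using that by (intro poly_mapping_eqI) (auto simp: in_keys_iff image_iff)
    ultimately show ?thesis by (cases "e \<in> ?E") simp_all
  qed
  have "(\<Sum>e\<in>(\<lambda>t. int (mon_degree t)) ` Poly_Mapping.keys f. ?h e) \<in> vanishing_ideal X"
    unfolding vanishing_ideal_def
  proof (intro module.span_sum[OF module_mult] module.span_base[OF module_mult] CollectI conjI ballI)
    fix e assume "e \<in> (\<lambda>t. int (mon_degree t)) ` Poly_Mapping.keys f"
    then obtain e' where e': "e = int e'" by auto
    show "\<exists>e'. ?h e \<in> homog_part e'"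
      using restrict_degrees_in[of "\<lambda>d. d = e" f] by (auto simp: homog_part_eq)
    show "eval_at v (?h e) = 0" if "P \<in> X" "v \<in> P" for P v
      using comp[OF that] e' by simp
  qed
  then show "f \<in> vanishing_ideal X" by (simp add: sum_homogeneous_parts)
qed (use eval_at_vanishing_ideal in blast)

text \<open>The forms u_i0 x_i - u_i x_i0 vanish on Q, the point of u. If all of them vanished at v,
  then v would be proportional to u.\<close>

lemma separating_linear_form:
  fixes v :: "'v::finite \<Rightarrow> 'k::field"
  assumes "P \<in> proj_space" "Q \<in> proj_space" "P \<noteq> Q" "v \<in> P"
  shows "\<exists>l. (\<forall>w\<in>Q. eval_at w l = 0) \<and> eval_at v l \<noteq> 0"
proof (rule ccontr)
  assume contra: "\<not> ?thesis"
  obtain u where Q: "Q = {w. \<exists>c. c \<noteq> 0 \<and> w = (\<lambda>i. c * u i)}" and "u \<noteq> (\<lambda>_. 0)"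
    using assms(2) by (auto simp: proj_space_def)
  then obtain i0 where i0: "u i0 \<noteq> 0" by auto
  have "u i0 * v i - u i * v i0 = 0" for i
  proof -
    let ?l = "const (u i0) * var i - const (u i) * var i0"
    have "eval_at w ?l = u i0 * w i - u i * w i0" for w
      by (simp add: eval_at_minus eval_at_mult eval_at_const eval_at_var)
    moreover have "\<forall>w\<in>Q. u i0 * w i - u i * w i0 = 0" by (auto simp: Q)
    ultimately show ?thesis using contra by metis
  qed
  then have v: "v = (\<lambda>i. (v i0 / u i0) * u i)"
    using i0 by (auto simp: field_simps)
  moreover have "v i0 \<noteq> 0"
    using v proj_space_nonzero[OF assms(1,4)] by (metis div_0 mult_zero_left)
  ultimately have "v \<in> Q" using i0 by (auto simp: Q intro!: exI[of _ "v i0 / u i0"])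
  then show False
    using proj_space_eqI[of P v] proj_space_eqI[of Q v] assms by blast
qed

lemma separating_form:
  fixes v :: "'v::finite \<Rightarrow> 'k::field"
  assumes "finite X" "X \<subseteq> proj_space" "P \<in> X" "v \<in> P"
  shows "\<exists>g. (\<forall>Q\<in>X - {P}. \<forall>w\<in>Q. eval_at w g = 0) \<and> eval_at v g \<noteq> 0"
proof -
  have "\<exists>l. (\<forall>w\<in>Q. eval_at w l = 0) \<and> eval_at v l \<noteq> 0" if "Q \<in> X - {P}" for Q
    using separating_linear_form[of P Q v] that assms by auto
  then obtain l where l: "\<And>Q. Q \<in> X - {P} \<Longrightarrow> (\<forall>w\<in>Q. eval_at w (l Q) = 0) \<and> eval_at v (l Q) \<noteq> 0"
    by metis
  have "eval_at w (\<Prod>Q\<in>X - {P}. l Q) = 0" if "Q \<in> X - {P}" "w \<in> Q" for Q w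
    using that l assms(1) by (auto simp: eval_at_prod intro!: prod_zero)
  moreover have "eval_at v (\<Prod>Q\<in>X - {P}. l Q) \<noteq> 0"
    using l assms(1) by (auto simp: eval_at_prod)
  ultimately show ?thesis by blast
qed

text \<open>Differentiating \<open>b\<close> at \<open>v\<close>, where the \<open>F i\<close>
  vanish, along coordinate r gives that the sum of \<open>b j i\<close> at \<open>v\<close> times
  the r-th derivative of \<open>F i\<close> is g(v) v_j0 if r = j and 0 otherwise, for r and j
  different from \<open>j0\<close>. So the Jacobian without column \<open>j0\<close> is an n by n
  matrix with a left inverse up to the factor \<open>?k\<close>, and a left inverse of a square
  matrix is a right inverse.\<close>

lemma dir_deriv_surj:
  fixes F :: "nat \<Rightarrow> ('v::finite, 'k::field) mpoly_ring"
  assumes card: "card (UNIV :: 'v set) = n + 1" and j0: "v j0 \<noteq> 0"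
    and F: "\<And>i. i < n \<Longrightarrow> eval_at v (F i) = 0" and g: "eval_at v g \<noteq> 0"
    and b: "\<And>j. g * (const (v j0) * var j - const (v j) * var j0) = (\<Sum>i<n. b j i * F i)"
  shows "\<exists>w. \<forall>i<n. dir_deriv v w (F i) = y i"
proof -
  let ?e = "\<lambda>j k. of_bool (k = j) :: 'k"
  have "card (UNIV - {j0}) = n" using card by simp
  then obtain h where h: "bij_betw h {..<n} (UNIV - {j0})"
    using finite_same_card_bij[of "{..<n}" "UNIV - {j0}"] by auto
  have h_eq: "h r = h s \<longleftrightarrow> r = s" if "r < n" "s < n" for r s
    using h that by (auto simp: bij_betw_def inj_on_def)
  have h_ne: "h r \<noteq> j0" if "r < n" for r
    using h that by (auto simp: bij_betw_def)
  let ?k = "eval_at v g * v j0"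
  define B where "B = mat n n (\<lambda>(r, i). eval_at v (b (h r) i) / ?k)"
  define D where "D = mat n n (\<lambda>(i, r). dir_deriv v (?e (h r)) (F i))"
  have "(\<Sum>i<n. eval_at v (b (h r) i) * dir_deriv v (?e (h s)) (F i)) = ?k * of_bool (r = s)"
    if rs: "r < n" "s < n" for r s
  proof -
    have "(\<Sum>i<n. eval_at v (b (h r) i) * dir_deriv v (?e (h s)) (F i)) =
        dir_deriv v (?e (h s)) (\<Sum>i<n. b (h r) i * F i)"
      by (simp add: dir_deriv_sum dir_deriv_mult F)
    also have "\<dots> = dir_deriv v (?e (h s)) (g * (const (v j0) * var (h r) + const (- v (h r)) * var j0))"
      by (simp add: b[symmetric] const_def single_uminus)
    also have "\<dots> = ?k * of_bool (r = s)"
      using h_ne[OF rs(2)] h_eq[OF rs]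
      by (auto simp: dir_deriv_mult dir_deriv_add dir_deriv_const dir_deriv_var eval_at_add eval_at_mult
          eval_at_const eval_at_var)
    finally show ?thesis .
  qed
  then have "B * D = 1\<^sub>m n"
    using g j0 by (intro eq_matI)
      (auto simp: B_def D_def scalar_prod_def sum_divide_distrib[symmetric] atLeast0LessThan of_bool_def)
  then have "D * B = 1\<^sub>m n"
    by (rule mat_mult_left_right_inverse[rotated 2]) (auto simp: B_def D_def)
  then have DB: "(\<Sum>r<n. D $$ (i, r) * B $$ (r, l)) = of_bool (i = l)" if "i < n" "l < n" for i l
  proof -
    have "(D * B) $$ (i, l) = (\<Sum>r<n. D $$ (i, r) * B $$ (r, l))"
      using that by (simp add: B_def D_def scalar_prod_def atLeast0LessThan)
    then show ?thesis using that by (cases "i = l") (simp_all add: \<open>D * B = 1\<^sub>m n\<close>)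
  qed
  \<comment> \<open>\<open>w\<close> is B y carried along \<open>h\<close> to the coordinates other
    than \<open>j0\<close>; then D B = 1 gives the derivatives \<open>y\<close>.\<close>
  define w where "w j = (if j = j0 then 0 else \<Sum>l<n. B $$ (inv_into {..<n} h j, l) * y l)" for j
  have w_h: "w (h r) = (\<Sum>l<n. B $$ (r, l) * y l)" if "r < n" for r
    using h that h_ne[OF that] by (simp add: w_def bij_betw_def)
  have "dir_deriv v w (F i) = y i" if i: "i < n" for i
  proof -
    have "dir_deriv v w (F i) = (\<Sum>j\<in>UNIV - {j0}. w j * dir_deriv v (?e j) (F i))"
      unfolding dir_deriv_linear[of v w] by (simp add: sum.remove[of UNIV j0] w_def)
    also have "\<dots> = (\<Sum>r<n. w (h r) * D $$ (i, r))"
      using i by (simp add: D_def sum.reindex_bij_betw[OF h, symmetric])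
    also have "\<dots> = (\<Sum>r<n. \<Sum>l<n. D $$ (i, r) * B $$ (r, l) * y l)"
      by (simp add: w_h sum_distrib_left sum_distrib_right ac_simps)
    also have "\<dots> = (\<Sum>l<n. (\<Sum>r<n. D $$ (i, r) * B $$ (r, l)) * y l)"
      by (subst sum.swap) (simp add: sum_distrib_right)
    also have "\<dots> = (\<Sum>l<n. of_bool (i = l) * y l)"
      using i by (intro sum.cong refl) (simp add: DB)
    also have "\<dots> = y i"
      using i by (simp add: of_bool_def if_distrib[of "\<lambda>x. x * _"] cong: if_cong)
    finally show ?thesis .
  qed
  then show ?thesis by blast
qed

section \<open>Order of vanishing on lines through a point\<close>

lemma pCons_0_dvd_iff: "[:0, 1:] dvd p \<longleftrightarrow> coeff p 0 = (0 :: 'k::field)"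
  using poly_eq_0_iff_dvd[of p 0] by (simp add: poly_0_coeff_0)

lemma ideal_power_on_line:
  fixes v :: "'v::finite \<Rightarrow> 'k::field"
  assumes "f \<in> ideal_power (vanishing_ideal {P}) m" "v \<in> P"
  shows "[:0, 1:] ^ m dvd on_line v w f"
  using assms(1)
proof (induction m arbitrary: f)
  case (Suc m)
  have "module.subspace (*) {f. [:0, 1:] ^ Suc m dvd on_line v w f}"
    by (auto simp: module.subspace_def[OF module_mult] on_line_add on_line_mult simp del: power_Suc)
  moreover have "{a * b | a b. a \<in> vanishing_ideal {P} \<and> b \<in> ideal_power (vanishing_ideal {P}) m}
      \<subseteq> {f. [:0, 1:] ^ Suc m dvd on_line v w f}"
  proof safe
    fix a b :: "('v, 'k) mpoly_ring"
    assume "a \<in> vanishing_ideal {P}" and b: "b \<in> ideal_power (vanishing_ideal {P}) m"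
    then have "eval_at v a = 0" using assms(2) by (auto intro: eval_at_vanishing_ideal)
    then have "[:0, 1:] dvd on_line v w a"
      by (simp add: pCons_0_dvd_iff eval_at_eq_coeff[of v a w])
    with Suc.IH[OF b] show "[:0, 1:] ^ Suc m dvd on_line v w (a * b)"
      by (simp add: on_line_mult mult_dvd_mono del: mult_pCons_left)
  qed
  ultimately have "ideal_power (vanishing_ideal {P}) (Suc m) \<subseteq> {f. [:0, 1:] ^ Suc m dvd on_line v w f}"
    unfolding ideal_power.simps by (rule module.span_minimal[OF module_mult, rotated])
  with Suc.prems show ?case by blast
qed simp

text \<open>The coefficient of \<open>t\<^sup>m\<close> of \<open>f (v + t w)\<close> is \<open>\<Sum>\<^sub>a c\<^sub>a(v) \<Prod>\<^sub>i (D\<^sub>w F\<^sub>i(v))\<^bsup>a i\<^esup>\<close>.\<close>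

lemma leading_coefficients_vanish:
  fixes F :: "nat \<Rightarrow> ('v::finite, 'k::field_char_0) mpoly_ring"
  assumes F: "\<And>i. i < n \<Longrightarrow> eval_at v (F i) = 0"
    and surj: "\<And>y. \<exists>w. \<forall>i<n. dir_deriv v w (F i) = y i"
    and f: "\<And>w. [:0, 1:] ^ Suc m dvd on_line v w (\<Sum>a\<in>exponents n m. c a * monomial_in n F a)"
    and b: "b \<in> exponents n m"
  shows "eval_at v (c b) = 0"
proof -
  \<comment> \<open>By \<open>surj\<close> every vector \<open>y\<close> occurs as the derivatives
    along some line, so the leading form is zero as a function of \<open>y\<close>.\<close>
  have "(\<Sum>a\<in>exponents n m. eval_at v (c a) * (\<Prod>i<n. y i ^ a i)) = 0" for y
  proof -
    obtain w where w: "\<And>i. i < n \<Longrightarrow> dir_deriv v w (F i) = y i" using surj by metis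
    have "\<exists>q. on_line v w (F i) = [:0, 1:] * q" if "i < n" for i
      using F[OF that] pCons_0_dvd_iff[of "on_line v w (F i)"]
      by (metis dvd_def eval_at_eq_coeff)
    then obtain q where q: "\<And>i. i < n \<Longrightarrow> on_line v w (F i) = [:0, 1:] * q i" by metis
    have q0: "poly (q i) 0 = y i" if "i < n" for i
      using w[OF that] q[OF that] by (simp add: dir_deriv_def poly_0_coeff_0)
    have "on_line v w (\<Sum>a\<in>exponents n m. c a * monomial_in n F a) =
        (\<Sum>a\<in>exponents n m. on_line v w (c a) * (\<Prod>i<n. ([:0, 1:] * q i) ^ a i))"
      by (simp add: on_line_sum on_line_mult on_line_prod on_line_power monomial_in_def q
          del: mult_pCons_left)
    also have "\<dots> = (\<Sum>a\<in>exponents n m. [:0, 1:] ^ m * (on_line v w (c a) * (\<Prod>i<n. q i ^ a i)))"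
    proof (rule sum.cong[OF refl])
      fix a assume "a \<in> exponents n m"
      then have "sum a {..<n} = m" by (simp add: exponents_def)
      then have "(\<Prod>i<n. ([:0, 1:] :: 'k poly) ^ a i) = [:0, 1:] ^ m" by (simp add: power_sum[symmetric])
      then show "on_line v w (c a) * (\<Prod>i<n. ([:0, 1:] * q i) ^ a i) =
          [:0, 1:] ^ m * (on_line v w (c a) * (\<Prod>i<n. q i ^ a i))"
        by (simp add: power_mult_distrib prod.distrib ac_simps del: mult_pCons_left mult_pCons_right)
    qed
    finally have "[:0, 1:] ^ m * [:0, 1:] dvd
        [:0, 1:] ^ m * (\<Sum>a\<in>exponents n m. on_line v w (c a) * (\<Prod>i<n. q i ^ a i))"
      using f[of w] by (simp add: sum_distrib_left[symmetric] mult.commute del: mult_pCons_left mult_pCons_right)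
    then have "[:0, 1:] dvd (\<Sum>a\<in>exponents n m. on_line v w (c a) * (\<Prod>i<n. q i ^ a i))"
      by (subst (asm) dvd_mult_cancel_left) simp
    then have "poly (\<Sum>a\<in>exponents n m. on_line v w (c a) * (\<Prod>i<n. q i ^ a i)) 0 = 0"
      by (simp add: pCons_0_dvd_iff poly_0_coeff_0)
    then show ?thesis
      by (simp add: poly_sum poly_prod q0 poly_on_line)
  qed
  then have "(\<Sum>a | a \<in> exponents n m \<and> (\<forall>i\<in>{..<n}. a i = b i). eval_at v (c a)) = 0"
    by (intro sum_monomials_eq_0 finite_exponents) auto
  moreover have "a = b" if "a \<in> exponents n m" "\<forall>i\<in>{..<n}. a i = b i" for a
  proof
    fix i show "a i = b i" using that b by (cases "i < n") (auto simp: exponents_def)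
  qed
  then have "{a \<in> exponents n m. \<forall>i\<in>{..<n}. a i = b i} = {b}"
    using b by blast
  ultimately show ?thesis by simp
qed

section \<open>Powers of an ideal\<close>

lemma ideal_power_ideal: "module.subspace (*) (ideal_power I m)"
  by (cases m)
    (simp_all only: ideal_power.simps module.subspace_span[OF module_mult] module.subspace_UNIV[OF module_mult])

lemma ideal_power_Suc_subset: "ideal_power I (Suc m) \<subseteq> ideal_power I m"
proof -
  have "{a * b | a b. a \<in> I \<and> b \<in> ideal_power I m} \<subseteq> ideal_power I m"
    using module.subspace_scale[OF module_mult ideal_power_ideal] by auto
  then show ?thesis
    using module.span_minimal[OF module_mult _ ideal_power_ideal] by simp
qed

lemma monomial_in_ideal_power:
  assumes "\<And>i. i < n \<Longrightarrow> F i \<in> I" "a \<in> exponents n m"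
  shows "monomial_in n F a \<in> ideal_power I m"
  using assms(2)
proof (induction m arbitrary: a)
  case (Suc m)
  obtain i where i: "i < n" "a i > 0" using exponents_pos[OF Suc.prems] .
  let ?b = "a(i := a i - 1)"
  have a: "a = ?b(i := Suc (?b i))" using i by auto
  then have "?b \<in> exponents n m"
    using Suc.prems exponents_Suc_iff[OF i(1), of ?b m] by simp
  then have "monomial_in n F ?b \<in> ideal_power I m" by (rule Suc.IH)
  moreover have "monomial_in n F a = F i * monomial_in n F ?b"
    using i(1) by (subst a) (rule monomial_in_Suc)
  ultimately show ?case
    using assms(1) i(1) by (auto intro!: module.span_base[OF module_mult])
qed simp


section \<open>Complete intersections of points\<close>

text \<open>With \<open>n\<close> generators and \<open>n + 1\<close> variables the Jacobian at a
  point becomes square once one coordinate is dropped; the inversion in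
  \<open>dir_deriv_surj\<close> rests on this count.\<close>

locale ci_points =
  fixes X :: "('v::finite \<Rightarrow> 'k::field_char_0) set set"
    and Fs :: "('v, 'k) mpoly_ring list" and n :: nat
  assumes card_vars: "card (UNIV :: 'v set) = n + 1"
    and X: "X \<subseteq> proj_space" "finite X"
    and len: "length Fs = n"
    and gen: "vanishing_ideal X = ideal_gen (set Fs)"
begin

abbreviation "F \<equiv> (!) Fs"

lemma generator_in_ideal: "i < n \<Longrightarrow> F i \<in> vanishing_ideal X"
  unfolding gen by (rule module.span_base[OF module_mult]) (simp add: len)

text \<open>Serves three times: in the induction for \<open>fat_points_ideal_eq\<close>, for the
  independence of the F^a over R / I in the Hilbert function, and, with the sum equal to 0, for
  quasi-regularity in the resolution.\<close>

lemma coefficients_in_ideal: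
  assumes f: "(\<Sum>a\<in>exponents n m. c a * monomial_in n F a) \<in> fat_points_ideal X (Suc m)"
    and b: "b \<in> exponents n m"
  shows "c b \<in> vanishing_ideal X"
  unfolding vanishing_ideal_iff[OF X(1)]
proof safe
  fix P v assume P: "P \<in> X" "v \<in> P"
  then obtain j0 where j0: "v j0 \<noteq> 0" using proj_space_nonzero X by blast
  obtain g where g: "\<And>Q w. Q \<in> X \<Longrightarrow> Q \<noteq> P \<Longrightarrow> w \<in> Q \<Longrightarrow> eval_at w g = 0" and gv: "eval_at v g \<noteq> 0"
    using separating_form[OF X(2,1) P] by blast
  \<comment> \<open>The linear form vanishes at \<open>P\<close> and \<open>g\<close> at all other
    points, so the product lies in the ideal of \<open>X\<close>.\<close>
  have "\<exists>b. g * (const (v j0) * var j - const (v j) * var j0) = (\<Sum>i<n. b i * F i)" for j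
  proof -
    have "g * (const (v j0) * var j - const (v j) * var j0) \<in> vanishing_ideal X"
      unfolding vanishing_ideal_iff[OF X(1)]
    proof (intro ballI)
      fix Q w assume Q: "Q \<in> X" "w \<in> Q"
      show "eval_at w (g * (const (v j0) * var j - const (v j) * var j0)) = 0"
      proof (cases "Q = P")
        case True
        then obtain c where "w = (\<lambda>i. c * v i)"
          using proj_space_eqI[of P v] X P Q by auto
        then show ?thesis by (simp add: eval_at_mult eval_at_minus eval_at_const eval_at_var)
      next
        case False
        then show ?thesis using g[OF Q(1) _ Q(2)] by (simp add: eval_at_mult)
      qed
    qed
    then show ?thesis unfolding gen ideal_gen_nth len by blast
  qed
  then obtain B where B: "\<And>j. g * (const (v j0) * var j - const (v j) * var j0) = (\<Sum>i<n. B j i * F i)"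
    by metis
  have F: "eval_at v (F i) = 0" if "i < n" for i
    by (rule eval_at_vanishing_ideal[OF generator_in_ideal[OF that] P])
  have surj: "\<exists>w. \<forall>i<n. dir_deriv v w (F i) = y i" for y
    by (rule dir_deriv_surj[OF card_vars j0 F gv B])
  have line: "[:0, 1:] ^ Suc m dvd on_line v w (\<Sum>a\<in>exponents n m. c a * monomial_in n F a)" for w
    using f P unfolding fat_points_ideal_def by (intro ideal_power_on_line[of _ P]) auto
  show "eval_at v (c b) = 0"
    by (rule leading_coefficients_vanish[OF F surj line b])
qed

lemma fat_points_ideal_eq: "fat_points_ideal X m = monomial_ideal n F m"
proof
  have F_P: "F i \<in> vanishing_ideal {P}" if "i < n" "P \<in> X" for i P
    using that X(1) generator_in_ideal[OF that(1)] vanishing_ideal_iff[of "{P}"] vanishing_ideal_iff[of X]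
    by auto
  show "monomial_ideal n F m \<subseteq> fat_points_ideal X m"
    unfolding monomial_ideal_def fat_points_ideal_def
    by (auto intro!: module.subspace_sum[OF module_mult ideal_power_ideal]
        module.subspace_scale[OF module_mult ideal_power_ideal] monomial_in_ideal_power F_P)
  show "fat_points_ideal X m \<subseteq> monomial_ideal n F m"
  proof (induction m)
    case (Suc m)
    show ?case
    proof
      fix f assume f: "f \<in> fat_points_ideal X (Suc m)"
      have "fat_points_ideal X (Suc m) \<subseteq> fat_points_ideal X m"
        unfolding fat_points_ideal_def using ideal_power_Suc_subset by blast
      with f Suc obtain c where c: "f = (\<Sum>a\<in>exponents n m. c a * monomial_in n F a)"
        by (auto simp: monomial_ideal_def)
      have "c a \<in> ideal_gen (set Fs)" if "a \<in> exponents n m" for a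
        using coefficients_in_ideal[of c m a] f c that gen by simp
      then show "f \<in> monomial_ideal n F (Suc m)"
        unfolding c by (intro sum_monomial_in_mem_Suc len)
    qed
  qed simp
qed

end


section \<open>Koszul differentials\<close>

definition koszul_sign :: "nat \<Rightarrow> nat set \<Rightarrow> 'r::comm_ring_1" where
  "koszul_sign s \<sigma> = (-1) ^ card {r \<in> \<sigma>. r < s}"

text \<open>Acts on coefficient families: the entry at \<open>(\<sigma>, u)\<close> collects what
  reaches it from \<open>insert s \<sigma>\<close>, with a factor \<open>\<alpha>\<close> and a
  change \<open>g\<close> of the second index. Both differentials are instances, so squares and
  anticommutation are treated once.\<close>

definition koszul ::
    "nat \<Rightarrow> (nat \<Rightarrow> 'u \<Rightarrow> 'r::comm_ring_1) \<Rightarrow> (nat \<Rightarrow> 'u \<Rightarrow> 'u) \<Rightarrow> (nat set \<Rightarrow> 'u \<Rightarrow> 'r) \<Rightarrow> nat set \<Rightarrow> 'u \<Rightarrow> 'r"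
  where
  "koszul n \<alpha> g x \<sigma> u =
    (\<Sum>s\<in>{..<n} - \<sigma>. koszul_sign s \<sigma> * (\<alpha> s u * x (insert s \<sigma>) (g s u)))"

lemma koszul_sign_insert:
  assumes "s \<notin> \<sigma>"
  shows "koszul_sign r (insert s \<sigma>) = (if s < r then - koszul_sign r \<sigma> else koszul_sign r \<sigma> :: 'r::comm_ring_1)"
proof (cases "s < r")
  case True
  then have "{q \<in> insert s \<sigma>. q < r} = insert s {q \<in> \<sigma>. q < r}" by auto
  with True assms show ?thesis by (simp add: koszul_sign_def)
next
  case False
  then have "{q \<in> insert s \<sigma>. q < r} = {q \<in> \<sigma>. q < r}" by auto
  with False show ?thesis by (simp add: koszul_sign_def)
qed

text \<open>Of the two insertions exactly one, that of the smaller index, changes the sign belonging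
  to the other index.\<close>

lemma koszul_sign_swap:
  assumes "s \<notin> \<sigma>" "r \<notin> \<sigma>" "s \<noteq> r"
  shows "koszul_sign s \<sigma> * koszul_sign r (insert s \<sigma>) =
    - (koszul_sign r \<sigma> * koszul_sign s (insert r \<sigma>) :: 'r::comm_ring_1)"
  using assms by (auto simp: koszul_sign_insert mult.commute)

lemma koszul_sign_cases: "koszul_sign s \<sigma> = (1::'r::comm_ring_1) \<or> koszul_sign s \<sigma> = (-1::'r)"
  by (simp add: koszul_sign_def) (metis neg_one_even_power neg_one_odd_power)

text \<open>Both sums are brought to the same index set, with zeros on the diagonal, so that
  exchanging \<open>s\<close> and \<open>r\<close> is an exchange of sums.\<close>

lemma koszul_koszul:
  "koszul n \<alpha> g (koszul n \<beta> h x) \<sigma> u =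
    (\<Sum>s\<in>{..<n} - \<sigma>. \<Sum>r\<in>{..<n} - \<sigma>. if r = s then 0 else
      koszul_sign s \<sigma> * koszul_sign r (insert s \<sigma>) * (\<alpha> s u * \<beta> r (g s u)) *
        x (insert r (insert s \<sigma>)) (h r (g s u)))"
proof -
  have "koszul_sign s \<sigma> * (\<alpha> s u * (\<Sum>r\<in>{..<n} - insert s \<sigma>. G r)) =
      (\<Sum>r\<in>{..<n} - \<sigma>. if r = s then 0 else koszul_sign s \<sigma> * (\<alpha> s u * G r))"
    if "s \<in> {..<n} - \<sigma>" for s G
    unfolding sum_distrib_left
    by (rule sum.mono_neutral_cong_left) auto
  then show ?thesis
    by (simp add: koszul_def mult.assoc mult.left_commute cong: if_cong)
qed

lemma koszul_anticommute:
  assumes "\<And>s r u. s \<noteq> r \<Longrightarrow> \<alpha> s u * \<beta> r (g s u) = \<beta> r u * \<alpha> s (h r u)"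
    and "\<And>s r u. s \<noteq> r \<Longrightarrow> h r (g s u) = g s (h r u)"
  shows "koszul n \<alpha> g (koszul n \<beta> h x) \<sigma> u = - koszul n \<beta> h (koszul n \<alpha> g x) \<sigma> u"
  unfolding koszul_koszul sum_negf[symmetric]
proof (subst sum.swap, intro sum.cong refl)
  fix r s assume rs: "r \<in> {..<n} - \<sigma>" "s \<in> {..<n} - \<sigma>"
  show "(if r = s then 0 else koszul_sign s \<sigma> * koszul_sign r (insert s \<sigma>) * (\<alpha> s u * \<beta> r (g s u)) *
        x (insert r (insert s \<sigma>)) (h r (g s u))) =
      - (if s = r then 0 else koszul_sign r \<sigma> * koszul_sign s (insert r \<sigma>) * (\<beta> r u * \<alpha> s (h r u)) *
        x (insert s (insert r \<sigma>)) (g s (h r u)))"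
  proof (cases "r = s")
    case False
    then show ?thesis
      using koszul_sign_swap[of s \<sigma> r, where 'r = 'b] rs assms[of s r] by (simp add: insert_commute)
  qed simp
qed

text \<open>The diagonal is a separate assumption because \<open>G s s = - G s s\<close> does not
  force \<open>0\<close> when 2 is not invertible.\<close>

lemma sum_antisymmetric:
  fixes G :: "'i \<Rightarrow> 'i \<Rightarrow> 'r::ab_group_add"
  assumes "finite A" "\<And>s. G s s = 0" "\<And>s r. s \<in> A \<Longrightarrow> r \<in> A \<Longrightarrow> G s r = - G r s"
  shows "(\<Sum>s\<in>A. \<Sum>r\<in>A. G s r) = 0"
  using assms(1,3)
proof (induction A rule: finite_induct)
  case (insert a A)
  have "(\<Sum>r\<in>A. G a r) = - (\<Sum>s\<in>A. G s a)"
    unfolding sum_negf[symmetric] by (intro sum.cong refl insert.prems) auto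
  moreover have "(\<Sum>s\<in>A. \<Sum>r\<in>A. G s r) = 0"
    by (rule insert.IH) (use insert.prems in blast)
  ultimately show ?case using insert.hyps by (simp add: sum.distrib assms(2))
qed simp

lemma koszul_square_zero:
  assumes "\<And>s r u. s \<noteq> r \<Longrightarrow> \<alpha> s u * \<alpha> r (g s u) = \<alpha> r u * \<alpha> s (g r u)"
    and "\<And>s r u. s \<noteq> r \<Longrightarrow> g r (g s u) = g s (g r u)"
  shows "koszul n \<alpha> g (koszul n \<alpha> g x) \<sigma> u = 0"
  unfolding koszul_koszul
proof (rule sum_antisymmetric)
  fix s r assume rs: "s \<in> {..<n} - \<sigma>" "r \<in> {..<n} - \<sigma>"
  show "(if r = s then 0 else koszul_sign s \<sigma> * koszul_sign r (insert s \<sigma>) * (\<alpha> s u * \<alpha> r (g s u)) *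
        x (insert r (insert s \<sigma>)) (g r (g s u))) =
      - (if s = r then 0 else koszul_sign r \<sigma> * koszul_sign s (insert r \<sigma>) * (\<alpha> r u * \<alpha> s (g r u)) *
        x (insert s (insert r \<sigma>)) (g s (g r u)))"
  proof (cases "r = s")
    case False
    then show ?thesis
      using koszul_sign_swap[of s \<sigma> r, where 'r = 'b] rs assms[of s r] by (simp add: insert_commute)
  qed simp
qed simp_all

lemma koszul_add:
  "koszul n \<alpha> g (\<lambda>\<sigma> u. x \<sigma> u + y \<sigma> u) \<sigma> u = koszul n \<alpha> g x \<sigma> u + koszul n \<alpha> g y \<sigma> u"
  by (simp add: koszul_def distrib_left sum.distrib)

lemma koszul_scale: "koszul n \<alpha> g (\<lambda>\<sigma> u. r * x \<sigma> u) \<sigma> u = r * koszul n \<alpha> g x \<sigma> u"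
  by (simp add: koszul_def sum_distrib_left ac_simps)

lemma koszul_zero: "koszul n \<alpha> g (\<lambda>\<sigma> u. 0) = (\<lambda>\<sigma> u. 0)"
  by (simp add: koszul_def fun_eq_iff)

abbreviation koszul_mult :: "nat \<Rightarrow> (nat \<Rightarrow> 'r::comm_ring_1) \<Rightarrow> (nat set \<Rightarrow> 'u \<Rightarrow> 'r) \<Rightarrow> nat set \<Rightarrow> 'u \<Rightarrow> 'r"
  where "koszul_mult n F \<equiv> koszul n (\<lambda>s u. F s) (\<lambda>s u. u)"

text \<open>Replaces a factor e_s by y_s: the coefficient at y^u comes from the exponent lowered at
  \<open>s\<close>. The factor \<open>of_bool\<close> excludes \<open>u s = 0\<close>, where natural
  subtraction would truncate.\<close>

abbreviation koszul_shift ::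
    "nat \<Rightarrow> (nat set \<Rightarrow> (nat \<Rightarrow> nat) \<Rightarrow> 'r::comm_ring_1) \<Rightarrow> nat set \<Rightarrow> (nat \<Rightarrow> nat) \<Rightarrow> 'r"
  where "koszul_shift n \<equiv> koszul n (\<lambda>s u. of_bool (u s > 0)) (\<lambda>s u. u(s := u s - Suc 0))"

lemma koszul_mult_square: "koszul_mult n F (koszul_mult n F x) = (\<lambda>\<sigma> u. 0)"
  by (intro ext koszul_square_zero) (auto simp: mult.commute)

lemma koszul_shift_square: "koszul_shift n (koszul_shift n x) = (\<lambda>\<sigma> u. 0)"
  by (intro ext koszul_square_zero) (auto simp: mult.commute fun_upd_twist)

lemma koszul_mult_shift:
  "koszul_mult n F (koszul_shift n x) \<sigma> u = - koszul_shift n (koszul_mult n F x) \<sigma> u"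
  by (rule koszul_anticommute) (auto simp: mult.commute)


section \<open>Exactness of the Koszul complex of a regular sequence\<close>

definition lin_ideal :: "nat \<Rightarrow> (nat \<Rightarrow> 'r::comm_ring_1) \<Rightarrow> 'r set" where
  "lin_ideal j F = {\<Sum>s<j. b s * F s | b. True}"

lemma lin_ideal_uminus:
  assumes "f \<in> lin_ideal j F"
  shows "- f \<in> lin_ideal j F"
proof -
  obtain b where "f = (\<Sum>s<j. b s * F s)" using assms by (auto simp: lin_ideal_def)
  then have "- f = (\<Sum>s<j. (- b s) * F s)" by (simp add: sum_negf)
  then show ?thesis unfolding lin_ideal_def by (intro CollectI exI[of _ "\<lambda>s. - b s"]) simp
qed

lemma insert_not_singleton:
  assumes "s \<notin> \<sigma>" "\<sigma> \<noteq> {}"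
  shows "insert s \<sigma> \<noteq> {t}"
proof -
  obtain r where "r \<in> \<sigma>" using assms(2) by blast
  with assms(1) show ?thesis by auto
qed

lemma koszul_mult_surj_lin_ideal:
  fixes F :: "nat \<Rightarrow> 'r::comm_ring_1"
  assumes "f \<in> lin_ideal n F"
  shows "\<exists>y :: nat set \<Rightarrow> nat \<Rightarrow> 'r. (\<forall>\<sigma>. y \<sigma> 0 \<noteq> 0 \<longrightarrow> \<sigma> \<subseteq> {..<n} \<and> card \<sigma> = 1) \<and>
    (\<forall>\<sigma>. koszul_mult n F y \<sigma> 0 = (if \<sigma> = {} then f else 0))"
proof -
  obtain b where b: "f = (\<Sum>s<n. b s * F s)" using assms by (auto simp: lin_ideal_def)
  define y where "y \<sigma> = (\<lambda>_::nat. if \<exists>s<n. \<sigma> = {s} then b (the_elem \<sigma>) else 0)" for \<sigma>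
  have "koszul_mult n F y \<sigma> 0 = (if \<sigma> = {} then f else 0)" for \<sigma>
  proof (cases "\<sigma> = {}")
    case True
    then show ?thesis by (simp add: koszul_def koszul_sign_def y_def b ac_simps)
  next
    case False
    have "y (insert s \<sigma>) 0 = 0" if "s \<notin> \<sigma>" for s
      using insert_not_singleton[OF that False] by (simp add: y_def)
    then show ?thesis using False by (simp add: koszul_def)
  qed
  moreover have "\<sigma> \<subseteq> {..<n} \<and> card \<sigma> = 1" if "y \<sigma> 0 \<noteq> 0" for \<sigma>
    using that by (auto simp: y_def split: if_splits)
  ultimately show ?thesis by blast
qed

text \<open>With the next lemma, this presents the Koszul complex on one more element as the mapping
  cone of multiplication by \<open>F n\<close>. The sign is \<open>(-1) ^ card \<sigma>\<close>
  since all of \<open>\<sigma>\<close> lies below \<open>n\<close>.\<close>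

lemma koszul_mult_Suc:
  assumes "n \<notin> \<sigma>" "\<sigma> \<subseteq> {..<n}"
  shows "koszul_mult (Suc n) F x \<sigma> u =
    koszul_mult n F x \<sigma> u + (-1) ^ card \<sigma> * (F n * x (insert n \<sigma>) u)"
proof -
  have "{..<Suc n} - \<sigma> = insert n ({..<n} - \<sigma>)" using assms by auto
  moreover have "{r \<in> \<sigma>. r < n} = \<sigma>" using assms by auto
  ultimately show ?thesis by (simp add: koszul_def koszul_sign_def)
qed

lemma koszul_mult_Suc_insert:
  assumes "n \<notin> \<sigma>"
  shows "koszul_mult (Suc n) F x (insert n \<sigma>) u = koszul_mult n F (\<lambda>\<sigma>. x (insert n \<sigma>)) \<sigma> u"
proof -
  have "{..<Suc n} - insert n \<sigma> = {..<n} - \<sigma>" using assms by auto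
  then show ?thesis
    using assms by (auto simp: koszul_def koszul_sign_insert insert_commute intro!: sum.cong)
qed

lemma koszul_mult_cong:
  "(\<And>s. s < n \<Longrightarrow> s \<notin> \<sigma> \<Longrightarrow> x (insert s \<sigma>) u = y (insert s \<sigma>) u) \<Longrightarrow>
    koszul_mult n F x \<sigma> u = koszul_mult n F y \<sigma> u"
  unfolding koszul_def by (intro sum.cong) auto

text \<open>Write x = x0 + e_n x1 with x0 and x1 free of e_n. The cycle condition makes x1 a cycle
  and the boundary of x0 a multiple of F_n x1; lift x1 to y1, correct x0 by a multiple of F_n y1,
  and lift the result. \<open>koszul_mult\<close> leaves the second index alone, so a dummy
  \<open>0\<close> stands for it.\<close>

lemma koszul_exact:
  fixes F :: "nat \<Rightarrow> 'r::comm_ring_1" and x :: "nat set \<Rightarrow> nat \<Rightarrow> 'r"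
  assumes "\<And>j g. j < n \<Longrightarrow> F j * g \<in> lin_ideal j F \<Longrightarrow> g \<in> lin_ideal j F"
    and "\<And>\<sigma>. x \<sigma> 0 \<noteq> 0 \<Longrightarrow> \<sigma> \<subseteq> {..<n} \<and> card \<sigma> = Suc i"
    and "\<And>\<sigma>. koszul_mult n F x \<sigma> 0 = 0"
  shows "\<exists>y :: nat set \<Rightarrow> nat \<Rightarrow> 'r. (\<forall>\<sigma>. y \<sigma> 0 \<noteq> 0 \<longrightarrow> \<sigma> \<subseteq> {..<n} \<and> card \<sigma> = Suc (Suc i)) \<and>
    (\<forall>\<sigma>. koszul_mult n F y \<sigma> 0 = x \<sigma> 0)"
  using assms
proof (induction n arbitrary: i x)
  case 0
  have "x \<sigma> 0 = 0" for \<sigma> using "0.prems"(2)[of \<sigma>] by (cases "x \<sigma> 0 = 0") auto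
  then show ?case by (intro exI[of _ "\<lambda>_ _. 0"]) (simp add: koszul_zero)
next
  case (Suc n)
  note IH = Suc.IH and reg = Suc.prems(1) and supp = Suc.prems(2) and cyc = Suc.prems(3)
  define x0 where "x0 \<sigma> = (if n \<in> \<sigma> then (\<lambda>_. 0) else x \<sigma>)" for \<sigma>
  define x1 where "x1 \<sigma> = (if n \<in> \<sigma> then (\<lambda>_. 0) else x (insert n \<sigma>))" for \<sigma>
  have x0_supp: "\<sigma> \<subseteq> {..<n} \<and> card \<sigma> = Suc i" if "x0 \<sigma> 0 \<noteq> 0" for \<sigma>
  proof -
    have "n \<notin> \<sigma>" "\<sigma> \<subseteq> {..<Suc n}" "card \<sigma> = Suc i"
      using that supp[of \<sigma>] by (auto simp: x0_def split: if_splits)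
    then show ?thesis by (auto simp: lessThan_Suc)
  qed
  have x1_supp: "\<sigma> \<subseteq> {..<n} \<and> card \<sigma> = i" if "x1 \<sigma> 0 \<noteq> 0" for \<sigma>
  proof -
    have n: "n \<notin> \<sigma>" and *: "insert n \<sigma> \<subseteq> {..<Suc n}" "card (insert n \<sigma>) = Suc i"
      using that supp[of "insert n \<sigma>"] by (auto simp: x1_def split: if_splits)
    then have "\<sigma> \<subseteq> {..<n}" by (auto simp: lessThan_Suc)
    moreover from this have "finite \<sigma>" by (rule finite_subset) simp
    ultimately show ?thesis using n * by simp
  qed
  have x1_cyc: "koszul_mult n F x1 \<sigma> 0 = 0" for \<sigma>
  proof (cases "n \<in> \<sigma>")
    case True
    then show ?thesis by (simp add: koszul_def x1_def)
  next
    case False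
    have "koszul_mult n F x1 \<sigma> 0 = koszul_mult n F (\<lambda>\<sigma>. x (insert n \<sigma>)) \<sigma> 0"
      using False by (intro koszul_mult_cong) (auto simp: x1_def)
    then show ?thesis using koszul_mult_Suc_insert[OF False, of F x "0"] cyc by simp
  qed
  have x0_x1: "koszul_mult n F x0 \<sigma> 0 + (-1) ^ card \<sigma> * (F n * x1 \<sigma> 0) = 0"
    if "\<sigma> \<subseteq> {..<n}" for \<sigma>
  proof -
    have n: "n \<notin> \<sigma>" using that by auto
    have "koszul_mult n F x0 \<sigma> 0 = koszul_mult n F x \<sigma> 0"
      using n by (intro koszul_mult_cong) (auto simp: x0_def)
    then show ?thesis using koszul_mult_Suc[OF n that, of F x "0"] cyc n by (simp add: x1_def)
  qed
  have "\<exists>y1 :: nat set \<Rightarrow> nat \<Rightarrow> 'r. (\<forall>\<sigma>. y1 \<sigma> 0 \<noteq> 0 \<longrightarrow> \<sigma> \<subseteq> {..<n} \<and> card \<sigma> = Suc i) \<and>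
      (\<forall>\<sigma>. koszul_mult n F y1 \<sigma> 0 = x1 \<sigma> 0)"
  proof (cases i)
    case (Suc i')
    then show ?thesis using IH[of x1 i'] x1_supp x1_cyc reg by simp
  next
    \<comment> \<open>Here \<open>x1\<close> is one scalar at \<open>{}\<close>, below the range of
      the induction hypothesis; regularity of \<open>F n\<close> modulo its predecessors puts this
      scalar into their ideal.\<close>
    case 0
    have fin: "finite \<sigma>" if "x1 \<sigma> 0 \<noteq> 0" for \<sigma>
      using x1_supp[OF that] finite_subset by blast
    have x1_empty: "x1 \<sigma> 0 = 0" if "\<sigma> \<noteq> {}" for \<sigma>
      using x1_supp[of \<sigma>] fin[of \<sigma>] that 0 by auto
    have "koszul_mult n F x0 {} 0 \<in> lin_ideal n F"
      unfolding lin_ideal_def koszul_def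
      by (auto simp: koszul_sign_def intro!: exI[of _ "\<lambda>s. x0 {s} 0"] sum.cong)
    moreover have "F n * x1 {} 0 = - koszul_mult n F x0 {} 0"
      using x0_x1[of "{}"] by (simp add: eq_neg_iff_add_eq_0 add.commute)
    ultimately have "F n * x1 {} 0 \<in> lin_ideal n F"
      using lin_ideal_uminus by simp
    then have "x1 {} 0 \<in> lin_ideal n F" using reg[of n] by simp
    then obtain y :: "nat set \<Rightarrow> nat \<Rightarrow> 'r" where y_supp: "\<forall>\<sigma>. y \<sigma> 0 \<noteq> 0 \<longrightarrow> \<sigma> \<subseteq> {..<n} \<and> card \<sigma> = 1"
      and y: "\<forall>\<sigma>. koszul_mult n F y \<sigma> 0 = (if \<sigma> = {} then x1 {} 0 else 0)"
      using koszul_mult_surj_lin_ideal by blast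
    have "koszul_mult n F y \<sigma> 0 = x1 \<sigma> 0" for \<sigma>
      using x1_empty[of \<sigma>] by (simp add: y)
    with y_supp 0 show ?thesis by (intro exI[of _ y]) simp
  qed
  then obtain y1 :: "nat set \<Rightarrow> nat \<Rightarrow> 'r" where y1_supp: "\<And>\<sigma>. y1 \<sigma> 0 \<noteq> 0 \<Longrightarrow> \<sigma> \<subseteq> {..<n} \<and> card \<sigma> = Suc i"
    and y1: "\<And>\<sigma>. koszul_mult n F y1 \<sigma> 0 = x1 \<sigma> 0" by blast
  \<comment> \<open>\<open>x1\<close> lives on sets of size \<open>i\<close>, so by
    \<open>x0_x1\<close> the boundary of \<open>x0\<close> is \<open>- (-1) ^ i * F n * x1\<close>;
    the added term cancels it.\<close>
  define x2 where "x2 \<sigma> = (\<lambda>_::nat. x0 \<sigma> 0 + (-1) ^ i * F n * y1 \<sigma> 0)" for \<sigma>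
  have x2_supp: "\<sigma> \<subseteq> {..<n} \<and> card \<sigma> = Suc i" if "x2 \<sigma> 0 \<noteq> 0" for \<sigma>
    using that x0_supp[of \<sigma>] y1_supp[of \<sigma>]
    by (cases "x0 \<sigma> 0 = 0"; cases "y1 \<sigma> 0 = 0") (simp_all add: x2_def)
  have x2: "koszul_mult n F x2 \<sigma> 0 = koszul_mult n F x0 \<sigma> 0 + (-1) ^ i * (F n * x1 \<sigma> 0)" for \<sigma>
  proof -
    have "koszul_mult n F x2 \<sigma> 0 =
      koszul_mult n F x0 \<sigma> 0 + (-1) ^ i * F n * koszul_mult n F y1 \<sigma> 0"
      unfolding koszul_scale[symmetric] koszul_add[symmetric] by (simp add: koszul_def x2_def)
    then show ?thesis by (simp add: y1 mult.assoc)
  qed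
  have x2_cyc: "koszul_mult n F x2 \<sigma> 0 = 0" for \<sigma>
  proof (cases "\<sigma> \<subseteq> {..<n} \<and> card \<sigma> = i")
    case True
    then show ?thesis using x0_x1[of \<sigma>] by (simp add: x2)
  next
    case False
    have "x2 (insert s \<sigma>) 0 = 0" if "s \<notin> \<sigma>" for s
    proof (rule ccontr)
      assume "x2 (insert s \<sigma>) 0 \<noteq> 0"
      then have "insert s \<sigma> \<subseteq> {..<n}" "card (insert s \<sigma>) = Suc i" using x2_supp by auto
      moreover from this have "finite \<sigma>" using finite_subset[of \<sigma> "{..<n}"] by auto
      ultimately show False using that False by auto
    qed
    then show ?thesis by (simp add: koszul_def)
  qed
  have "\<exists>y :: nat set \<Rightarrow> nat \<Rightarrow> 'r. (\<forall>\<sigma>. y \<sigma> 0 \<noteq> 0 \<longrightarrow> \<sigma> \<subseteq> {..<n} \<and> card \<sigma> = Suc (Suc i)) \<and>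
      (\<forall>\<sigma>. koszul_mult n F y \<sigma> 0 = x2 \<sigma> 0)"
    by (rule IH[OF _ x2_supp x2_cyc]) (rule reg, simp_all)
  then obtain y0 :: "nat set \<Rightarrow> nat \<Rightarrow> 'r"
    where y0_supp: "\<And>\<sigma>. y0 \<sigma> 0 \<noteq> 0 \<Longrightarrow> \<sigma> \<subseteq> {..<n} \<and> card \<sigma> = Suc (Suc i)"
    and y0: "\<And>\<sigma>. koszul_mult n F y0 \<sigma> 0 = x2 \<sigma> 0" by blast
  \<comment> \<open>\<open>y1\<close> lives on sets of size \<open>Suc i\<close>, so e_n y1
    contributes \<open>(-1) ^ Suc i * F n * y1\<close>, which removes the correction in
    \<open>x2\<close> and leaves \<open>x0\<close>.\<close>
  define y where "y \<sigma> = (if n \<in> \<sigma> then y1 (\<sigma> - {n}) else y0 \<sigma>)" for \<sigma>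
  show ?case
  proof (intro exI[of _ y] conjI allI impI)
    fix \<sigma> assume ne: "y \<sigma> 0 \<noteq> 0"
    show "\<sigma> \<subseteq> {..<Suc n}" "card \<sigma> = Suc (Suc i)"
    proof -
      have "\<sigma> \<subseteq> {..<Suc n} \<and> card \<sigma> = Suc (Suc i)"
      proof (cases "n \<in> \<sigma>")
        case True
        then have *: "\<sigma> - {n} \<subseteq> {..<n}" "card (\<sigma> - {n}) = Suc i"
          using ne y1_supp[of "\<sigma> - {n}"] by (auto simp: y_def)
        from *(1) have "finite (\<sigma> - {n})" by (rule finite_subset) simp
        then have "card \<sigma> = Suc (Suc i)" using True *(2) card_Suc_Diff1[of \<sigma> n] by simp
        moreover have "\<sigma> \<subseteq> {..<Suc n}" using *(1) by (auto simp: lessThan_Suc)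
        ultimately show ?thesis by simp
      next
        case False
        then show ?thesis using ne y0_supp[of \<sigma>] by (auto simp: y_def lessThan_Suc)
      qed
      then show "\<sigma> \<subseteq> {..<Suc n}" "card \<sigma> = Suc (Suc i)" by auto
    qed
  next
    fix \<sigma>
    show "koszul_mult (Suc n) F y \<sigma> 0 = x \<sigma> 0"
    proof (cases "n \<in> \<sigma>")
      case True
      define \<tau> where "\<tau> = \<sigma> - {n}"
      have \<tau>: "\<sigma> = insert n \<tau>" "n \<notin> \<tau>" using True by (auto simp: \<tau>_def)
      have "koszul_mult n F (\<lambda>\<tau>. y (insert n \<tau>)) \<tau> 0 = koszul_mult n F y1 \<tau> 0"
        using \<tau>(2) by (intro koszul_mult_cong) (auto simp: y_def)
      then show ?thesis
        using koszul_mult_Suc_insert[OF \<tau>(2), of F y "0"] \<tau> y1[of \<tau>] by (simp add: x1_def)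
    next
      case False
      show ?thesis
      proof (cases "\<sigma> \<subseteq> {..<n}")
        case True
        have "koszul_mult n F y \<sigma> 0 = koszul_mult n F y0 \<sigma> 0"
          using False by (intro koszul_mult_cong) (auto simp: y_def)
        then have "koszul_mult (Suc n) F y \<sigma> 0 = x2 \<sigma> 0 + (-1) ^ card \<sigma> * (F n * y1 \<sigma> 0)"
          using koszul_mult_Suc[OF False True, of F y "0"] False y0[of \<sigma>] by (simp add: y_def)
        also have "\<dots> = x0 \<sigma> 0"
          using y1_supp[of \<sigma>] by (cases "y1 \<sigma> 0 = 0") (auto simp: x2_def)
        finally show ?thesis using False by (simp add: x0_def)
      next
        case outside: False
        then have "x \<sigma> 0 = 0" using x0_supp[of \<sigma>] False by (auto simp: x0_def)
        moreover have "y (insert s \<sigma>) 0 = 0" if "s < Suc n" "s \<notin> \<sigma>" for s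
        proof (cases "s = n")
          case True
          then show ?thesis using y1_supp[of \<sigma>] outside False by (auto simp: y_def)
        next
          case sn: False
          then show ?thesis using y0_supp[of "insert s \<sigma>"] outside False by (auto simp: y_def)
        qed
        ultimately show ?thesis by (simp add: koszul_def)
      qed
    qed
  qed
qed


section \<open>Cycles of the bigraded Koszul complex\<close>

text \<open>Such an \<open>x\<close> is an element of \<open>\<And>\<^sup>i k\<^sup>n \<otimes> Sym\<^sup>p k\<^sup>n \<otimes> R\<close>, with coefficient \<open>x \<sigma> u\<close> at
  \<open>e\<^sub>\<sigma> \<otimes> y\<^sup>u\<close>.\<close>

definition koszul_elements ::
    "nat \<Rightarrow> nat \<Rightarrow> nat \<Rightarrow> (nat set \<Rightarrow> (nat \<Rightarrow> nat) \<Rightarrow> 'r::zero) set" where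
  "koszul_elements n i p =
    {x. \<forall>\<sigma> u. x \<sigma> u \<noteq> 0 \<longrightarrow> \<sigma> \<subseteq> {..<n} \<and> card \<sigma> = i \<and> u \<in> exponents n p}"

text \<open>The multidegree in which e_s counts like y_s. \<open>koszul_shift\<close> preserves it,
  so its complex splits into one piece for each total exponent.\<close>

definition total_exponent :: "nat set \<Rightarrow> (nat \<Rightarrow> nat) \<Rightarrow> nat \<Rightarrow> nat" where
  "total_exponent \<sigma> u j = u j + of_bool (j \<in> \<sigma>)"

definition first_index :: "(nat \<Rightarrow> nat) \<Rightarrow> nat" where
  "first_index a = (LEAST j. a j > 0)"

text \<open>In total exponent \<open>a\<close>, \<open>koszul_shift\<close> is the boundary of the simplex on the support of \<open>a\<close>;
  the homotopy is the cone on its first vertex.\<close>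

definition koszul_homotopy ::
    "(nat set \<Rightarrow> (nat \<Rightarrow> nat) \<Rightarrow> 'r::comm_ring_1) \<Rightarrow> nat set \<Rightarrow> (nat \<Rightarrow> nat) \<Rightarrow> 'r" where
  "koszul_homotopy x \<sigma> u = (let M = first_index (total_exponent \<sigma> u) in
     if M \<in> \<sigma> then x (\<sigma> - {M}) (u(M := Suc (u M))) else 0)"

lemma koszul_elementsD:
  assumes "x \<in> koszul_elements n i p" "x \<sigma> u \<noteq> 0"
  shows "\<sigma> \<subseteq> {..<n}" "card \<sigma> = i" "u \<in> exponents n p" "finite \<sigma>"
  using assms finite_subset[of \<sigma> "{..<n}"] by (auto simp: koszul_elements_def)

lemma koszul_elements_add:
  fixes x y :: "nat set \<Rightarrow> (nat \<Rightarrow> nat) \<Rightarrow> 'r::comm_ring_1"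
  shows "x \<in> koszul_elements n i p \<Longrightarrow> y \<in> koszul_elements n i p \<Longrightarrow>
    (\<lambda>\<sigma> u. x \<sigma> u + y \<sigma> u) \<in> koszul_elements n i p"
  unfolding koszul_elements_def by (simp, metis add.left_neutral)

lemma koszul_nonzeroE:
  assumes "koszul n \<alpha> g x \<sigma> u \<noteq> 0"
  obtains s where "s < n" "s \<notin> \<sigma>" "\<alpha> s u \<noteq> 0" "x (insert s \<sigma>) (g s u) \<noteq> 0"
proof -
  obtain s where "s \<in> {..<n} - \<sigma>" "koszul_sign s \<sigma> * (\<alpha> s u * x (insert s \<sigma>) (g s u)) \<noteq> 0"
    using assms unfolding koszul_def by (meson sum.neutral)
  moreover from this have "\<alpha> s u \<noteq> 0" "x (insert s \<sigma>) (g s u) \<noteq> 0" by (auto intro: ccontr)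
  ultimately show ?thesis using that[of s] by simp
qed

lemma koszul_mult_elements:
  assumes "x \<in> koszul_elements n (Suc i) p"
  shows "koszul_mult n F x \<in> koszul_elements n i p"
  unfolding koszul_elements_def
proof (intro CollectI allI impI)
  fix \<sigma> u assume "koszul_mult n F x \<sigma> u \<noteq> 0"
  then obtain s where s: "s \<notin> \<sigma>" "x (insert s \<sigma>) u \<noteq> 0" by (elim koszul_nonzeroE)
  show "\<sigma> \<subseteq> {..<n} \<and> card \<sigma> = i \<and> u \<in> exponents n p"
    using koszul_elementsD[OF assms, OF s(2)] s(1) by auto
qed

lemma koszul_shift_elements:
  assumes "x \<in> koszul_elements n (Suc i) p"
  shows "koszul_shift n x \<in> koszul_elements n i (Suc p)"
  unfolding koszul_elements_def
proof (intro CollectI allI impI)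
  fix \<sigma> u assume "koszul_shift n x \<sigma> u \<noteq> 0"
  then obtain s where s: "s < n" "s \<notin> \<sigma>" "u s > 0" and ne: "x (insert s \<sigma>) (u(s := u s - Suc 0)) \<noteq> 0"
    by (elim koszul_nonzeroE) (auto simp: of_bool_def split: if_splits)
  have "u(s := u s - Suc 0) \<in> exponents n p" using koszul_elementsD[OF assms, OF ne] by simp
  then have "u \<in> exponents n (Suc p)"
    using exponents_Suc_iff[OF s(1), of "u(s := u s - Suc 0)" p] s(3) by simp
  then show "\<sigma> \<subseteq> {..<n} \<and> card \<sigma> = i \<and> u \<in> exponents n (Suc p)"
    using koszul_elementsD[OF assms, OF ne] s(2) by auto
qed

section \<open>The cone homotopy for the shift differential\<close>

lemma first_index_pos: "a j > 0 \<Longrightarrow> a (first_index a) > 0"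
  unfolding first_index_def by (rule LeastI)

lemma first_index_le: "a j > 0 \<Longrightarrow> first_index a \<le> j"
  unfolding first_index_def by (rule Least_le)

lemma total_exponent_shift:
  assumes "s \<notin> \<sigma>" "u s > 0"
  shows "total_exponent (insert s \<sigma>) (u(s := u s - Suc 0)) = total_exponent \<sigma> u"
  using assms by (auto simp: total_exponent_def fun_eq_iff)

lemma total_exponent_unshift:
  assumes "s \<in> \<sigma>"
  shows "total_exponent (\<sigma> - {s}) (u(s := Suc (u s))) = total_exponent \<sigma> u"
  using assms by (auto simp: total_exponent_def fun_eq_iff)

lemma total_exponent_bound:
  assumes "\<sigma> \<subseteq> {..<n}" "u \<in> exponents n p" "total_exponent \<sigma> u j > 0"
  shows "j < n"
proof (rule ccontr)
  assume "\<not> j < n"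
  then have "u j = 0" "j \<notin> \<sigma>" using assms(1,2) by (auto simp: exponents_def)
  with assms(3) show False by (simp add: total_exponent_def)
qed

lemma koszul_sign_empty [simp]: "koszul_sign s {} = 1"
  by (simp add: koszul_sign_def)

lemma koszul_homotopy_elements:
  assumes "x \<in> koszul_elements n i (Suc p)"
  shows "koszul_homotopy x \<in> koszul_elements n (Suc i) p"
  unfolding koszul_elements_def
proof (intro CollectI allI impI)
  fix \<sigma> u assume *: "koszul_homotopy x \<sigma> u \<noteq> 0"
  define M where "M = first_index (total_exponent \<sigma> u)"
  have M: "M \<in> \<sigma>" and ne: "x (\<sigma> - {M}) (u(M := Suc (u M))) \<noteq> 0"
    using * by (auto simp: koszul_homotopy_def Let_def M_def split: if_splits)
  note D = koszul_elementsD[OF assms, OF ne]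
  have "M < n"
  proof (rule ccontr)
    assume "\<not> M < n"
    then show False using D(3) by (auto simp: exponents_def split: if_splits)
  qed
  moreover have "card \<sigma> = Suc i" using M D(2,4) card_Suc_Diff1[of \<sigma> M] by simp
  ultimately show "\<sigma> \<subseteq> {..<n} \<and> card \<sigma> = Suc i \<and> u \<in> exponents n p"
    using D(1,3) exponents_Suc_iff[of M n u p] by auto
qed

text \<open>\<open>koszul_homotopy\<close> carries no signs because the cone vertex precedes every
  element of \<open>\<sigma>\<close>.\<close>

lemma koszul_sign_first:
  assumes "first_index (total_exponent \<sigma> u) = M"
  shows "koszul_sign M \<sigma> = (1 :: 'r::comm_ring_1)"
proof -
  have "M \<le> r" if "r \<in> \<sigma>" for r
    using first_index_le[of "total_exponent \<sigma> u" r] that assms by (simp add: total_exponent_def)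
  then have "{r \<in> \<sigma>. r < M} = {}" by force
  then show ?thesis unfolding koszul_sign_def by (simp only: card.empty power_0)
qed

text \<open>Cone contraction with vertex M. If M is outside \<open>\<sigma>\<close>, the second term
  is 0 and only s = M survives in the first. If M is in \<open>\<sigma>\<close>, the term s = M of
  the second gives \<open>x \<sigma> u\<close> and the others cancel the first term, because passing
  M < s flips the sign. A nonzero total exponent is what provides the vertex.\<close>

lemma koszul_homotopy:
  assumes ne: "total_exponent \<sigma> u j > 0" and bd: "\<And>j. total_exponent \<sigma> u j > 0 \<Longrightarrow> j < n"
  shows "koszul_shift n (koszul_homotopy x) \<sigma> u + koszul_homotopy (koszul_shift n x) \<sigma> u = x \<sigma> u"
proof -
  define M where "M = first_index (total_exponent \<sigma> u)"
  have Mpos: "total_exponent \<sigma> u M > 0" unfolding M_def using ne by (rule first_index_pos)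
  then have Mn: "M < n" by (rule bd)
  have hx: "koszul_homotopy x (insert s \<sigma>) (u(s := u s - Suc 0)) =
      (if M \<in> insert s \<sigma> then x (insert s \<sigma> - {M}) ((u(s := u s - Suc 0))(M := Suc ((u(s := u s - Suc 0)) M))) else 0)"
    if "s \<notin> \<sigma>" "u s > 0" for s
    using total_exponent_shift[of s \<sigma> u] that by (simp add: koszul_homotopy_def M_def Let_def)
  show ?thesis
  proof (cases "M \<in> \<sigma>")
    case False
    then have uM: "u M > 0" using Mpos by (simp add: total_exponent_def)
    have "koszul_shift n (koszul_homotopy x) \<sigma> u =
        (\<Sum>s\<in>{..<n} - \<sigma>. if s = M then x \<sigma> u else 0)"
      unfolding koszul_def
    proof (intro sum.cong refl)
      fix s assume s: "s \<in> {..<n} - \<sigma>"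
      show "koszul_sign s \<sigma> * (of_bool (u s > 0) * koszul_homotopy x (insert s \<sigma>) (u(s := u s - Suc 0))) =
          (if s = M then x \<sigma> u else 0)"
        using s False uM hx[of s] koszul_sign_first[of \<sigma> u M, where 'r = 'a]
        by (cases "u s > 0") (auto simp: M_def[symmetric])
    qed
    also have "\<dots> = x \<sigma> u" using False Mn by simp
    finally show ?thesis using False by (simp add: koszul_homotopy_def M_def[symmetric])
  next
    case True
    define \<tau> where "\<tau> = \<sigma> - {M}"
    define w where "w = u(M := Suc (u M))"
    have \<tau>: "\<sigma> = insert M \<tau>" "M \<notin> \<tau>" using True by (auto simp: \<tau>_def)
    have "koszul_homotopy (koszul_shift n x) \<sigma> u = koszul_shift n x \<tau> w"
      using True by (simp add: koszul_homotopy_def M_def[symmetric] \<tau>_def w_def)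
    also have "\<dots> = koszul_sign M \<tau> * (of_bool (w M > 0) * x (insert M \<tau>) (w(M := w M - Suc 0))) +
      (\<Sum>s\<in>{..<n} - \<sigma>. koszul_sign s \<tau> * (of_bool (w s > 0) * x (insert s \<tau>) (w(s := w s - Suc 0))))"
    proof -
      have "{..<n} - \<tau> = insert M ({..<n} - \<sigma>)" using \<tau> Mn by auto
      then have "koszul_shift n x \<tau> w = (\<Sum>s\<in>insert M ({..<n} - \<sigma>).
          koszul_sign s \<tau> * (of_bool (w s > 0) * x (insert s \<tau>) (w(s := w s - Suc 0))))"
        by (simp only: koszul_def)
      then show ?thesis using True by (subst (asm) sum.insert) simp_all
    qed
    also have "koszul_sign M \<tau> * (of_bool (w M > 0) * x (insert M \<tau>) (w(M := w M - Suc 0))) = x \<sigma> u"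
    proof -
      have "koszul_sign M \<tau> = (1 :: 'a)"
        using koszul_sign_first[of \<tau> w M] total_exponent_unshift[OF True, of u]
        by (simp add: \<tau>_def w_def M_def)
      then show ?thesis using \<tau> by (simp add: w_def)
    qed
    also have "(\<Sum>s\<in>{..<n} - \<sigma>. koszul_sign s \<tau> * (of_bool (w s > 0) * x (insert s \<tau>) (w(s := w s - Suc 0)))) =
        - koszul_shift n (koszul_homotopy x) \<sigma> u"
      unfolding koszul_def sum_negf[symmetric]
    proof (intro sum.cong refl)
      fix s assume s: "s \<in> {..<n} - \<sigma>"
      then have sM: "s \<noteq> M" "s \<notin> \<tau>" "s \<notin> \<sigma>" using \<tau> by auto
      show "koszul_sign s \<tau> * (of_bool (w s > 0) * x (insert s \<tau>) (w(s := w s - Suc 0))) =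
        - (koszul_sign s \<sigma> * (of_bool (u s > 0) * koszul_homotopy x (insert s \<sigma>) (u(s := u s - Suc 0))))"
      proof (cases "u s > 0")
        case us: True
        have "M < s"
          using first_index_le[of "total_exponent \<sigma> u" s] us sM by (simp add: M_def total_exponent_def)
        then have "koszul_sign s \<sigma> = (- koszul_sign s \<tau> :: 'a)"
          using koszul_sign_insert[OF \<tau>(2), of s] \<tau>(1) by simp
        moreover have "insert s \<sigma> - {M} = insert s \<tau>" using \<tau> sM by auto
        moreover have "(u(s := u s - Suc 0))(M := Suc ((u(s := u s - Suc 0)) M)) = w(s := w s - Suc 0)"
          using sM by (auto simp: w_def fun_eq_iff)
        ultimately show ?thesis using us True hx[OF sM(3) us] sM by (simp add: w_def)
      next
        case False
        then show ?thesis using sM by (simp add: w_def)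
      qed
    qed
    finally have "koszul_homotopy (koszul_shift n x) \<sigma> u =
        x \<sigma> u + - koszul_shift n (koszul_homotopy x) \<sigma> u" .
    moreover have "a = c + - b \<Longrightarrow> b + a = c" for a b c :: 'a by simp
    ultimately show ?thesis by blast
  qed
qed

text \<open>\<open>Suc p\<close> keeps \<open>u\<close>, hence the total exponent, nonzero: the
  homotopy has no vertex in total exponent 0. This is where \<open>m \<ge> 1\<close> will
  enter.\<close>

lemma
  assumes x: "x \<in> koszul_elements n i (Suc p)" "x \<sigma> u \<noteq> 0"
  shows koszul_elements_total_pos: "\<exists>j. total_exponent \<sigma> u j > 0"
    and koszul_elements_total_less: "total_exponent \<sigma> u j > 0 \<Longrightarrow> j < n"
proof -
  note D = koszul_elementsD[OF x(1), OF x(2)]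
  obtain l where "u l > 0" using exponents_pos[OF D(3)] by blast
  then have "total_exponent \<sigma> u l > 0" by (simp add: total_exponent_def)
  then show "\<exists>j. total_exponent \<sigma> u j > 0" ..
  show "total_exponent \<sigma> u j > 0 \<Longrightarrow> j < n" by (rule total_exponent_bound[OF D(1,3)])
qed

lemma koszul_shift_exact:
  assumes x: "x \<in> koszul_elements n i (Suc p)" and cyc: "koszul_shift n x = (\<lambda>\<sigma> u. 0)"
  shows "koszul_shift n (koszul_homotopy x) = x"
proof (intro ext)
  fix \<sigma> u
  let ?y = "koszul_shift n (koszul_homotopy x)"
  have y: "?y \<in> koszul_elements n i (Suc p)"
    by (intro koszul_shift_elements koszul_homotopy_elements x)
  have 0: "koszul_homotopy (koszul_shift n x) = (\<lambda>\<sigma> u. 0)"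
    unfolding cyc by (simp add: koszul_homotopy_def Let_def fun_eq_iff)
  show "?y \<sigma> u = x \<sigma> u"
  proof (cases "x \<sigma> u = 0 \<and> ?y \<sigma> u = 0")
    case False
    obtain j where "total_exponent \<sigma> u j > 0"
      using False koszul_elements_total_pos[OF x, of \<sigma> u] koszul_elements_total_pos[OF y, of \<sigma> u] by blast
    moreover have "l < n" if "total_exponent \<sigma> u l > 0" for l
      using False that koszul_elements_total_less[OF x, of \<sigma> u l] koszul_elements_total_less[OF y, of \<sigma> u l]
      by blast
    ultimately have "?y \<sigma> u + koszul_homotopy (koszul_shift n x) \<sigma> u = x \<sigma> u"
      by (rule koszul_homotopy)
    then show ?thesis by (simp add: 0)
  qed simp
qed

lemma koszul_mult_pointwise:
  "koszul_mult n F x \<sigma> u = koszul_mult n F (\<lambda>\<sigma> _::nat. x \<sigma> u) \<sigma> 0"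
  by (simp add: koszul_def)

section \<open>Internal degrees\<close>

lemma koszul_sign_degrees:
  "f \<in> degrees_in Q \<Longrightarrow> koszul_sign s \<sigma> * f \<in> degrees_in Q"
  using koszul_sign_cases[of s \<sigma>, where 'r = "('a, 'b) mpoly_ring"] by (auto simp: degrees_in_uminus)

lemma degrees_le_neg:
  assumes "f \<in> degrees_in (\<lambda>c. c + w \<le> E)" "E < w"
  shows "f = 0"
  using assms by (intro poly_mapping_eqI) (fastforce simp: degrees_in_def in_keys_iff)

definition weight :: "nat \<Rightarrow> (nat \<Rightarrow> nat) \<Rightarrow> (nat \<Rightarrow> nat) \<Rightarrow> int" where
  "weight n d a = (\<Sum>j<n. int (a j) * int (d j))"

lemma weight_insert:
  assumes "s < n" "s \<notin> \<sigma>"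
  shows "weight n d (total_exponent (insert s \<sigma>) u) = weight n d (total_exponent \<sigma> u) + int (d s)"
proof -
  have "(\<Sum>j\<in>{..<n} - {s}. int (total_exponent (insert s \<sigma>) u j) * int (d j)) =
      (\<Sum>j\<in>{..<n} - {s}. int (total_exponent \<sigma> u j) * int (d j))"
    by (intro sum.cong) (auto simp: total_exponent_def)
  then show ?thesis
    using assms by (simp add: weight_def sum.remove[of "{..<n}" s] total_exponent_def distrib_right)
qed

text \<open>Every \<open>d j\<close> is at least 1, so \<open>p\<close> cannot exceed the weight.
  This is what stops the induction that raises \<open>p\<close>.\<close>

lemma weight_ge:
  assumes "u \<in> exponents n p" "\<And>j. j < n \<Longrightarrow> d j > 0"
  shows "int p \<le> weight n d (total_exponent \<sigma> u)"
proof -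
  have "int p = (\<Sum>j<n. int (u j))" using assms(1) by (auto simp: exponents_def)
  also have "\<dots> \<le> weight n d (total_exponent \<sigma> u)"
    unfolding weight_def
  proof (rule sum_mono)
    fix j assume "j \<in> {..<n}"
    then have "d j > 0" using assms(2) by simp
    then have "int (total_exponent \<sigma> u j) * 1 \<le> int (total_exponent \<sigma> u j) * int (d j)"
      by (intro mult_left_mono) auto
    moreover have "int (u j) \<le> int (total_exponent \<sigma> u j) * 1"
      by (simp add: total_exponent_def)
    ultimately show "int (u j) \<le> int (total_exponent \<sigma> u j) * int (d j)"
      by (rule order_trans[rotated])
  qed
  finally show ?thesis .
qed

text \<open>The internal degree of \<open>f e\<^sub>\<sigma> \<otimes> y\<^sup>u\<close> is \<open>deg f + weight\<close>; the predicate \<open>Q\<close> is \<open>= e\<close> or \<open>\<le> e\<close>.\<close>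

definition graded_elements ::
    "nat \<Rightarrow> (nat \<Rightarrow> nat) \<Rightarrow> (int \<Rightarrow> bool) \<Rightarrow> (nat set \<Rightarrow> (nat \<Rightarrow> nat) \<Rightarrow> ('v::finite, 'k::comm_ring_1) mpoly_ring) set"
  where
  "graded_elements n d Q =
    {x. \<forall>\<sigma> u. x \<sigma> u \<in> degrees_in (\<lambda>c. Q (c + weight n d (total_exponent \<sigma> u)))}"

lemma koszul_mult_graded:
  assumes "\<And>s. s < n \<Longrightarrow> F s \<in> homog_part (int (d s))" "x \<in> graded_elements n d Q"
  shows "koszul_mult n F x \<in> graded_elements n d Q"
  unfolding graded_elements_def koszul_def
proof (intro CollectI allI degrees_in_sum koszul_sign_degrees)
  fix \<sigma> u s assume s: "s \<in> {..<n} - \<sigma>"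
  have "x (insert s \<sigma>) u \<in> degrees_in (\<lambda>c. Q (c + weight n d (total_exponent (insert s \<sigma>) u)))"
    using assms(2) by (auto simp: graded_elements_def)
  then show "F s * x (insert s \<sigma>) u \<in> degrees_in (\<lambda>c. Q (c + weight n d (total_exponent \<sigma> u)))"
    using s assms(1)[of s] by (intro degrees_in_mult[of _ "int (d s)"]) (auto simp: weight_insert ac_simps)
qed

lemma koszul_shift_graded:
  assumes "x \<in> graded_elements n d Q"
  shows "koszul_shift n x \<in> graded_elements n d Q"
  unfolding graded_elements_def koszul_def
proof (intro CollectI allI degrees_in_sum koszul_sign_degrees)
  fix \<sigma> u s assume s: "s \<in> {..<n} - \<sigma>"
  show "of_bool (u s > 0) * x (insert s \<sigma>) (u(s := u s - Suc 0)) \<in>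
      degrees_in (\<lambda>c. Q (c + weight n d (total_exponent \<sigma> u)))"
  proof (cases "u s > 0")
    case True
    have "x (insert s \<sigma>) (u(s := u s - Suc 0)) \<in>
        degrees_in (\<lambda>c. Q (c + weight n d (total_exponent (insert s \<sigma>) (u(s := u s - Suc 0)))))"
      using assms by (auto simp: graded_elements_def)
    then show ?thesis using s True total_exponent_shift[of s \<sigma> u] by simp
  qed simp
qed

lemma koszul_homotopy_graded:
  assumes "x \<in> graded_elements n d Q"
  shows "koszul_homotopy x \<in> graded_elements n d Q"
  unfolding graded_elements_def
proof (intro CollectI allI)
  fix \<sigma> u
  define M where "M = first_index (total_exponent \<sigma> u)"
  have "x (\<sigma> - {M}) (u(M := Suc (u M))) \<in>
      degrees_in (\<lambda>c. Q (c + weight n d (total_exponent (\<sigma> - {M}) (u(M := Suc (u M))))))"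
    using assms by (auto simp: graded_elements_def)
  then show "koszul_homotopy x \<sigma> u \<in> degrees_in (\<lambda>c. Q (c + weight n d (total_exponent \<sigma> u)))"
    using total_exponent_unshift[of M \<sigma> u]
    by (cases "M \<in> \<sigma>") (auto simp: koszul_homotopy_def M_def[symmetric])
qed

definition restrict_elements ::
    "nat \<Rightarrow> (nat \<Rightarrow> nat) \<Rightarrow> (int \<Rightarrow> bool) \<Rightarrow> (nat set \<Rightarrow> (nat \<Rightarrow> nat) \<Rightarrow> ('v::finite, 'k::comm_ring_1) mpoly_ring)
      \<Rightarrow> nat set \<Rightarrow> (nat \<Rightarrow> nat) \<Rightarrow> ('v, 'k) mpoly_ring" where
  "restrict_elements n d Q x \<sigma> u = restrict_degrees (\<lambda>c. Q (c + weight n d (total_exponent \<sigma> u))) (x \<sigma> u)"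

lemma restrict_degrees_koszul_sign:
  "restrict_degrees Q (koszul_sign s \<sigma> * f) = koszul_sign s \<sigma> * restrict_degrees Q f"
  using koszul_sign_cases[of s \<sigma>, where 'r = "('a, 'b) mpoly_ring"] by (auto simp: restrict_degrees_uminus)

text \<open>Removing \<open>s\<close> from the index lowers the weight by \<open>d s\<close>,
  exactly what multiplication by \<open>F s\<close> adds to the polynomial degree.\<close>

lemma koszul_mult_restrict:
  assumes "\<And>s. s < n \<Longrightarrow> F s \<in> homog_part (int (d s))"
  shows "koszul_mult n F (restrict_elements n d Q x) = restrict_elements n d Q (koszul_mult n F x)"
proof (intro ext)
  fix \<sigma> u
  show "koszul_mult n F (restrict_elements n d Q x) \<sigma> u = restrict_elements n d Q (koszul_mult n F x) \<sigma> u"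
    unfolding koszul_def restrict_elements_def restrict_degrees_sum restrict_degrees_koszul_sign
    by (intro sum.cong refl)
      (simp add: restrict_degrees_mult[OF assms] weight_insert ac_simps)
qed

lemma restrict_elements_graded: "restrict_elements n d Q x \<in> graded_elements n d Q"
  by (simp add: graded_elements_def restrict_elements_def restrict_degrees_in)

lemma restrict_elements_id: "x \<in> graded_elements n d Q \<Longrightarrow> restrict_elements n d Q x = x"
  by (intro ext) (auto simp: graded_elements_def restrict_elements_def restrict_degrees_id)

lemma restrict_elements_koszul:
  "x \<in> koszul_elements n i p \<Longrightarrow> restrict_elements n d Q x \<in> koszul_elements n i p"
  unfolding koszul_elements_def
proof (intro CollectI allI impI)
  fix \<sigma> u
  assume x: "x \<in> {x. \<forall>\<sigma> u. x \<sigma> u \<noteq> 0 \<longrightarrow> \<sigma> \<subseteq> {..<n} \<and> card \<sigma> = i \<and> u \<in> exponents n p}"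
    and "restrict_elements n d Q x \<sigma> u \<noteq> 0"
  then have "x \<sigma> u \<noteq> 0" by (auto simp: restrict_elements_def)
  with x show "\<sigma> \<subseteq> {..<n} \<and> card \<sigma> = i \<and> u \<in> exponents n p" by blast
qed

text \<open>\<open>regular\<close> yields exactness of \<open>koszul_mult\<close> at i > 0.
  \<open>quasi\<close> takes over at i = 0, where a relation among the monomials in \<open>F\<close>
  must have its coefficients in the ideal. \<open>d_pos\<close> ends the induction of
  \<open>shift_cycles_exact\<close> and gives minimality.\<close>

locale quasi_regular =
  fixes n :: nat and F :: "nat \<Rightarrow> ('v::finite, 'k::comm_ring_1) mpoly_ring" and d :: "nat \<Rightarrow> nat"
  assumes F_homog: "\<And>s. s < n \<Longrightarrow> F s \<in> homog_part (int (d s))"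
    and d_pos: "\<And>s. s < n \<Longrightarrow> d s > 0"
    and regular: "\<And>j g. j < n \<Longrightarrow> F j * g \<in> lin_ideal j F \<Longrightarrow> g \<in> lin_ideal j F"
    and quasi: "\<And>p c u. (\<Sum>a\<in>exponents n p. c a * monomial_in n F a) = 0 \<Longrightarrow>
      u \<in> exponents n p \<Longrightarrow> c u \<in> lin_ideal n F"
begin

definition augment :: "nat \<Rightarrow> (nat set \<Rightarrow> (nat \<Rightarrow> nat) \<Rightarrow> ('v, 'k) mpoly_ring) \<Rightarrow> ('v, 'k) mpoly_ring" where
  "augment p x = (\<Sum>u\<in>exponents n p. x {} u * monomial_in n F u)"

text \<open>At \<open>i = 0\<close> \<open>koszul_mult\<close> kills every element, and the
  augmentation takes its place as the next map.\<close>

definition is_cycle :: "nat \<Rightarrow> nat \<Rightarrow> (nat set \<Rightarrow> (nat \<Rightarrow> nat) \<Rightarrow> ('v, 'k) mpoly_ring) \<Rightarrow> bool" where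
  "is_cycle i p x \<longleftrightarrow> (if i = 0 then augment p x = 0 else koszul_mult n F x = (\<lambda>\<sigma> u. 0))"

lemma koszul_mult_exact:
  assumes x: "x \<in> koszul_elements n i p" and cyc: "is_cycle i p x"
  shows "\<exists>y\<in>koszul_elements n (Suc i) p. koszul_mult n F y = x"
proof -
  have "\<exists>y :: nat set \<Rightarrow> nat \<Rightarrow> ('v, 'k) mpoly_ring. (\<forall>\<sigma>. y \<sigma> 0 \<noteq> 0 \<longrightarrow> \<sigma> \<subseteq> {..<n} \<and> card \<sigma> = Suc i) \<and>
      (\<forall>\<sigma>. koszul_mult n F y \<sigma> 0 = x \<sigma> u)" for u
  proof (cases i)
    case (Suc i')
    have "koszul_mult n F (\<lambda>\<sigma> _::nat. x \<sigma> u) \<sigma> 0 = 0" for \<sigma>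
      using cyc Suc unfolding koszul_mult_pointwise[symmetric] by (simp add: is_cycle_def)
    moreover have "\<sigma> \<subseteq> {..<n} \<and> card \<sigma> = Suc i'" if "x \<sigma> u \<noteq> 0" for \<sigma>
      using koszul_elementsD[OF x, OF that] Suc by simp
    ultimately show ?thesis
      using koszul_exact[of n F "\<lambda>\<sigma> _. x \<sigma> u" i'] regular Suc by simp
  next
    case 0
    have supp: "x \<sigma> u = 0" if "\<sigma> \<noteq> {}" for \<sigma>
      using koszul_elementsD[OF x, of \<sigma> u] that 0 by auto
    have "x {} u \<in> lin_ideal n F"
    proof (cases "u \<in> exponents n p")
      case True
      then show ?thesis using cyc 0 quasi[of "x {}" p u] by (simp add: is_cycle_def augment_def)
    next
      case False
      then have "x {} u = 0" using koszul_elementsD(3)[OF x] by blast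
      then show ?thesis by (auto simp: lin_ideal_def intro!: exI[of _ "\<lambda>_. 0"])
    qed
    then obtain y :: "nat set \<Rightarrow> nat \<Rightarrow> ('v, 'k) mpoly_ring" where y_supp: "\<forall>\<sigma>. y \<sigma> 0 \<noteq> 0 \<longrightarrow> \<sigma> \<subseteq> {..<n} \<and> card \<sigma> = 1"
      and y: "\<forall>\<sigma>. koszul_mult n F y \<sigma> 0 = (if \<sigma> = {} then x {} u else 0)"
      using koszul_mult_surj_lin_ideal by blast
    have "koszul_mult n F y \<sigma> 0 = x \<sigma> u" for \<sigma>
      using supp[of \<sigma>] by (simp add: y)
    with y_supp 0 show ?thesis by (intro exI[of _ y]) simp
  qed
  then obtain y :: "(nat \<Rightarrow> nat) \<Rightarrow> nat set \<Rightarrow> nat \<Rightarrow> ('v, 'k) mpoly_ring" where y_supp: "\<And>u \<sigma>. y u \<sigma> 0 \<noteq> 0 \<Longrightarrow> \<sigma> \<subseteq> {..<n} \<and> card \<sigma> = Suc i"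
    and y: "\<And>u \<sigma>. koszul_mult n F (y u) \<sigma> 0 = x \<sigma> u"
    by metis
  define z where "z \<sigma> u = (if u \<in> exponents n p then y u \<sigma> 0 else 0)" for \<sigma> u
  have "z \<in> koszul_elements n (Suc i) p"
    using y_supp by (auto simp: koszul_elements_def z_def split: if_splits)
  moreover have "koszul_mult n F z \<sigma> u = x \<sigma> u" for \<sigma> u
  proof (cases "u \<in> exponents n p")
    case True
    then have "koszul_mult n F z \<sigma> u = koszul_mult n F (y u) \<sigma> 0"
      by (simp add: koszul_def z_def)
    then show ?thesis by (simp add: y)
  next
    case False
    then have "x \<sigma> u = 0" using koszul_elementsD(3)[OF x] by blast
    then show ?thesis using False by (simp add: koszul_def z_def)
  qed
  ultimately show ?thesis by blast
qed

text \<open>A preimage may be cut down to the degrees of \<open>x\<close> because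
  \<open>koszul_mult\<close> commutes with the cut; this keeps the bound \<open>E\<close> along the
  chase.\<close>

lemma koszul_mult_exact_graded:
  assumes x: "x \<in> koszul_elements n i p" "x \<in> graded_elements n d Q" and cyc: "is_cycle i p x"
  shows "\<exists>y\<in>koszul_elements n (Suc i) p. y \<in> graded_elements n d Q \<and> koszul_mult n F y = x"
proof -
  obtain y where y: "y \<in> koszul_elements n (Suc i) p" "koszul_mult n F y = x"
    using koszul_mult_exact[OF x(1) cyc] by blast
  show ?thesis
  proof (intro bexI[of _ "restrict_elements n d Q y"] conjI)
    show "koszul_mult n F (restrict_elements n d Q y) = x"
      using koszul_mult_restrict[of n F d Q y] F_homog y(2) restrict_elements_id[OF x(2)] by simp
  qed (auto intro: restrict_elements_graded restrict_elements_koszul y)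
qed

text \<open>On e_s y^u both composites give F_s F^u. Hence \<open>augment\<close> kills boundaries
  of shift cycles, and at i = 0 it plays the part that anticommutation plays above.\<close>

lemma augment_shift:
  "augment (Suc p) (koszul_shift n z) = augment p (koszul_mult n F z)"
proof -
  let ?m = "monomial_in n F"
  have "augment (Suc p) (koszul_shift n z) = (\<Sum>s<n. \<Sum>u\<in>exponents n (Suc p).
      (of_bool (u s > 0) * z {s} (u(s := u s - Suc 0))) * ?m u)"
    by (subst sum.swap)
      (simp only: augment_def koszul_def koszul_sign_empty sum_distrib_right Diff_empty mult_1_left)
  also have "\<dots> = (\<Sum>s<n. \<Sum>u\<in>exponents n p. z {s} u * ?m (u(s := Suc (u s))))"
  proof (rule sum.cong[OF refl])
    fix s assume s: "s \<in> {..<n}"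
    have "(\<Sum>u\<in>exponents n (Suc p). (of_bool (u s > 0) * z {s} (u(s := u s - Suc 0))) * ?m u) =
        (\<Sum>u\<in>{u \<in> exponents n (Suc p). u s > 0}. z {s} (u(s := u s - Suc 0)) * ?m u)"
      by (rule sum.mono_neutral_cong_right) (auto simp: finite_exponents)
    also have "\<dots> = (\<Sum>u\<in>exponents n p. z {s} u * ?m (u(s := Suc (u s))))"
    proof (rule sum.reindex_bij_witness[of _ "\<lambda>u. u(s := Suc (u s))" "\<lambda>u. u(s := u s - Suc 0)"])
      fix u assume "u \<in> {u \<in> exponents n (Suc p). u s > 0}"
      then show "u(s := u s - Suc 0) \<in> exponents n p"
        using exponents_Suc_iff[of s n "u(s := u s - Suc 0)" p] s by simp
    qed (use s exponents_Suc_iff[of s n _ p] in auto)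
    finally show "(\<Sum>u\<in>exponents n (Suc p). (of_bool (u s > 0) * z {s} (u(s := u s - Suc 0))) * ?m u) =
        (\<Sum>u\<in>exponents n p. z {s} u * ?m (u(s := Suc (u s))))" .
  qed
  also have "\<dots> = augment p (koszul_mult n F z)"
    by (subst sum.swap)
      (simp add: augment_def koszul_def koszul_sign_def sum_distrib_left sum_distrib_right monomial_in_Suc ac_simps)
  finally show ?thesis .
qed

text \<open>A preimage \<open>z\<close> of \<open>x\<close> in the full Koszul complex is
  corrected by a cycle, which exists by induction since \<open>koszul_shift n z\<close> has larger \<open>p\<close>.\<close>

lemma shift_cycles_exact:
  assumes "x \<in> koszul_elements n i p" "x \<in> graded_elements n d (\<lambda>e. e \<le> E)"
    and "koszul_shift n x = (\<lambda>\<sigma> u. 0)" "is_cycle i p x"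
  shows "\<exists>y\<in>koszul_elements n (Suc i) p. koszul_shift n y = (\<lambda>\<sigma> u. 0) \<and> koszul_mult n F y = x"
  using assms
proof (induction "nat (E + 1 - int p)" arbitrary: p x)
  case 0
  \<comment> \<open>Measure 0 means E < p; as the weight is at least p, a nonzero entry would need a
    negative polynomial degree.\<close>
  have "x \<sigma> u = 0" for \<sigma> u
  proof (rule ccontr)
    assume ne: "x \<sigma> u \<noteq> 0"
    have "int p \<le> weight n d (total_exponent \<sigma> u)"
      using koszul_elementsD(3)[OF 0(2), OF ne] d_pos by (intro weight_ge)
    moreover have "x \<sigma> u \<in> degrees_in (\<lambda>c. c + weight n d (total_exponent \<sigma> u) \<le> E)"
      using 0(3) by (auto simp: graded_elements_def)
    ultimately have "x \<sigma> u = 0" using 0(1) by (intro degrees_le_neg) auto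
    with ne show False by simp
  qed
  then have "x = (\<lambda>\<sigma> u. 0)" by blast
  then show ?case
    by (intro bexI[of _ "\<lambda>\<sigma> u. 0"]) (auto simp: koszul_zero koszul_elements_def)
next
  case (Suc N)
  obtain z where z: "z \<in> koszul_elements n (Suc i) p" "z \<in> graded_elements n d (\<lambda>e. e \<le> E)"
    "koszul_mult n F z = x"
    using koszul_mult_exact_graded[OF Suc.prems(1,2,4)] by blast
  let ?y = "koszul_shift n z"
  have y: "?y \<in> koszul_elements n i (Suc p)" "?y \<in> graded_elements n d (\<lambda>e. e \<le> E)"
    "koszul_shift n ?y = (\<lambda>\<sigma> u. 0)"
    by (rule koszul_shift_elements[OF z(1)], rule koszul_shift_graded[OF z(2)], rule koszul_shift_square)
  have N: "N = nat (E + 1 - int (Suc p))" using Suc.hyps(2) by linarith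
  have "is_cycle i (Suc p) ?y"
  proof (cases "i = 0")
    case True
    then show ?thesis using augment_shift[of p z] z(3) Suc.prems(4) by (simp add: is_cycle_def)
  next
    case False
    have "koszul_mult n F ?y = (\<lambda>\<sigma> u. 0)"
      using Suc.prems(3) by (simp add: koszul_mult_shift z(3) fun_eq_iff)
    with False show ?thesis by (simp add: is_cycle_def)
  qed
  then obtain h where h: "h \<in> koszul_elements n (Suc i) (Suc p)" "koszul_shift n h = (\<lambda>\<sigma> u. 0)"
    "koszul_mult n F h = ?y"
    using Suc.hyps(1)[OF N y] by blast
  let ?h = "koszul_homotopy h"
  have h': "?h \<in> koszul_elements n (Suc (Suc i)) p" "koszul_shift n ?h = h"
    by (rule koszul_homotopy_elements[OF h(1)], rule koszul_shift_exact[OF h(1,2)])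
  \<comment> \<open>As \<open>koszul_shift n ?h = h\<close>, anticommutation turns the shift of the
    added term into \<open>- koszul_mult n F h = - ?y\<close>, which cancels the shift of
    \<open>z\<close>; \<open>koszul_mult\<close> itself kills the added term.\<close>
  let ?x = "\<lambda>\<sigma> u. z \<sigma> u + koszul_mult n F ?h \<sigma> u"
  have "koszul_shift n (koszul_mult n F ?h) \<sigma> u = - ?y \<sigma> u" for \<sigma> u
    using koszul_mult_shift[of n F ?h \<sigma> u] h' h by simp
  then have "koszul_shift n ?x = (\<lambda>\<sigma> u. 0)" by (simp add: koszul_add fun_eq_iff)
  moreover have "koszul_mult n F ?x = x"
    by (simp add: koszul_add fun_eq_iff z(3) koszul_mult_square)
  moreover have "?x \<in> koszul_elements n (Suc i) p"
    by (intro koszul_elements_add koszul_mult_elements z h')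
  ultimately show ?case by (intro bexI[of _ ?x]) auto
qed

end


section \<open>Bases modulo a subspace\<close>

abbreviation k_scale :: "'k::field \<Rightarrow> ('v::finite, 'k) mpoly_ring \<Rightarrow> ('v, 'k) mpoly_ring" where
  "k_scale c f \<equiv> const c * f"

abbreviation k_subspace :: "('v::finite, 'k::field) mpoly_ring set \<Rightarrow> bool" where
  "k_subspace \<equiv> module.subspace k_scale"

lemma vector_space_k_scale: "vector_space (k_scale :: 'k::field \<Rightarrow> ('v::finite, 'k) mpoly_ring \<Rightarrow> _)"
  by unfold_locales (simp_all only: distrib_left distrib_right const_add const_mult mult.assoc const_one mult_1_left)

lemma module_k_scale: "Modules.module (k_scale :: 'k::field \<Rightarrow> ('v::finite, 'k) mpoly_ring \<Rightarrow> _)"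
  using vector_space_k_scale by (simp add: module_iff_vector_space)

lemma ideal_k_subspace: "module.subspace (*) J \<Longrightarrow> k_subspace J"
  by (simp add: module.subspace_def[OF module_mult] module.subspace_def[OF module_k_scale])

lemma homog_part_k_subspace: "k_subspace (homog_part e)"
  unfolding module.subspace_def[OF module_k_scale]
  using homog_part_mult[OF const_homog, of _ e]
  by (auto simp: homog_part_eq degrees_in_add)

lemma k_subspace_diff:
  assumes "k_subspace W" "f \<in> W" "g \<in> W"
  shows "f - g \<in> W"
  using module.subspace_diff[OF module_k_scale assms(1)] assms by blast

lemma k_subspace_0: "k_subspace W \<Longrightarrow> 0 \<in> W"
  by (rule module.subspace_0[OF module_k_scale])

lemma k_subspace_sum: "k_subspace W \<Longrightarrow> (\<And>a. a \<in> A \<Longrightarrow> f a \<in> W) \<Longrightarrow> (\<Sum>a\<in>A. const (c a) * f a) \<in> W"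
  by (intro module.subspace_sum[OF module_k_scale] module.subspace_scale[OF module_k_scale]) auto

text \<open>Unique coefficients split into spanning and independence modulo \<open>W\<close>;
  independence is uniqueness for the element 0, with coefficients set to 0 off
  \<open>B\<close>.\<close>

lemma basis_modulo_iff:
  fixes W V :: "('v::finite, 'k::field) mpoly_ring set"
  assumes W: "k_subspace W" and V: "k_subspace V"
  shows "basis_modulo W V B \<longleftrightarrow> finite B \<and> B \<subseteq> V \<and>
    (\<forall>f\<in>V. \<exists>c. f - (\<Sum>b\<in>B. const (c b) * b) \<in> W) \<and>
    (\<forall>c. (\<Sum>b\<in>B. const (c b) * b) \<in> W \<longrightarrow> (\<forall>b\<in>B. c b = 0))" (is "?L \<longleftrightarrow> ?R")
proof
  assume L: ?L
  have "c b = 0" if c: "(\<Sum>b\<in>B. const (c b) * b) \<in> W" and b: "b \<in> B" for c b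
  proof -
    define P where "P c \<longleftrightarrow> (\<forall>b. b \<notin> B \<longrightarrow> c b = 0) \<and> 0 - (\<Sum>b\<in>B. const (c b) * b) \<in> W" for c
    define c' where "c' b = (if b \<in> B then c b else 0)" for b
    have "(\<Sum>b\<in>B. const (c' b) * b) = (\<Sum>b\<in>B. const (c b) * b)" by (simp add: c'_def)
    then have "P c'"
      using k_subspace_diff[OF W k_subspace_0[OF W]] c by (simp add: P_def c'_def)
    moreover have "P (\<lambda>_. 0)"
      using k_subspace_0[OF W] by (simp add: P_def)
    moreover have "\<exists>!c. P c"
      using L k_subspace_0[OF V] unfolding basis_modulo_def P_def by blast
    ultimately have "c' = (\<lambda>_. 0)" by blast
    then show ?thesis using b by (metis c'_def)
  qed
  then show ?R using L unfolding basis_modulo_def by blast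
next
  assume R: ?R
  then have indep: "c b = 0" if "(\<Sum>b\<in>B. const (c b) * b) \<in> W" "b \<in> B" for c b
    using that by blast
  have "\<exists>!c. (\<forall>b. b \<notin> B \<longrightarrow> c b = 0) \<and> f - (\<Sum>b\<in>B. const (c b) * b) \<in> W" if f: "f \<in> V" for f
  proof -
    obtain c where c: "f - (\<Sum>b\<in>B. const (c b) * b) \<in> W" using R f by blast
    show ?thesis
    proof (rule ex1I[of _ "\<lambda>b. if b \<in> B then c b else 0"])
      show "(\<forall>b. b \<notin> B \<longrightarrow> (if b \<in> B then c b else 0) = 0) \<and>
          f - (\<Sum>b\<in>B. const (if b \<in> B then c b else 0) * b) \<in> W"
        using c by simp
    next
      fix d assume d: "(\<forall>b. b \<notin> B \<longrightarrow> d b = 0) \<and> f - (\<Sum>b\<in>B. const (d b) * b) \<in> W"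
      have "(f - (\<Sum>b\<in>B. const (c b) * b)) - (f - (\<Sum>b\<in>B. const (d b) * b)) \<in> W"
        by (rule k_subspace_diff[OF W c d[THEN conjunct2]])
      then have "(\<Sum>b\<in>B. const (d b - c b) * b) \<in> W"
        by (simp add: const_minus left_diff_distrib sum_subtractf)
      then have "\<forall>b\<in>B. d b - c b = 0" using indep[of "\<lambda>b. d b - c b"] by blast
      then show "d = (\<lambda>b. if b \<in> B then c b else 0)" using d by auto
    qed
  qed
  moreover have "finite B" "B \<subseteq> V" using R by auto
  ultimately show ?L by (simp add: basis_modulo_def)
qed

text \<open>Extend a basis \<open>C\<close> of \<open>V \<inter> W\<close> to a basis
  \<open>D\<close> of \<open>V\<close> and take \<open>D - C\<close>.\<close>

lemma basis_modulo_exists: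
  fixes W V :: "('v::finite, 'k::field) mpoly_ring set"
  assumes W: "k_subspace W" and V: "k_subspace V" and S: "finite S" "V \<subseteq> module.span k_scale S"
  shows "\<exists>B. basis_modulo W V B"
proof -
  interpret vs: vector_space "k_scale :: 'k \<Rightarrow> ('v, 'k) mpoly_ring \<Rightarrow> _" by (rule vector_space_k_scale)
  obtain C where C: "C \<subseteq> V \<inter> W" "vs.independent C" "V \<inter> W \<subseteq> vs.span C" "card C = vs.dim (V \<inter> W)"
    using vs.basis_exists[of "V \<inter> W"] by blast
  have fin: "finite A" if "vs.independent A" "A \<subseteq> V" for A
    using vs.independent_span_bound[OF S(1) that(1)] that(2) S(2) by blast
  have finC: "finite C" using fin C by blast
  obtain D where D: "C \<subseteq> D" "D \<subseteq> V" "vs.independent D" "V \<subseteq> vs.span D"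
    using vs.maximal_independent_subset_extend[of C V] C by blast
  have finD: "finite D" using fin D by blast
  have "basis_modulo W V (D - C)"
    unfolding basis_modulo_iff[OF W V]
  proof (intro conjI allI impI ballI)
    fix f assume "f \<in> V"
    then obtain r where r: "f = (\<Sum>d\<in>D. k_scale (r d) d)"
      using D(4) vs.span_finite[OF finD] by auto
    have "f = (\<Sum>b\<in>D - C. k_scale (r b) b) + (\<Sum>d\<in>C. k_scale (r d) d)"
      unfolding r using finD D(1) by (rule sum.subset_diff[rotated])
    moreover have "(\<Sum>d\<in>C. k_scale (r d) d) \<in> W" using C(1) by (intro k_subspace_sum[OF W]) auto
    ultimately show "\<exists>c. f - (\<Sum>b\<in>D - C. const (c b) * b) \<in> W" by (intro exI[of _ r]) simp
  next
    fix c b assume c: "(\<Sum>b\<in>D - C. const (c b) * b) \<in> W" and b: "b \<in> D - C"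
    have "(\<Sum>b\<in>D - C. const (c b) * b) \<in> V" using D(2) by (intro k_subspace_sum[OF V]) auto
    with c C(3) obtain e where e: "(\<Sum>b\<in>D - C. const (c b) * b) = (\<Sum>d\<in>C. k_scale (e d) d)"
      using vs.span_finite[OF finC] by auto
    define r where "r d = (if d \<in> C then - e d else c d)" for d
    have "(\<Sum>d\<in>D. k_scale (r d) d) = (\<Sum>d\<in>D - C. k_scale (r d) d) + (\<Sum>d\<in>C. k_scale (r d) d)"
      using finD D(1) by (rule sum.subset_diff[rotated])
    also have "(\<Sum>d\<in>D - C. k_scale (r d) d) = (\<Sum>d\<in>D - C. k_scale (c d) d)" by (simp add: r_def)
    also have "(\<Sum>d\<in>C. k_scale (r d) d) = - (\<Sum>d\<in>C. k_scale (e d) d)"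
      by (simp add: r_def sum_negf[symmetric] const_def single_uminus)
    finally have "(\<Sum>d\<in>D. k_scale (r d) d) = 0" using e by simp
    then have "\<forall>d\<in>D. r d = 0" using D(3) vs.dependent_finite[OF finD] by blast
    then show "c b = 0" using b by (auto simp: r_def)
  qed (use finD D in auto)
  then show ?thesis by blast
qed

text \<open>\<open>B\<close> together with a basis of \<open>V \<inter> W\<close> is a basis of
  \<open>V\<close>. So all choices of \<open>B\<close> have the same size, and the
  \<open>SOME\<close> in \<open>quotient_dim\<close> is harmless.\<close>

lemma basis_modulo_card:
  fixes W V :: "('v::finite, 'k::field) mpoly_ring set"
  assumes W: "k_subspace W" and V: "k_subspace V" and S: "finite S" "V \<subseteq> module.span k_scale S"
    and B: "basis_modulo W V B"
  shows "card B + vector_space.dim k_scale (V \<inter> W) = vector_space.dim k_scale V"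
proof -
  interpret vs: vector_space "k_scale :: 'k \<Rightarrow> ('v, 'k) mpoly_ring \<Rightarrow> _" by (rule vector_space_k_scale)
  obtain C where C: "C \<subseteq> V \<inter> W" "vs.independent C" "V \<inter> W \<subseteq> vs.span C" "card C = vs.dim (V \<inter> W)"
    using vs.basis_exists[of "V \<inter> W"] by blast
  have fin: "finite A" if "vs.independent A" "A \<subseteq> V" for A
    using vs.independent_span_bound[OF S(1) that(1)] that(2) S(2) by blast
  have finC: "finite C" using fin C by blast
  have B: "finite B" "B \<subseteq> V" "\<And>f. f \<in> V \<Longrightarrow> \<exists>c. f - (\<Sum>b\<in>B. const (c b) * b) \<in> W"
    "\<And>c b. (\<Sum>b\<in>B. const (c b) * b) \<in> W \<Longrightarrow> b \<in> B \<Longrightarrow> c b = 0"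
    using B unfolding basis_modulo_iff[OF W V] by blast+
  have disj: "B \<inter> C = {}"
  proof (rule ccontr)
    assume "B \<inter> C \<noteq> {}"
    then obtain b where b: "b \<in> B" "b \<in> W" using C(1) by blast
    have "(\<Sum>a\<in>B. const (of_bool (a = b)) * a) = b"
      using b B(1) by (simp add: of_bool_def if_distrib[of const] if_distrib[of "\<lambda>x. x * _"] cong: if_cong)
    then show False using B(4)[of "\<lambda>a. of_bool (a = b)" b] b by simp
  qed
  have "vs.independent (B \<union> C)"
    unfolding vs.dependent_finite[OF finite_UnI[OF B(1) finC]]
  proof (rule notI, elim exE conjE bexE)
    fix u v assume v: "v \<in> B \<union> C" "u v \<noteq> 0" and 0: "(\<Sum>v\<in>B \<union> C. k_scale (u v) v) = 0"
    then have sum: "(\<Sum>v\<in>B. k_scale (u v) v) + (\<Sum>v\<in>C. k_scale (u v) v) = 0"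
      using sum.union_disjoint[OF B(1) finC disj, of "\<lambda>v. k_scale (u v) v"] 0 by simp
    have "(\<Sum>v\<in>C. k_scale (u v) v) \<in> W" using C(1) by (intro k_subspace_sum[OF W]) auto
    moreover have "(\<Sum>v\<in>B. k_scale (u v) v) = 0 - (\<Sum>v\<in>C. k_scale (u v) v)"
      using sum by (simp add: eq_neg_iff_add_eq_0)
    ultimately have "(\<Sum>v\<in>B. k_scale (u v) v) \<in> W"
      using k_subspace_diff[OF W k_subspace_0[OF W]] by simp
    then have uB: "\<forall>b\<in>B. u b = 0" using B(4) by blast
    then have "(\<Sum>v\<in>C. k_scale (u v) v) = 0" using sum by simp
    then have "\<forall>v\<in>C. u v = 0" using C(2) vs.dependent_finite[OF finC] by blast
    with uB v show False by blast
  qed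
  moreover have "V \<subseteq> vs.span (B \<union> C)"
  proof
    fix f assume f: "f \<in> V"
    then obtain c where c: "f - (\<Sum>b\<in>B. const (c b) * b) \<in> W" using B(3) by blast
    have sB: "(\<Sum>b\<in>B. const (c b) * b) \<in> vs.span (B \<union> C)"
      by (intro vs.span_sum vs.span_scale vs.span_base) auto
    have "(\<Sum>b\<in>B. const (c b) * b) \<in> V" using B(2) by (intro k_subspace_sum[OF V]) auto
    then have "f - (\<Sum>b\<in>B. const (c b) * b) \<in> vs.span C"
      using c C(3) k_subspace_diff[OF V f] by blast
    then have "f - (\<Sum>b\<in>B. const (c b) * b) \<in> vs.span (B \<union> C)"
      using vs.span_mono[of C "B \<union> C"] by auto
    from vs.span_add[OF this sB] show "f \<in> vs.span (B \<union> C)" by simp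
  qed
  ultimately have "card (B \<union> C) = vs.dim V"
    using B(2) C(1) by (intro vs.basis_card_eq_dim) auto
  then show "card B + vs.dim (V \<inter> W) = vs.dim V"
    using card_Un_disjoint[OF B(1) finC disj] C(4) by simp
qed

lemma homog_part_span:
  "\<exists>S. finite S \<and> homog_part e \<subseteq> module.span k_scale (S :: ('v::finite, 'k::field) mpoly_ring set)"
proof -
  interpret vs: vector_space "k_scale :: 'k \<Rightarrow> ('v, 'k) mpoly_ring \<Rightarrow> _" by (rule vector_space_k_scale)
  define T where "T = {t :: 'v \<Rightarrow>\<^sub>0 nat. int (mon_degree t) = e}"
  have "finite T"
  proof (rule finite_imageD)
    show "finite (Poly_Mapping.lookup ` T)"
    proof (rule finite_subset)
      show "Poly_Mapping.lookup ` T \<subseteq> {h. \<forall>i. (i \<in> UNIV \<longrightarrow> h i \<in> {..nat e}) \<and> (i \<notin> UNIV \<longrightarrow> h i = 0)}"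
      proof
        fix h assume "h \<in> Poly_Mapping.lookup ` T"
        then obtain t where t: "h = Poly_Mapping.lookup t" "int (mon_degree t) = e" by (auto simp: T_def)
        have "sum h UNIV = mon_degree t" by (simp add: t(1) mon_degree_def)
        with t(2) have "sum h UNIV = nat e" by linarith
        then have "h i \<le> nat e" for i using member_le_sum[of i UNIV h] by simp
        then show "h \<in> {h. \<forall>i. (i \<in> UNIV \<longrightarrow> h i \<in> {..nat e}) \<and> (i \<notin> UNIV \<longrightarrow> h i = 0)}" by simp
      qed
    qed (rule finite_set_of_finite_funs, simp_all)
    show "inj_on Poly_Mapping.lookup T" by (rule inj_onI, rule poly_mapping_eqI) simp
  qed
  moreover have "homog_part e \<subseteq> vs.span ((\<lambda>t. Poly_Mapping.single t 1) ` T)"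
  proof
    fix f :: "('v, 'k) mpoly_ring" assume f: "f \<in> homog_part e"
    have "(\<Sum>t\<in>Poly_Mapping.keys f. Poly_Mapping.single t (Poly_Mapping.lookup f t)) =
        (\<Sum>t\<in>Poly_Mapping.keys f. k_scale (Poly_Mapping.lookup f t) (Poly_Mapping.single t 1))"
      by (simp add: const_def mult_single)
    also have "\<dots> \<in> vs.span ((\<lambda>t. Poly_Mapping.single t 1) ` T)"
      using f by (intro vs.span_sum vs.span_scale vs.span_base) (auto simp: homog_part_def T_def)
    finally show "f \<in> vs.span ((\<lambda>t. Poly_Mapping.single t 1) ` T)" by (simp add: mpoly_eq_sum_single)
  qed
  ultimately show ?thesis by blast
qed

lemma homog_basis_modulo_exists:
  assumes "k_subspace J"
  shows "\<exists>B. basis_modulo J (homog_part e) B"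
  using homog_part_span basis_modulo_exists[OF assms homog_part_k_subspace] by blast

lemma hilbert_function_eq_card:
  fixes J :: "('v::finite, 'k::field) mpoly_ring set"
  assumes "k_subspace J" "basis_modulo J (homog_part e) B"
  shows "hilbert_function J e = card B"
proof -
  obtain S :: "('v, 'k) mpoly_ring set" where S: "finite S" "homog_part e \<subseteq> module.span k_scale S"
    using homog_part_span by blast
  have "basis_modulo J (homog_part e) (SOME B. basis_modulo J (homog_part e) B)"
    using assms(2) by (rule someI)
  then show ?thesis
    unfolding hilbert_function_def quotient_dim_def
    using basis_modulo_card[OF assms(1) homog_part_k_subspace S] assms(2) by (metis add_right_cancel)
qed

text \<open>Dimensions add along \<open>W2 \<subseteq> W1\<close>; this climbs from the m-th power
  of the ideal to the next.\<close>

lemma basis_modulo_filtration: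
  fixes V W1 W2 :: "('v::finite, 'k::field) mpoly_ring set"
  assumes V: "k_subspace V" and W1: "k_subspace W1" and W2: "k_subspace W2" "W2 \<subseteq> W1"
    and B1: "basis_modulo W1 V B1" and B2: "basis_modulo W2 (V \<inter> W1) B2"
  shows "basis_modulo W2 V (B1 \<union> B2) \<and> card (B1 \<union> B2) = card B1 + card B2"
proof -
  have VW1: "k_subspace (V \<inter> W1)" by (rule module.subspace_inter[OF module_k_scale V W1])
  note B1 = B1[unfolded basis_modulo_iff[OF W1 V]]
  note B2 = B2[unfolded basis_modulo_iff[OF W2(1) VW1]]
  have B1_indep: "c b = 0" if "(\<Sum>b\<in>B1. const (c b) * b) \<in> W1" "b \<in> B1" for c b
    using B1 that by blast
  have disj: "B1 \<inter> B2 = {}"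
  proof (rule ccontr)
    assume "B1 \<inter> B2 \<noteq> {}"
    then obtain b where b: "b \<in> B1" "b \<in> W1" using B2 by blast
    have "(\<Sum>a\<in>B1. const (of_bool (a = b)) * a) = b"
      using b B1 by (simp add: of_bool_def if_distrib[of const] if_distrib[of "\<lambda>x. x * _"] cong: if_cong)
    then show False using B1_indep[of "\<lambda>a. of_bool (a = b)" b] b by simp
  qed
  have sum: "(\<Sum>b\<in>B1 \<union> B2. const (c b) * b) = (\<Sum>b\<in>B1. const (c b) * b) + (\<Sum>b\<in>B2. const (c b) * b)" for c
    using B1 B2 disj by (intro sum.union_disjoint) auto
  have B2W1: "(\<Sum>b\<in>B2. const (c b) * b) \<in> W1" for c
    using B2 by (intro k_subspace_sum[OF W1]) auto
  have B1V: "(\<Sum>b\<in>B1. const (c b) * b) \<in> V" for c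
    using B1 by (intro k_subspace_sum[OF V]) auto
  have "basis_modulo W2 V (B1 \<union> B2)"
    unfolding basis_modulo_iff[OF W2(1) V]
  proof (intro conjI allI impI ballI)
    fix f assume f: "f \<in> V"
    obtain c1 where c1: "f - (\<Sum>b\<in>B1. const (c1 b) * b) \<in> W1" using B1 f by blast
    then obtain c2 where c2: "f - (\<Sum>b\<in>B1. const (c1 b) * b) - (\<Sum>b\<in>B2. const (c2 b) * b) \<in> W2"
      using B2 k_subspace_diff[OF V f B1V] by blast
    define c where "c b = (if b \<in> B1 then c1 b else c2 b)" for b
    have "(\<Sum>b\<in>B1. const (c b) * b) = (\<Sum>b\<in>B1. const (c1 b) * b)" by (simp add: c_def)
    moreover have "(\<Sum>b\<in>B2. const (c b) * b) = (\<Sum>b\<in>B2. const (c2 b) * b)"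
      using disj by (intro sum.cong) (auto simp: c_def)
    ultimately show "\<exists>c. f - (\<Sum>b\<in>B1 \<union> B2. const (c b) * b) \<in> W2"
      using c2 by (intro exI[of _ c]) (simp add: sum diff_diff_eq)
  next
    fix c b assume c: "(\<Sum>b\<in>B1 \<union> B2. const (c b) * b) \<in> W2" and b: "b \<in> B1 \<union> B2"
    have "(\<Sum>b\<in>B1 \<union> B2. const (c b) * b) - (\<Sum>b\<in>B2. const (c b) * b) \<in> W1"
      using c W2(2) B2W1 by (intro k_subspace_diff[OF W1]) auto
    then have "(\<Sum>b\<in>B1. const (c b) * b) \<in> W1" by (simp add: sum)
    then have cB1: "\<forall>b\<in>B1. c b = 0" using B1 by blast
    then have "(\<Sum>b\<in>B2. const (c b) * b) \<in> W2" using c by (simp add: sum)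
    then have "\<forall>b\<in>B2. c b = 0" using B2 by blast
    with cB1 b show "c b = 0" by blast
  qed (use B1 B2 in auto)
  then show ?thesis using card_Un_disjoint[of B1 B2] B1 B2 disj by simp
qed


section \<open>The Hilbert function of fat points\<close>

lemma monomial_ideal_subspace: "module.subspace (*) (monomial_ideal n F m)"
  by (auto simp: module.subspace_def[OF module_mult] monomial_ideal_add monomial_ideal_mult)

lemma monomial_ideal_Suc_subset: "monomial_ideal n F (Suc m) \<subseteq> monomial_ideal n F m"
proof
  fix f assume "f \<in> monomial_ideal n F (Suc m)"
  then obtain c where c: "f = (\<Sum>a\<in>exponents n (Suc m). c a * monomial_in n F a)"
    by (auto simp: monomial_ideal_def)
  have "monomial_in n F a \<in> monomial_ideal n F m" if a: "a \<in> exponents n (Suc m)" for a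
  proof -
    obtain i where i: "i < n" "a i > 0" using exponents_pos[OF a] .
    define b where "b = a(i := a i - 1)"
    have ab: "a = b(i := Suc (b i))" using i by (auto simp: b_def)
    then have "b \<in> exponents n m" using a exponents_Suc_iff[OF i(1), of b m] by simp
    moreover have "monomial_in n F a = F i * monomial_in n F b"
      using i(1) by (subst ab) (rule monomial_in_Suc)
    ultimately show ?thesis by (simp add: monomial_ideal_mult monomial_in_mem)
  qed
  then show "f \<in> monomial_ideal n F m"
    unfolding c by (intro monomial_ideal_sum monomial_ideal_mult)
qed

lemma monomial_in_homog:
  assumes "\<And>s. s < n \<Longrightarrow> F s \<in> homog_part (int (d s))"
  shows "monomial_in n F a \<in> homog_part (weight n d a)"
  unfolding monomial_in_def weight_def
  using assms by (intro homog_part_prod) (auto intro: homog_part_power)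

text \<open>Any coefficients may be replaced by their components of the right degree, since the
  monomials in \<open>F\<close> are homogeneous.\<close>

lemma homogeneous_coefficients:
  assumes F: "\<And>s. s < n \<Longrightarrow> F s \<in> homog_part (int (d s))"
    and f: "f \<in> homog_part i" "f \<in> monomial_ideal n F m"
  shows "\<exists>r. (\<forall>a. r a \<in> homog_part (i - weight n d a)) \<and>
    f = (\<Sum>a\<in>exponents n m. r a * monomial_in n F a)"
proof -
  obtain c where c: "f = (\<Sum>a\<in>exponents n m. c a * monomial_in n F a)"
    using f(2) by (auto simp: monomial_ideal_def)
  let ?r = "\<lambda>a. restrict_degrees (\<lambda>e. e = i - weight n d a) (c a)"
  have "f = restrict_degrees (\<lambda>e. e = i) f"
    using f(1) by (simp add: homog_part_eq restrict_degrees_id)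
  also have "\<dots> = (\<Sum>a\<in>exponents n m. ?r a * monomial_in n F a)"
    unfolding c restrict_degrees_sum
  proof (rule sum.cong[OF refl])
    fix a
    have "(\<lambda>e. e + weight n d a = i) = (\<lambda>e. e = i - weight n d a)" by auto
    then show "restrict_degrees (\<lambda>e. e = i) (c a * monomial_in n F a) = ?r a * monomial_in n F a"
      using restrict_degrees_mult[OF monomial_in_homog[OF F], where Q = "\<lambda>e. e = i" and f = "c a"]
      by (simp add: mult.commute)
  qed
  finally show ?thesis
    by (intro exI[of _ ?r]) (simp add: homog_part_eq restrict_degrees_in)
qed

definition exponents_below :: "nat \<Rightarrow> nat \<Rightarrow> (nat \<Rightarrow> nat) set" where
  "exponents_below n m = {a. (\<forall>i\<ge>n. a i = 0) \<and> sum a {..<n} < m}"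

lemma exponents_below_Suc: "exponents_below n (Suc m) = exponents_below n m \<union> exponents n m"
  by (auto simp: exponents_below_def exponents_def)

lemma exponents_below_0 [simp]: "exponents_below n 0 = {}"
  by (simp add: exponents_below_def)

lemma finite_exponents_below: "finite (exponents_below n m)"
  by (induction m) (simp_all add: exponents_below_Suc finite_exponents)

locale graded_ci = ci_points X Fs n
  for X :: "('v::finite \<Rightarrow> 'k::field_char_0) set set"
    and Fs :: "('v, 'k) mpoly_ring list" and n :: nat +
  fixes ds :: "nat list"
  assumes F_homog: "\<And>s. s < n \<Longrightarrow> F s \<in> homog_part (int (ds ! s))"
begin

abbreviation "wt \<equiv> weight n ((!) ds)"
abbreviation "S \<equiv> monomial_ideal n F"
abbreviation "J \<equiv> vanishing_ideal X"

lemma J_subspace: "k_subspace J"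
  unfolding vanishing_ideal_def by (intro ideal_k_subspace module.subspace_span[OF module_mult])

lemma S_subspace: "k_subspace (S m)"
  by (intro ideal_k_subspace monomial_ideal_subspace)

text \<open>The products b F^a work, with \<open>b\<close> from a basis of R / I in degree
  \<open>i - wt a\<close>: \<open>coefficients_in_ideal\<close> pushes a relation among them modulo
  the next power down to a relation modulo I for each \<open>a\<close>.\<close>

lemma graded_piece_basis:
  "\<exists>B. basis_modulo (S (Suc m)) (homog_part i \<inter> S m) B \<and>
    card B = (\<Sum>a\<in>exponents n m. hilbert_function J (i - wt a))"
proof -
  have "\<forall>a. \<exists>B. basis_modulo J (homog_part (i - wt a)) B"
    using homog_basis_modulo_exists[OF J_subspace] by blast
  then obtain Ba where Ba: "\<And>a. basis_modulo J (homog_part (i - wt a)) (Ba a)" by metis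
  note Ba' = Ba[unfolded basis_modulo_iff[OF J_subspace homog_part_k_subspace]]
  have Ba_fin: "finite (Ba a)" and Ba_homog: "Ba a \<subseteq> homog_part (i - wt a)" for a
    using Ba' by blast+
  have Ba_span: "\<exists>c. f - (\<Sum>b\<in>Ba a. const (c b) * b) \<in> J" if "f \<in> homog_part (i - wt a)" for f a
    using Ba' that by blast
  have Ba_indep: "c b = 0" if "(\<Sum>b\<in>Ba a. const (c b) * b) \<in> J" "b \<in> Ba a" for c a b
    using Ba'[of a] that by blast
  define Sg where "Sg = (SIGMA a:exponents n m. Ba a)"
  define \<psi> where "\<psi> = (\<lambda>(a, b). b * monomial_in n F a)"
  have Sg_fin: "finite Sg" unfolding Sg_def using finite_exponents Ba_fin by blast
  have sum_Sg: "(\<Sum>x\<in>Sg. const (e x) * \<psi> x) =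
      (\<Sum>a\<in>exponents n m. (\<Sum>b\<in>Ba a. const (e (a, b)) * b) * monomial_in n F a)" for e
  proof -
    have "(\<Sum>a\<in>exponents n m. (\<Sum>b\<in>Ba a. const (e (a, b)) * b) * monomial_in n F a) =
        (\<Sum>a\<in>exponents n m. \<Sum>b\<in>Ba a. const (e (a, b)) * \<psi> (a, b))"
      by (simp add: \<psi>_def sum_distrib_right mult.assoc)
    also have "\<dots> = (\<Sum>(a, b)\<in>Sg. const (e (a, b)) * \<psi> (a, b))"
      unfolding Sg_def by (rule sum.Sigma) (simp_all add: finite_exponents Ba_fin)
    finally show ?thesis by (simp add: case_prod_unfold)
  qed
  have indep: "e x = 0" if mem: "(\<Sum>x\<in>Sg. const (e x) * \<psi> x) \<in> S (Suc m)" and x_in: "x \<in> Sg" for e x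
  proof -
    obtain a b where x: "x = (a, b)" "a \<in> exponents n m" "b \<in> Ba a" using x_in by (auto simp: Sg_def)
    have "(\<Sum>b\<in>Ba a. const (e (a, b)) * b) \<in> J"
      using mem x(2) unfolding sum_Sg fat_points_ideal_eq[symmetric]
      by (rule coefficients_in_ideal[where c = "\<lambda>a. \<Sum>b\<in>Ba a. const (e (a, b)) * b"])
    then show ?thesis using Ba_indep[of "\<lambda>b. e (a, b)" a b] x by simp
  qed
  have inj: "inj_on \<psi> Sg"
  proof (rule inj_onI, rule ccontr)
    fix x y assume xy: "x \<in> Sg" "y \<in> Sg" "\<psi> x = \<psi> y" "x \<noteq> y"
    \<comment> \<open>Independence is stated over pairs, so it also shows that different pairs give
      different products: their difference would be a relation.\<close>
    let ?e = "\<lambda>z. of_bool (z = x) - of_bool (z = y) :: 'k"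
    have *: "(\<Sum>z\<in>Sg. const (of_bool (z = x)) * \<psi> z) = \<psi> x" if "x \<in> Sg" for x
      using that Sg_fin by (simp add: of_bool_def if_distrib[of const] if_distrib[of "\<lambda>x. x * _"] cong: if_cong)
    have "(\<Sum>z\<in>Sg. const (?e z) * \<psi> z) = \<psi> x - \<psi> y"
      using *[OF xy(1)] *[OF xy(2)] by (simp add: const_minus left_diff_distrib sum_subtractf)
    then have "?e x = 0" using xy by (intro indep) auto
    with xy show False by simp
  qed
  have sum_image: "(\<Sum>z\<in>\<psi> ` Sg. const (c z) * z) = (\<Sum>x\<in>Sg. const (c (\<psi> x)) * \<psi> x)" for c
    using sum.reindex[OF inj, of "\<lambda>z. const (c z) * z"] by simp
  have V: "k_subspace (homog_part i \<inter> S m)"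
    by (intro module.subspace_inter[OF module_k_scale] homog_part_k_subspace S_subspace)
  have "basis_modulo (S (Suc m)) (homog_part i \<inter> S m) (\<psi> ` Sg)"
    unfolding basis_modulo_iff[OF S_subspace V]
  proof (intro conjI ballI allI impI)
    show "finite (\<psi> ` Sg)" using Sg_fin by simp
    show "\<psi> ` Sg \<subseteq> homog_part i \<inter> S m"
    proof
      fix z assume "z \<in> \<psi> ` Sg"
      then obtain a b where z: "z = b * monomial_in n F a" "a \<in> exponents n m" "b \<in> Ba a"
        by (auto simp: Sg_def \<psi>_def)
      have "b * monomial_in n F a \<in> homog_part (i - wt a + wt a)"
        using z Ba_homog F_homog by (intro homog_part_mult monomial_in_homog) auto
      then show "z \<in> homog_part i \<inter> S m" using z by (simp add: monomial_ideal_mult monomial_in_mem)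
    qed
  next
    fix f assume "f \<in> homog_part i \<inter> S m"
    then have "\<exists>r. (\<forall>a. r a \<in> homog_part (i - wt a)) \<and> f = (\<Sum>a\<in>exponents n m. r a * monomial_in n F a)"
      by (intro homogeneous_coefficients F_homog) auto
    then obtain r where r: "\<And>a. r a \<in> homog_part (i - wt a)"
      and f: "f = (\<Sum>a\<in>exponents n m. r a * monomial_in n F a)"
      by blast
    have "\<forall>a. \<exists>c. r a - (\<Sum>b\<in>Ba a. const (c b) * b) \<in> J" by (intro allI Ba_span r)
    from choice[OF this] obtain c where c: "\<forall>a. r a - (\<Sum>b\<in>Ba a. const (c a b) * b) \<in> J" ..
    define e where "e z = (case inv_into Sg \<psi> z of (a, b) \<Rightarrow> c a b)" for z
    have "(\<Sum>z\<in>\<psi> ` Sg. const (e z) * z) = (\<Sum>x\<in>Sg. const (case x of (a, b) \<Rightarrow> c a b) * \<psi> x)"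
      unfolding sum_image by (intro sum.cong refl) (simp add: e_def inj)
    also have "\<dots> = (\<Sum>a\<in>exponents n m. (\<Sum>b\<in>Ba a. const (c a b) * b) * monomial_in n F a)"
      unfolding sum_Sg by simp
    finally have "f - (\<Sum>z\<in>\<psi> ` Sg. const (e z) * z) =
        (\<Sum>a\<in>exponents n m. (r a - (\<Sum>b\<in>Ba a. const (c a b) * b)) * monomial_in n F a)"
      by (simp add: f left_diff_distrib sum_subtractf)
    also have "\<dots> \<in> S (Suc m)"
      using c gen by (intro sum_monomial_in_mem_Suc[OF len]) auto
    finally show "\<exists>c. f - (\<Sum>z\<in>\<psi> ` Sg. const (c z) * z) \<in> S (Suc m)" by blast
  next
    fix c z assume "(\<Sum>z\<in>\<psi> ` Sg. const (c z) * z) \<in> S (Suc m)" "z \<in> \<psi> ` Sg"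
    then show "c z = 0" using indep[of "\<lambda>x. c (\<psi> x)"] unfolding sum_image by blast
  qed
  moreover have "card (\<psi> ` Sg) = (\<Sum>a\<in>exponents n m. hilbert_function J (i - wt a))"
    using hilbert_function_eq_card[OF J_subspace Ba] card_image[OF inj]
    by (simp add: Sg_def finite_exponents Ba_fin)
  ultimately show ?thesis by blast
qed

lemma hilbert_function_monomial_ideal:
  "hilbert_function (S m) i = (\<Sum>a\<in>exponents_below n m. hilbert_function J (i - wt a))"
proof -
  have "\<exists>B. basis_modulo (S m) (homog_part i) B \<and>
      card B = (\<Sum>a\<in>exponents_below n m. hilbert_function J (i - wt a))"
  proof (induction m)
    case 0
    have "basis_modulo (S 0) (homog_part i) {}"
      unfolding basis_modulo_iff[OF S_subspace homog_part_k_subspace] by simp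
    then show ?case by (intro exI[of _ "{}"]) simp
  next
    case (Suc m)
    then obtain B1 where B1: "basis_modulo (S m) (homog_part i) B1"
      "card B1 = (\<Sum>a\<in>exponents_below n m. hilbert_function J (i - wt a))" by blast
    obtain B2 where B2: "basis_modulo (S (Suc m)) (homog_part i \<inter> S m) B2"
      "card B2 = (\<Sum>a\<in>exponents n m. hilbert_function J (i - wt a))"
      using graded_piece_basis by blast
    have "exponents_below n m \<inter> exponents n m = {}"
      by (auto simp: exponents_below_def exponents_def)
    then have "card B1 + card B2 = (\<Sum>a\<in>exponents_below n (Suc m). hilbert_function J (i - wt a))"
      by (simp add: exponents_below_Suc B1 B2 sum.union_disjoint finite_exponents finite_exponents_below)
    then show ?case
      using basis_modulo_filtration[OF homog_part_k_subspace S_subspace S_subspace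
          monomial_ideal_Suc_subset B1(1) B2(1)] by (intro exI[of _ "B1 \<union> B2"]) simp
  qed
  then show ?thesis using hilbert_function_eq_card[OF S_subspace] by metis
qed

end


section \<open>Exponent lists\<close>

definition exponent_of :: "nat list \<Rightarrow> nat \<Rightarrow> nat" where
  "exponent_of as j = (if j < length as then as ! j else 0)"

lemma sum_exponent_of: "length as = n \<Longrightarrow> sum (exponent_of as) {..<n} = sum_list as"
  by (simp add: exponent_of_def sum_list_sum_nth atLeast0LessThan)

text \<open>\<open>P\<close> is instantiated with \<open>= m + i\<close> for the resolution and with
  \<open>< m\<close> for the Hilbert function.\<close>

lemma exponent_of_bij:
  "bij_betw exponent_of {as. length as = n \<and> P (sum_list as)}
    {a. (\<forall>i\<ge>n. a i = 0) \<and> P (sum a {..<n})}"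
proof (rule bij_betw_byWitness[where f' = "\<lambda>a. map a [0..<n]"])
  show "\<forall>as\<in>{as. length as = n \<and> P (sum_list as)}. map (exponent_of as) [0..<n] = as"
    by (auto intro!: nth_equalityI simp: exponent_of_def)
  show "\<forall>a\<in>{a. (\<forall>i\<ge>n. a i = 0) \<and> P (sum a {..<n})}. exponent_of (map a [0..<n]) = a"
    by (auto simp: exponent_of_def fun_eq_iff)
  show "exponent_of ` {as. length as = n \<and> P (sum_list as)} \<subseteq> {a. (\<forall>i\<ge>n. a i = 0) \<and> P (sum a {..<n})}"
    by (auto simp: sum_exponent_of) (simp add: exponent_of_def)
  show "(\<lambda>a. map a [0..<n]) ` {a. (\<forall>i\<ge>n. a i = 0) \<and> P (sum a {..<n})} \<subseteq>
      {as. length as = n \<and> P (sum_list as)}"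
    by (auto simp: interv_sum_list_conv_sum_set_nat atLeast0LessThan)
qed

lemma weight_exponent_of:
  "length as = length ds \<Longrightarrow> weight (length ds) ((!) ds) (exponent_of as) = weighted_degree ds as"
  by (simp add: weight_def weighted_degree_def exponent_of_def)

lemma LL_bij: "bij_betw exponent_of (LL n m) (exponents_below n m)"
proof -
  have "LL n m = {as. length as = n \<and> sum_list as < m}" by (auto simp: LL_def)
  then show ?thesis using exponent_of_bij[of n "\<lambda>s. s < m"] by (simp add: exponents_below_def)
qed


section \<open>The resolution\<close>

lemma homog_part_irrelevant:
  fixes f :: "('v::finite, 'k::comm_ring_1) mpoly_ring"
  assumes "f \<in> homog_part e" "e > 0"
  shows "f \<in> irrelevant_ideal"
proof -
  have "(\<Sum>t\<in>Poly_Mapping.keys f. Poly_Mapping.single t (Poly_Mapping.lookup f t)) \<in> irrelevant_ideal"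
    unfolding irrelevant_ideal_def
  proof (rule module.span_sum[OF module_mult])
    fix t assume "t \<in> Poly_Mapping.keys f"
    then have "mon_degree t > 0" using assms by (auto simp: homog_part_def)
    then obtain i s where t: "t = Poly_Mapping.single i 1 + s" by (rule mon_degree_pos_split)
    have "Poly_Mapping.single t c = Poly_Mapping.single s c * var i" for c :: 'k
      using var_times_single[of i s c] unfolding t by (simp add: mult.commute)
    also have "Poly_Mapping.single s (Poly_Mapping.lookup f t) * var i \<in> ideal_gen (range var)"
      by (intro module.span_scale[OF module_mult] module.span_base[OF module_mult]) simp
    finally show "Poly_Mapping.single t (Poly_Mapping.lookup f t) \<in> ideal_gen (range var)" .
  qed
  then show ?thesis by (simp add: mpoly_eq_sum_single)
qed

lemma irrelevant_ideal_subspace: "module.subspace (*) irrelevant_ideal"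
  unfolding irrelevant_ideal_def by (rule module.subspace_span[OF module_mult])

text \<open>The basis of the shift cycles: the cell \<open>(a, \<sigma>)\<close> stands for the boundary of
  \<open>e\<^sub>M \<and> e\<^sub>\<sigma>\<close> in total exponent \<open>a\<close>, where \<open>M = first_index a\<close>.\<close>

definition cells :: "nat \<Rightarrow> nat \<Rightarrow> nat \<Rightarrow> ((nat \<Rightarrow> nat) \<times> nat set) set" where
  "cells n m i = {(a, \<sigma>). a \<in> exponents n (m + i) \<and> \<sigma> \<subseteq> {j. a j > 0} - {first_index a} \<and> card \<sigma> = i}"

lemma exponents_support:
  assumes "a \<in> exponents n q"
  shows "{j. a j > 0} \<subseteq> {..<n}"
proof
  fix j assume "j \<in> {j. a j > 0}"
  then show "j \<in> {..<n}" using assms by (cases "j < n") (auto simp: exponents_def)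
qed

lemma finite_cells: "finite (cells n m i)"
proof (rule finite_subset)
  show "cells n m i \<subseteq> exponents n (m + i) \<times> Pow {..<n}"
    using exponents_support by (fastforce simp: cells_def)
qed (simp add: finite_exponents)

text \<open>The first index of \<open>a\<close> is missing from \<open>\<sigma>\<close>, so at most
  n - 1 indices remain; hence the resolution ends at n - 1.\<close>

lemma cells_empty:
  assumes "m \<ge> 1" "i \<ge> n"
  shows "cells n m i = {}"
proof (rule ccontr)
  assume "cells n m i \<noteq> {}"
  then obtain a \<sigma> where a: "a \<in> exponents n (m + i)" and \<sigma>: "\<sigma> \<subseteq> {j. a j > 0} - {first_index a}" "card \<sigma> = i"
    by (auto simp: cells_def)
  have "m + i = Suc (m + i - 1)" using assms by simp
  then obtain j where "a j > 0" using a exponents_pos[of a n "m + i - 1"] by metis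
  then have "first_index a \<in> {j. a j > 0}" using first_index_pos by simp
  then have "\<sigma> \<subset> {..<n}" using \<sigma>(1) exponents_support[OF a] by blast
  then have "card \<sigma> < n" using psubset_card_mono[of "{..<n}" \<sigma>] by simp
  with \<sigma>(2) assms show False by simp
qed

lemma total_exponent_in_exponents:
  assumes "\<sigma> \<subseteq> {..<n}"
  shows "total_exponent \<sigma> u \<in> exponents n (m + card \<sigma>) \<longleftrightarrow> u \<in> exponents n m"
proof -
  have "sum (total_exponent \<sigma> u) {..<n} = sum u {..<n} + card ({..<n} \<inter> \<sigma>)"
    by (simp add: total_exponent_def sum.distrib of_bool_def sum.If_cases)
  moreover have "{..<n} \<inter> \<sigma> = \<sigma>" using assms by blast
  moreover have "(\<forall>i\<ge>n. total_exponent \<sigma> u i = 0) \<longleftrightarrow> (\<forall>i\<ge>n. u i = 0)"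
    using assms by (force simp: total_exponent_def)
  ultimately show ?thesis by (auto simp: exponents_def)
qed

text \<open>The homotopy reads only entries whose set avoids the cone vertex. As a cycle is the
  shift of its homotopy, these entries determine it; this is why the cells give coordinates.\<close>

lemma koszul_homotopy_cong:
  assumes "\<And>\<sigma> u. first_index (total_exponent \<sigma> u) \<notin> \<sigma> \<Longrightarrow> x \<sigma> u = y \<sigma> u"
  shows "koszul_homotopy x = koszul_homotopy y"
proof (intro ext)
  fix \<sigma> u
  define M where "M = first_index (total_exponent \<sigma> u)"
  have "x (\<sigma> - {M}) (u(M := Suc (u M))) = y (\<sigma> - {M}) (u(M := Suc (u M)))" if "M \<in> \<sigma>"
    using assms[of "\<sigma> - {M}" "u(M := Suc (u M))"] total_exponent_unshift[OF that, of u]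
    by (simp add: M_def)
  then show "koszul_homotopy x \<sigma> u = koszul_homotopy y \<sigma> u"
    by (simp add: koszul_homotopy_def M_def[symmetric])
qed

lemma koszul_homotopy_add:
  "koszul_homotopy (\<lambda>\<sigma> u. x \<sigma> u + y \<sigma> u) \<sigma> u = koszul_homotopy x \<sigma> u + koszul_homotopy y \<sigma> u"
  by (simp add: koszul_homotopy_def Let_def)

lemma koszul_homotopy_scale:
  "koszul_homotopy (\<lambda>\<sigma> u. r * x \<sigma> u) \<sigma> u = r * koszul_homotopy x \<sigma> u"
  by (simp add: koszul_homotopy_def Let_def)

text \<open>Only finitely many entries are nonzero, so the degree-bounded exactness applies to every
  element, homogeneous or not.\<close>

lemma exists_degree_bound:
  fixes x :: "nat set \<Rightarrow> (nat \<Rightarrow> nat) \<Rightarrow> ('v::finite, 'k::comm_ring_1) mpoly_ring"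
  assumes x: "x \<in> koszul_elements n i p"
  shows "\<exists>E. x \<in> graded_elements n d (\<lambda>e. e \<le> E)"
proof -
  define T where "T = (\<Union>\<sigma>\<in>Pow {..<n}. \<Union>u\<in>exponents n p.
    (\<lambda>t. int (mon_degree t) + weight n d (total_exponent \<sigma> u)) ` Poly_Mapping.keys (x \<sigma> u))"
  have T: "finite T" by (auto simp: T_def finite_exponents)
  have "int (mon_degree t) + weight n d (total_exponent \<sigma> u) \<le> Max T"
    if t: "t \<in> Poly_Mapping.keys (x \<sigma> u)" for \<sigma> u t
  proof -
    have "x \<sigma> u \<noteq> 0" using t by auto
    note D = koszul_elementsD[OF x, OF this]
    have "int (mon_degree t) + weight n d (total_exponent \<sigma> u) \<in> T"
      unfolding T_def using D t by blast
    then show ?thesis using T by simp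
  qed
  then show ?thesis by (auto simp: graded_elements_def degrees_in_def)
qed

text \<open>Separates the algebra from the indexing: all that is asked of \<open>\<beta>\<close> is
  a bijection with the cells for which the degree shifts agree.\<close>

locale koszul_resolution = quasi_regular n F d
  for n :: nat and F :: "nat \<Rightarrow> ('v::finite, 'k::field) mpoly_ring" and d :: "nat \<Rightarrow> nat" +
  fixes m :: nat and M :: "nat \<Rightarrow> 'j graded_free" and \<beta> :: "nat \<Rightarrow> 'j \<Rightarrow> (nat \<Rightarrow> nat) \<times> nat set"
  assumes m_pos: "m \<ge> 1"
    and \<beta>: "\<And>i. bij_betw (\<beta> i) (fst (M i)) (cells n m i)"
    and shift: "\<And>i j. j \<in> fst (M i) \<Longrightarrow> snd (M i) j = weight n d (fst (\<beta> i j))"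
begin

definition embed :: "nat \<Rightarrow> ('j \<Rightarrow>\<^sub>0 ('v, 'k) mpoly_ring) \<Rightarrow> nat set \<Rightarrow> (nat \<Rightarrow> nat) \<Rightarrow> ('v, 'k) mpoly_ring" where
  "embed i v \<sigma> u = (if (total_exponent \<sigma> u, \<sigma>) \<in> cells n m i
     then Poly_Mapping.lookup v (inv_into (fst (M i)) (\<beta> i) (total_exponent \<sigma> u, \<sigma>)) else 0)"

text \<open>\<open>koszul_shift\<close> after \<open>koszul_homotopy\<close> turns arbitrary entries
  at the cells into a cycle with the same entries there, and fixes cycles.\<close>

definition cycle_of :: "nat \<Rightarrow> ('j \<Rightarrow>\<^sub>0 ('v, 'k) mpoly_ring) \<Rightarrow> nat set \<Rightarrow> (nat \<Rightarrow> nat) \<Rightarrow> ('v, 'k) mpoly_ring" where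
  "cycle_of i v = koszul_shift n (koszul_homotopy (embed i v))"

text \<open>Subtracting the indicator of \<open>\<sigma>\<close> from the total exponent
  \<open>a\<close> recovers \<open>u\<close>; nothing is truncated, since \<open>\<sigma>\<close>
  lies in the support of \<open>a\<close>.\<close>

definition cell_coeff :: "nat \<Rightarrow> (nat set \<Rightarrow> (nat \<Rightarrow> nat) \<Rightarrow> ('v, 'k) mpoly_ring) \<Rightarrow> 'j \<Rightarrow> ('v, 'k) mpoly_ring" where
  "cell_coeff i x j = (case \<beta> i j of (a, \<sigma>) \<Rightarrow> x \<sigma> (\<lambda>k. a k - of_bool (k \<in> \<sigma>)))"

definition coords :: "nat \<Rightarrow> (nat set \<Rightarrow> (nat \<Rightarrow> nat) \<Rightarrow> ('v, 'k) mpoly_ring) \<Rightarrow> 'j \<Rightarrow>\<^sub>0 ('v, 'k) mpoly_ring" where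
  "coords i x = (\<Sum>j\<in>fst (M i). Poly_Mapping.single j (cell_coeff i x j))"

definition differential :: "nat \<Rightarrow> ('j \<Rightarrow>\<^sub>0 ('v, 'k) mpoly_ring) \<Rightarrow> 'j \<Rightarrow>\<^sub>0 ('v, 'k) mpoly_ring" where
  "differential i v = coords i (koszul_mult n F (cycle_of (Suc i) v))"

definition augmentation :: "('j \<Rightarrow>\<^sub>0 ('v, 'k) mpoly_ring) \<Rightarrow> ('v, 'k) mpoly_ring" where
  "augmentation v = augment m (cycle_of 0 v)"

section \<open>Elements of the free modules as shift cycles\<close>

lemma finite_index: "finite (fst (M i))"
  using bij_betw_finite[OF \<beta>] finite_cells by blast

lemma lookup_coords:
  "Poly_Mapping.lookup (coords i x) j = (if j \<in> fst (M i) then cell_coeff i x j else 0)"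
  by (simp add: coords_def lookup_sum lookup_single when_def finite_index)

lemma coords_elements: "coords i x \<in> gf_elements (M i)"
  by (auto simp: gf_elements_def in_keys_iff lookup_coords split: if_splits)

lemma cell_total:
  assumes "(a, \<sigma>) \<in> cells n m i"
  shows "total_exponent \<sigma> (\<lambda>k. a k - of_bool (k \<in> \<sigma>)) = a"
proof
  fix j
  have "\<sigma> \<subseteq> {j. a j > 0}" using assms by (auto simp: cells_def)
  then show "total_exponent \<sigma> (\<lambda>k. a k - of_bool (k \<in> \<sigma>)) j = a j"
    by (auto simp: total_exponent_def)
qed

lemma total_minus: "(\<lambda>k. total_exponent \<sigma> u k - of_bool (k \<in> \<sigma>)) = u"
  by (simp add: total_exponent_def fun_eq_iff)

lemma cellE:
  assumes "j \<in> fst (M i)"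
  obtains a \<sigma> where "\<beta> i j = (a, \<sigma>)" "(a, \<sigma>) \<in> cells n m i"
  using bij_betwE[OF \<beta>] assms by (metis surj_pair)

lemma embed_elements: "embed i v \<in> koszul_elements n i m"
  unfolding koszul_elements_def
proof (intro CollectI allI impI)
  fix \<sigma> u assume "embed i v \<sigma> u \<noteq> 0"
  then have *: "(total_exponent \<sigma> u, \<sigma>) \<in> cells n m i" by (auto simp: embed_def split: if_splits)
  then have \<sigma>: "\<sigma> \<subseteq> {..<n}" "card \<sigma> = i"
    using exponents_support by (fastforce simp: cells_def)+
  then show "\<sigma> \<subseteq> {..<n} \<and> card \<sigma> = i \<and> u \<in> exponents n m"
    using * total_exponent_in_exponents[OF \<sigma>(1), of u m] by (simp add: cells_def)
qed

lemma cycle_of_elements: "cycle_of i v \<in> koszul_elements n i m"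
proof -
  have m: "m = Suc (m - 1)" using m_pos by simp
  show ?thesis
    unfolding cycle_of_def
    by (subst m, rule koszul_shift_elements, rule koszul_homotopy_elements, subst m[symmetric],
        rule embed_elements)
qed

lemma shift_cycle_of: "koszul_shift n (cycle_of i v) = (\<lambda>\<sigma> u. 0)"
  unfolding cycle_of_def by (rule koszul_shift_square)

lemma cycle_of_add: "cycle_of i (v + w) = (\<lambda>\<sigma> u. cycle_of i v \<sigma> u + cycle_of i w \<sigma> u)"
proof -
  have "embed i (v + w) = (\<lambda>\<sigma> u. embed i v \<sigma> u + embed i w \<sigma> u)"
    by (simp add: embed_def lookup_add fun_eq_iff)
  moreover have "koszul_homotopy (\<lambda>\<sigma> u. embed i v \<sigma> u + embed i w \<sigma> u) =
      (\<lambda>\<sigma> u. koszul_homotopy (embed i v) \<sigma> u + koszul_homotopy (embed i w) \<sigma> u)"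
    by (intro ext koszul_homotopy_add)
  ultimately show ?thesis
    unfolding cycle_of_def by (intro ext) (simp only: koszul_add)
qed

lemma cycle_of_scale: "cycle_of i (fscale r v) = (\<lambda>\<sigma> u. r * cycle_of i v \<sigma> u)"
proof -
  have "embed i (fscale r v) = (\<lambda>\<sigma> u. r * embed i v \<sigma> u)"
    by (simp add: embed_def fun_eq_iff)
  moreover have "koszul_homotopy (\<lambda>\<sigma> u. r * embed i v \<sigma> u) =
      (\<lambda>\<sigma> u. r * koszul_homotopy (embed i v) \<sigma> u)"
    by (intro ext koszul_homotopy_scale)
  ultimately show ?thesis
    unfolding cycle_of_def by (intro ext) (simp only: koszul_scale)
qed

lemma coords_add: "coords i (\<lambda>\<sigma> u. x \<sigma> u + y \<sigma> u) = coords i x + coords i y"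
  by (rule poly_mapping_eqI) (simp add: lookup_coords lookup_add cell_coeff_def split: prod.split)

lemma coords_scale: "coords i (\<lambda>\<sigma> u. r * x \<sigma> u) = fscale r (coords i x)"
  by (rule poly_mapping_eqI) (simp add: lookup_coords cell_coeff_def split: prod.split)

lemma coords_zero: "coords i (\<lambda>\<sigma> u. 0) = 0"
  by (rule poly_mapping_eqI) (simp add: lookup_coords cell_coeff_def split: prod.split)

lemma cycle_of_zero: "cycle_of i 0 = (\<lambda>\<sigma> u. 0)"
proof -
  have "fscale 0 (0 :: 'j \<Rightarrow>\<^sub>0 ('v, 'k) mpoly_ring) = 0" by (rule poly_mapping_eqI) simp
  then show ?thesis using cycle_of_scale[of i 0 0] by simp
qed

text \<open>At a cell the first index is outside \<open>\<sigma>\<close>, so every value of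
  \<open>koszul_homotopy\<close> is 0 there and the homotopy identity loses its second term.\<close>

lemma coords_cycle_of:
  assumes v: "v \<in> gf_elements (M i)"
  shows "coords i (cycle_of i v) = v"
proof (rule poly_mapping_eqI)
  fix j
  show "Poly_Mapping.lookup (coords i (cycle_of i v)) j = Poly_Mapping.lookup v j"
  proof (cases "j \<in> fst (M i)")
    case False
    then have "j \<notin> Poly_Mapping.keys v" using v by (auto simp: gf_elements_def)
    then show ?thesis using False by (simp add: lookup_coords in_keys_iff)
  next
    case True
    then obtain a \<sigma> where j: "\<beta> i j = (a, \<sigma>)" and c: "(a, \<sigma>) \<in> cells n m i" by (rule cellE)
    define u where "u = (\<lambda>k. a k - of_bool (k \<in> \<sigma>))"
    have a: "total_exponent \<sigma> u = a" using cell_total[OF c] by (simp add: u_def)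
    have aE: "a \<in> exponents n (Suc (m + i - 1))" using c m_pos by (simp add: cells_def)
    obtain k where k: "a k > 0" using exponents_pos[OF aE] by blast
    have bd: "l < n" if "total_exponent \<sigma> u l > 0" for l
      using exponents_support[OF aE] that a by auto
    have "first_index a \<notin> \<sigma>" using c by (auto simp: cells_def)
    then have "koszul_homotopy (koszul_shift n (embed i v)) \<sigma> u = 0"
      by (simp add: koszul_homotopy_def Let_def a)
    moreover have "koszul_shift n (koszul_homotopy (embed i v)) \<sigma> u +
        koszul_homotopy (koszul_shift n (embed i v)) \<sigma> u = embed i v \<sigma> u"
      by (rule koszul_homotopy[OF _ bd]) (use k a in auto)
    ultimately have "cycle_of i v \<sigma> u = embed i v \<sigma> u" by (simp add: cycle_of_def)
    also have "\<dots> = Poly_Mapping.lookup v j"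
      using c bij_betw_inv_into_left[OF \<beta> True] by (simp add: embed_def a j)
    finally show ?thesis using True by (simp add: lookup_coords cell_coeff_def j u_def)
  qed
qed

text \<open>\<open>x\<close> agrees with \<open>embed i (coords i x)\<close> at all sets avoiding
  the first index: they are cells, or both entries are 0. Hence both have the same homotopy, and a
  cycle is recovered from its homotopy.\<close>

lemma cycle_of_coords:
  assumes x: "x \<in> koszul_elements n i m" and cyc: "koszul_shift n x = (\<lambda>\<sigma> u. 0)"
  shows "cycle_of i (coords i x) = x"
proof -
  have "koszul_homotopy (embed i (coords i x)) = koszul_homotopy x"
  proof (rule koszul_homotopy_cong)
    fix \<sigma> u assume first: "first_index (total_exponent \<sigma> u) \<notin> \<sigma>"
    let ?c = "(total_exponent \<sigma> u, \<sigma>)"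
    show "embed i (coords i x) \<sigma> u = x \<sigma> u"
    proof (cases "?c \<in> cells n m i")
      case True
      then have "?c \<in> \<beta> i ` fst (M i)" using \<beta>[of i] by (simp add: bij_betw_def)
      then have "inv_into (fst (M i)) (\<beta> i) ?c \<in> fst (M i)" "\<beta> i (inv_into (fst (M i)) (\<beta> i) ?c) = ?c"
        by (auto intro: inv_into_into f_inv_into_f)
      then show ?thesis using True by (simp add: embed_def lookup_coords cell_coeff_def total_minus)
    next
      case False
      have "x \<sigma> u = 0"
      proof (rule ccontr)
        assume "x \<sigma> u \<noteq> 0"
        note D = koszul_elementsD[OF x, OF this]
        have "total_exponent \<sigma> u \<in> exponents n (m + i)"
          using D total_exponent_in_exponents[OF D(1), of u m] by simp
        moreover have "\<sigma> \<subseteq> {j. total_exponent \<sigma> u j > 0}" by (auto simp: total_exponent_def)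
        ultimately have "?c \<in> cells n m i" using D(2) first by (auto simp: cells_def)
        with False show False by simp
      qed
      then show ?thesis using False by (simp add: embed_def)
    qed
  qed
  moreover have "x \<in> koszul_elements n i (Suc (m - 1))" using x m_pos by simp
  ultimately show ?thesis
    unfolding cycle_of_def using koszul_shift_exact[OF _ cyc] by simp
qed

lemma shift_mult_cycle_of: "koszul_shift n (koszul_mult n F (cycle_of i v)) = (\<lambda>\<sigma> u. 0)"
proof (intro ext)
  fix \<sigma> u
  have "koszul_mult n F (koszul_shift n (cycle_of i v)) \<sigma> u = 0"
    unfolding shift_cycle_of by (simp add: koszul_zero)
  then show "koszul_shift n (koszul_mult n F (cycle_of i v)) \<sigma> u = 0"
    using koszul_mult_shift[of n F "cycle_of i v" \<sigma> u] by simp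
qed

lemma cycle_of_differential: "cycle_of i (differential i v) = koszul_mult n F (cycle_of (Suc i) v)"
  unfolding differential_def
  by (intro cycle_of_coords koszul_mult_elements cycle_of_elements shift_mult_cycle_of)

lemma is_cycle_cycle_of:
  "is_cycle i m (cycle_of i v) \<longleftrightarrow> (if i = 0 then augmentation v = 0 else differential (i - 1) v = 0)"
proof (cases i)
  case 0
  then show ?thesis by (simp add: is_cycle_def augmentation_def)
next
  case (Suc i')
  have "koszul_mult n F (cycle_of i v) = (\<lambda>\<sigma> u. 0)" if "differential i' v = 0"
    using cycle_of_differential[of i' v] that cycle_of_zero[of i'] Suc by simp
  moreover have "differential i' v = 0" if "koszul_mult n F (cycle_of i v) = (\<lambda>\<sigma> u. 0)"
    using that Suc by (simp add: differential_def coords_zero)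
  ultimately show ?thesis using Suc by (auto simp: is_cycle_def)
qed

text \<open>Phrased with \<open>is_cycle\<close>, so that exactness at the first module, where the
  augmentation follows, and at all later ones is one statement.\<close>

lemma differential_exact:
  "differential i ` gf_elements (M (Suc i)) = {v \<in> gf_elements (M i). is_cycle i m (cycle_of i v)}"
proof safe
  fix v
  show "differential i v \<in> gf_elements (M i)" by (simp add: differential_def coords_elements)
  show "is_cycle i m (cycle_of i (differential i v))"
  proof (cases "i = 0")
    case True
    have "augment m (koszul_mult n F (cycle_of 1 v)) = augment (Suc m) (koszul_shift n (cycle_of 1 v))"
      by (rule augment_shift[symmetric])
    also have "\<dots> = 0" unfolding shift_cycle_of by (simp add: augment_def)
    finally show ?thesis using True by (simp add: is_cycle_def cycle_of_differential)
  next
    case False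
    then show ?thesis by (simp add: is_cycle_def cycle_of_differential koszul_mult_square)
  qed
next
  fix v assume v: "v \<in> gf_elements (M i)" and cyc: "is_cycle i m (cycle_of i v)"
  obtain E where E: "cycle_of i v \<in> graded_elements n d (\<lambda>e. e \<le> E)"
    using exists_degree_bound[OF cycle_of_elements] by blast
  obtain y where y: "y \<in> koszul_elements n (Suc i) m" "koszul_shift n y = (\<lambda>\<sigma> u. 0)"
    "koszul_mult n F y = cycle_of i v"
    using shift_cycles_exact[OF cycle_of_elements E shift_cycle_of cyc] by blast
  have "differential i (coords (Suc i) y) = coords i (cycle_of i v)"
    by (simp add: differential_def cycle_of_coords[OF y(1,2)] y(3))
  then have "v = differential i (coords (Suc i) y)" using coords_cycle_of[OF v] by simp
  then show "v \<in> differential i ` gf_elements (M (Suc i))" using coords_elements by blast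
qed

lemma augmentation_image: "augmentation ` gf_elements (M 0) = monomial_ideal n F m"
proof safe
  fix v show "augmentation v \<in> monomial_ideal n F m"
    by (auto simp: augmentation_def augment_def monomial_ideal_def)
next
  fix f assume "f \<in> monomial_ideal n F m"
  then obtain c where c: "f = (\<Sum>a\<in>exponents n m. c a * monomial_in n F a)"
    by (auto simp: monomial_ideal_def)
  define x where "x \<sigma> u = (if \<sigma> = {} \<and> u \<in> exponents n m then c u else 0)" for \<sigma> :: "nat set" and u
  have x: "x \<in> koszul_elements n 0 m" by (auto simp: koszul_elements_def x_def split: if_splits)
  \<comment> \<open>The shift reads only nonempty sets, so every element at i = 0 is a
    cycle.\<close>
  have "koszul_shift n x = (\<lambda>\<sigma> u. 0)" by (simp add: koszul_def x_def fun_eq_iff)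
  then have "augmentation (coords 0 x) = augment m x"
    by (simp add: augmentation_def cycle_of_coords[OF x])
  also have "\<dots> = f" by (simp add: augment_def x_def c)
  finally show "f \<in> augmentation ` gf_elements (M 0)" using coords_elements by blast
qed

lemma cycle_of_graded:
  assumes v: "v \<in> gf_part (M i) e"
  shows "cycle_of i v \<in> graded_elements n d (\<lambda>c. c = e)"
proof -
  have "embed i v \<in> graded_elements n d (\<lambda>c. c = e)"
    unfolding graded_elements_def
  proof (intro CollectI allI)
    fix \<sigma> u
    let ?c = "(total_exponent \<sigma> u, \<sigma>)"
    show "embed i v \<sigma> u \<in> degrees_in (\<lambda>c. c + weight n d (total_exponent \<sigma> u) = e)"
    proof (cases "?c \<in> cells n m i")
      case True
      define j where "j = inv_into (fst (M i)) (\<beta> i) ?c"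
      have "?c \<in> \<beta> i ` fst (M i)" using \<beta>[of i] True by (simp add: bij_betw_def)
      then have j: "j \<in> fst (M i)" "\<beta> i j = ?c"
        by (auto simp: j_def intro: inv_into_into f_inv_into_f)
      then have "Poly_Mapping.lookup v j \<in> homog_part (e - weight n d (total_exponent \<sigma> u))"
        using v shift[OF j(1)] by (auto simp: gf_part_def)
      then show ?thesis using True by (auto simp: embed_def j_def[symmetric] degrees_in_def homog_part_def)
    qed (simp add: embed_def)
  qed
  then show ?thesis
    unfolding cycle_of_def by (intro koszul_shift_graded koszul_homotopy_graded)
qed

lemma coords_graded:
  assumes x: "x \<in> graded_elements n d (\<lambda>c. c = e)"
  shows "coords i x \<in> gf_part (M i) e"
  unfolding gf_part_def
proof (intro CollectI conjI ballI coords_elements)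
  fix j assume j: "j \<in> fst (M i)"
  then obtain a \<sigma> where b: "\<beta> i j = (a, \<sigma>)" and c: "(a, \<sigma>) \<in> cells n m i" by (rule cellE)
  let ?u = "\<lambda>k. a k - of_bool (k \<in> \<sigma>)"
  have "x \<sigma> ?u \<in> degrees_in (\<lambda>c. c + weight n d (total_exponent \<sigma> ?u) = e)"
    using x by (auto simp: graded_elements_def)
  then have "x \<sigma> ?u \<in> homog_part (e - weight n d a)"
    unfolding cell_total[OF c] by (auto simp: degrees_in_def homog_part_def)
  then show "Poly_Mapping.lookup (coords i x) j \<in> homog_part (e - snd (M i) j)"
    using j shift[OF j] by (simp add: lookup_coords cell_coeff_def b)
qed

lemma augmentation_graded:
  assumes "v \<in> gf_part (M 0) e"
  shows "augmentation v \<in> homog_part e"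
  unfolding augmentation_def augment_def homog_part_eq
proof (rule degrees_in_sum)
  fix u assume "u \<in> exponents n m"
  have "total_exponent {} u = u" by (simp add: total_exponent_def fun_eq_iff)
  then have "cycle_of 0 v {} u \<in> degrees_in (\<lambda>c. c + weight n d u = e)"
    using cycle_of_graded[OF assms] by (auto simp: graded_elements_def dest!: spec[of _ "{}"] spec[of _ u])
  moreover have "monomial_in n F u \<in> homog_part (weight n d u)"
    by (rule monomial_in_homog, rule F_homog)
  ultimately have "monomial_in n F u * cycle_of 0 v {} u \<in> degrees_in (\<lambda>c. c = e)"
    by (rule degrees_in_mult[rotated])
  then show "cycle_of 0 v {} u * monomial_in n F u \<in> degrees_in (\<lambda>c. c = e)" by (simp add: mult.commute)
qed

text \<open>Coordinates are entries of a \<open>koszul_mult\<close> image, and each such entry is a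
  combination of the \<open>F s\<close>, forms of positive degree.\<close>

lemma minimal:
  "differential i v \<in> module.span fscale {fscale r w | r w. r \<in> irrelevant_ideal \<and> w \<in> gf_elements (M i)}"
proof -
  let ?x = "koszul_mult n F (cycle_of (Suc i) v)"
  have irr: "?x \<sigma> u \<in> irrelevant_ideal" for \<sigma> u
    unfolding koszul_def
  proof (rule module.subspace_sum[OF module_mult irrelevant_ideal_subspace],
      rule module.subspace_scale[OF module_mult irrelevant_ideal_subspace])
    fix s assume "s \<in> {..<n} - \<sigma>"
    then have "F s \<in> irrelevant_ideal"
      using F_homog[of s] d_pos[of s] by (intro homog_part_irrelevant[of _ "int (d s)"]) auto
    then have "cycle_of (Suc i) v (insert s \<sigma>) u * F s \<in> irrelevant_ideal"
      by (rule module.subspace_scale[OF module_mult irrelevant_ideal_subspace])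
    then show "F s * cycle_of (Suc i) v (insert s \<sigma>) u \<in> irrelevant_ideal" by (simp add: mult.commute)
  qed
  have single: "Poly_Mapping.single j r = fscale r (Poly_Mapping.single j 1)" for j :: 'j and r :: "('v, 'k) mpoly_ring"
    by (rule poly_mapping_eqI) (simp add: lookup_single when_def)
  show ?thesis
    unfolding differential_def coords_def
  proof (rule module.span_sum[OF module_fscale], rule module.span_base[OF module_fscale])
    fix j assume j: "j \<in> fst (M i)"
    have "cell_coeff i ?x j \<in> irrelevant_ideal"
      by (simp add: cell_coeff_def irr split: prod.split)
    moreover have "Poly_Mapping.single j 1 \<in> gf_elements (M i)" using j by (simp add: gf_elements_def)
    ultimately show "Poly_Mapping.single j (cell_coeff i ?x j) \<in>
        {fscale r w | r w. r \<in> irrelevant_ideal \<and> w \<in> gf_elements (M i)}"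
      using single by blast
  qed
qed

lemma minimal_resolution:
  "minimal_graded_free_resolution (monomial_ideal n F m) n M augmentation differential"
  unfolding minimal_graded_free_resolution_def
proof (intro conjI allI impI)
  show "finite (fst (M i))" for i by (rule finite_index)
  show "fst (M i) = {}" if "n \<le> i" for i
    using bij_betw_empty2[of "\<beta> i" "fst (M i)"] \<beta>[of i] cells_empty[OF m_pos that] by simp
  show "Modules.module_hom fscale (*) augmentation"
    unfolding Modules.module_hom_iff
    by (simp add: module_fscale module_mult augmentation_def augment_def cycle_of_add cycle_of_scale
        distrib_right sum.distrib sum_distrib_left mult.assoc)
  show "augmentation ` gf_part (M 0) e \<subseteq> homog_part e" for e using augmentation_graded by blast
  show "Modules.module_hom fscale fscale (differential i)" for i
  proof -
    have "koszul_mult n F (cycle_of (Suc i) (v + w)) =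
        (\<lambda>\<sigma> u. koszul_mult n F (cycle_of (Suc i) v) \<sigma> u + koszul_mult n F (cycle_of (Suc i) w) \<sigma> u)" for v w
      unfolding cycle_of_add by (intro ext koszul_add)
    moreover have "koszul_mult n F (cycle_of (Suc i) (fscale r v)) =
        (\<lambda>\<sigma> u. r * koszul_mult n F (cycle_of (Suc i) v) \<sigma> u)" for r v
      unfolding cycle_of_scale by (intro ext koszul_scale)
    ultimately show ?thesis
      unfolding Modules.module_hom_iff
      by (simp add: module_fscale differential_def coords_add coords_scale)
  qed
  show "differential i ` gf_part (M (Suc i)) e \<subseteq> gf_part (M i) e" for i e
    unfolding differential_def
    by (auto intro!: coords_graded koszul_mult_graded F_homog cycle_of_graded)
  show "augmentation ` gf_elements (M 0) = monomial_ideal n F m" by (rule augmentation_image)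
  show "differential 0 ` gf_elements (M 1) = {v \<in> gf_elements (M 0). augmentation v = 0}"
    using differential_exact[of 0] by (simp add: is_cycle_cycle_of)
  show "differential (Suc i) ` gf_elements (M (Suc (Suc i))) =
      {v \<in> gf_elements (M (Suc i)). differential i v = 0}" for i
    using differential_exact[of "Suc i"] by (simp add: is_cycle_cycle_of)
  show "differential i ` gf_elements (M (Suc i)) \<subseteq>
      module.span fscale {fscale r v | r v. r \<in> irrelevant_ideal \<and> v \<in> gf_elements (M i)}" for i
    using minimal by blast
qed

end


section \<open>Indexing of the resolution\<close>

text \<open>Sorted lists are multisets, and the interval has t - i members, so the number is (t - i)
  + i - 1 choose i.\<close>

lemma card_sorted_lists:
  "card {ls. length ls = i \<and> sorted ls \<and> set ls \<subseteq> {i + 1..t}} = (t - 1) choose i"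
  "finite {ls :: nat list. length ls = i \<and> sorted ls \<and> set ls \<subseteq> {i + 1..t}}"
proof -
  let ?L = "{ls. length ls = i \<and> sorted ls \<and> set ls \<subseteq> {i + 1..t}}"
  have "bij_betw mset ?L (multisets_of_size {i + 1..t} i)"
  proof (rule bij_betw_byWitness[where f' = sorted_list_of_multiset])
    have "length (sorted_list_of_multiset N) = size N" for N :: "nat multiset"
      by (metis mset_sorted_list_of_multiset size_mset)
    then show "sorted_list_of_multiset ` multisets_of_size {i + 1..t} i \<subseteq> ?L"
      by (auto simp: multisets_of_size_def)
  qed (auto simp: multisets_of_size_def sorted_sort_id)
  then have "card ?L = (card {i + 1..t} + i - 1) choose i"
    by (simp only: bij_betw_same_card card_multisets_of_size finite_atLeastAtMost)
  also have "\<dots> = (t - 1) choose i"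
  \<comment> \<open>If t < i, then both upper entries are below \<open>i\<close> and both binomials
    are 0, despite the truncated subtractions.\<close>
  proof (cases "i \<le> t")
    case False
    then show ?thesis by (cases i) (simp_all add: binomial_eq_0)
  qed simp
  finally show "card ?L = (t - 1) choose i" .
  show "finite ?L"
    by (rule finite_subset[OF _ finite_lists_length_eq[of "{i + 1..t}" i]]) auto
qed

definition support_size :: "nat list \<Rightarrow> nat" where
  "support_size as = card {j. j < length as \<and> as ! j \<noteq> 0}"

text \<open>For a sorted list the condition on its last entry bounds all entries by the support
  size, which replaces the bound n. For i = 0 the demand of one nonzero entry follows from
  \<open>m \<ge> 1\<close>, so both cases take one form.\<close>

lemma fst_HH:
  assumes "m \<ge> 1"
  shows "fst (HH ds m i) = {(ls, as). length ls = i \<and> sorted ls \<and> set ls \<subseteq> {i + 1..support_size as} \<and>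
    length as = length ds \<and> sum_list as = m + i}" (is "?L = ?R")
proof (cases "i = 0")
  case True
  have "1 \<le> card {j. j < length ds \<and> as ! j \<noteq> 0}" if "sum_list as = m" "length as = length ds" for as
  proof -
    have "sum_list as > 0" using that(1) assms by simp
    then obtain x where "x \<in> set as" "x \<noteq> 0" by (metis less_irrefl sum_list_eq_0_iff)
    then have "{j. j < length ds \<and> as ! j \<noteq> 0} \<noteq> {}" using that(2) by (auto simp: in_set_conv_nth)
    then show ?thesis by (simp add: Suc_le_eq card_gt_0_iff)
  qed
  then show ?thesis using True by (auto simp: HH_def Let_def MM_def)
next
  case False
  have *: "set ls \<subseteq> {i + 1..length ds} \<and> last ls \<le> support_size as \<longleftrightarrow> set ls \<subseteq> {i + 1..support_size as}"
    if "length ls = i" "sorted ls" "length as = length ds" for ls as :: "nat list"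
  proof -
    have ne: "ls \<noteq> []" using that False by auto
    have le: "x \<le> last ls" if "x \<in> set ls" for x
    proof -
      have "sorted (butlast ls @ [last ls])" "x \<in> set (butlast ls @ [last ls])"
        using \<open>sorted ls\<close> that ne by simp_all
      then show ?thesis by (auto simp: sorted_append simp del: append_butlast_last_id)
    qed
    have "support_size as \<le> length ds"
      using card_mono[of "{..<length as}" "{j. j < length as \<and> as ! j \<noteq> 0}"] that(3)
      by (auto simp: support_size_def)
    then show ?thesis using last_in_set[OF ne] le by fastforce
  qed
  have "(ls, as) \<in> ?L \<longleftrightarrow> length ls = i \<and> sorted ls \<and>
      (set ls \<subseteq> {i + 1..length ds} \<and> last ls \<le> support_size as) \<and>
      length as = length ds \<and> sum_list as = m + i" for ls as
    using False by (auto simp: HH_def Let_def MM_def support_size_def)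
  then have "(ls, as) \<in> ?L \<longleftrightarrow> (ls, as) \<in> ?R" for ls as
    using *[of ls as] by auto
  then show ?thesis by auto
qed

text \<open>For each \<open>as\<close> the lists and the subsets are equinumerous, and any bijection
  will do: the degree shift depends on the exponent only.\<close>

lemma HH_bij:
  assumes m: "m \<ge> 1"
  shows "\<exists>\<beta>. bij_betw \<beta> (fst (HH ds m i)) (cells (length ds) m i) \<and>
    (\<forall>(ls, as)\<in>fst (HH ds m i). fst (\<beta> (ls, as)) = exponent_of as)"
proof -
  let ?n = "length ds"
  define A where "A = {as. length as = ?n \<and> sum_list as = m + i}"
  define Ls where "Ls as = {ls. length ls = i \<and> sorted ls \<and> set ls \<subseteq> {i + 1..support_size as}}" for as
  define Sub where "Sub a = {\<sigma>. \<sigma> \<subseteq> {j. a j > 0} - {first_index a} \<and> card \<sigma> = i}" for a :: "nat \<Rightarrow> nat"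
  have HH: "fst (HH ds m i) = {(ls, as). as \<in> A \<and> ls \<in> Ls as}"
    by (auto simp: fst_HH[OF m] A_def Ls_def)
  have A: "bij_betw exponent_of A (exponents ?n (m + i))"
    unfolding A_def exponents_def by (rule exponent_of_bij)
  have "\<exists>\<gamma>. bij_betw \<gamma> (Ls as) (Sub (exponent_of as))" if as: "as \<in> A" for as
  proof -
    let ?a = "exponent_of as"
    have "?a \<in> exponents ?n (Suc (m + i - 1))" using bij_betwE[OF A] as m by simp
    then obtain j where "?a j > 0" by (rule exponents_pos) blast
    then have first: "first_index ?a \<in> {j. ?a j > 0}" using first_index_pos by simp
    have supp: "{j. ?a j > 0} = {j. j < length as \<and> as ! j \<noteq> 0}"
      by (auto simp: exponent_of_def split: if_splits)
    then have fin: "finite {j. ?a j > 0}" by simp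
    have "card ({j. ?a j > 0} - {first_index ?a}) = support_size as - 1"
      using card_Diff_singleton[OF first] by (simp only: supp support_size_def)
    then have "card (Sub ?a) = (support_size as - 1) choose i"
      using n_subsets[of "{j. ?a j > 0} - {first_index ?a}" i] fin by (simp add: Sub_def)
    moreover have "finite (Sub ?a)"
      by (rule finite_subset[of _ "Pow {j. ?a j > 0}"]) (auto simp: Sub_def fin)
    ultimately show ?thesis
      using finite_same_card_bij[of "Ls as" "Sub ?a"] card_sorted_lists[of i "support_size as"]
      by (simp add: Ls_def)
  qed
  then obtain \<gamma> where \<gamma>: "\<And>as. as \<in> A \<Longrightarrow> bij_betw (\<gamma> as) (Ls as) (Sub (exponent_of as))" by metis
  define \<beta> where "\<beta> = (\<lambda>(ls, as). (exponent_of as, \<gamma> as ls))"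
  have "bij_betw \<beta> (fst (HH ds m i)) (cells ?n m i)"
    unfolding bij_betw_def
  proof
    show "inj_on \<beta> (fst (HH ds m i))"
    proof (rule inj_onI)
      fix p q assume p: "p \<in> fst (HH ds m i)" and q: "q \<in> fst (HH ds m i)" and eq: "\<beta> p = \<beta> q"
      obtain ls as ls' as' where pq: "p = (ls, as)" "q = (ls', as')" by (metis surj_pair)
      have "as = as'" using A p q eq by (auto simp: HH pq \<beta>_def bij_betw_def inj_on_def)
      moreover from this have "ls = ls'"
        using \<gamma>[of as] p q eq by (auto simp: HH pq \<beta>_def bij_betw_def inj_on_def)
      ultimately show "p = q" by (simp add: pq)
    qed
    show "\<beta> ` fst (HH ds m i) = cells ?n m i"
    proof (intro Set.set_eqI iffI)
      fix c assume "c \<in> \<beta> ` fst (HH ds m i)"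
      then obtain ls as where "c = (exponent_of as, \<gamma> as ls)" "as \<in> A" "ls \<in> Ls as"
        by (auto simp: HH \<beta>_def)
      moreover from this have "exponent_of as \<in> exponents ?n (m + i)" "\<gamma> as ls \<in> Sub (exponent_of as)"
        using bij_betwE[OF A] bij_betwE[OF \<gamma>] by blast+
      ultimately show "c \<in> cells ?n m i" by (simp add: cells_def Sub_def)
    next
      fix c assume c: "c \<in> cells ?n m i"
      obtain a \<sigma> where a\<sigma>: "c = (a, \<sigma>)" by (metis surj_pair)
      have "a \<in> exponent_of ` A" "\<sigma> \<in> Sub a"
        using c A by (simp_all add: a\<sigma> cells_def Sub_def bij_betw_def)
      then obtain as where as: "as \<in> A" "a = exponent_of as" by blast
      have "\<sigma> \<in> \<gamma> as ` Ls as" using \<gamma>[OF as(1)] \<open>\<sigma> \<in> Sub a\<close> as(2) by (simp add: bij_betw_def)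
      then obtain ls where "ls \<in> Ls as" "\<sigma> = \<gamma> as ls" by blast
      then show "c \<in> \<beta> ` fst (HH ds m i)"
        using as by (auto simp: HH \<beta>_def a\<sigma> intro!: image_eqI[of _ _ "(ls, as)"])
    qed
  qed
  moreover have "\<forall>(ls, as)\<in>fst (HH ds m i). fst (\<beta> (ls, as)) = exponent_of as"
    by (simp add: \<beta>_def)
  ultimately show ?thesis by blast
qed


section \<open>Fat points on a complete intersection\<close>

lemma ideal_gen_take:
  assumes "i \<le> length Fs"
  shows "ideal_gen (set (take i Fs)) = lin_ideal i ((!) Fs)"
  using assms unfolding ideal_gen_nth lin_ideal_def by (simp add: min_absorb2)

text \<open>A member of degree 0 is a constant. A nonzero constant generates the unit ideal; the
  constant 0 is regular only if 1 already lies in the ideal of its predecessors. Both contradict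
  properness.\<close>

lemma regular_sequence_degrees_pos:
  fixes Fs :: "('v::finite, 'k::field) mpoly_ring list"
  assumes reg: "regular_sequence Fs" and s: "s < length Fs" and F: "Fs ! s \<in> homog_part (int e)"
  shows "e > 0"
proof (rule ccontr)
  assume "\<not> e > 0"
  have mon0: "t = 0" if "mon_degree t = 0" for t :: "'v \<Rightarrow>\<^sub>0 nat"
    using that by (intro poly_mapping_eqI) (simp add: mon_degree_def)
  obtain c where c: "Fs ! s = const c"
  proof
    show "Fs ! s = const (Poly_Mapping.lookup (Fs ! s) 0)"
    proof (rule poly_mapping_eqI)
      fix t
      have "Poly_Mapping.lookup (Fs ! s) t = 0" if "t \<noteq> 0"
      proof (rule ccontr)
        assume "Poly_Mapping.lookup (Fs ! s) t \<noteq> 0"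
        then have "t \<in> Poly_Mapping.keys (Fs ! s)" by (simp add: in_keys_iff)
        then have "int (mon_degree t) = int e" using F unfolding homog_part_def by blast
        with \<open>\<not> e > 0\<close> that show False using mon0[of t] by simp
      qed
      then show "Poly_Mapping.lookup (Fs ! s) t = Poly_Mapping.lookup (const (Poly_Mapping.lookup (Fs ! s) 0)) t"
        by (auto simp: const_def lookup_single when_def)
    qed
  qed
  have "1 \<in> ideal_gen (set Fs)"
  proof (cases "c = 0")
    case True
    then have "Fs ! s * 1 \<in> ideal_gen (set (take s Fs))"
      using c module.span_zero[OF module_mult] by simp
    then have "1 \<in> ideal_gen (set (take s Fs))" using reg s unfolding regular_sequence_def by blast
    then show ?thesis
      using module.span_mono[OF module_mult set_take_subset[of s Fs]] by blast
  next
    case False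
    have "const (inverse c) * Fs ! s \<in> ideal_gen (set Fs)"
      using s by (intro module.span_scale[OF module_mult] module.span_base[OF module_mult]) simp
    then show ?thesis using False by (simp add: c const_mult[symmetric])
  qed
  then have "f * 1 \<in> ideal_gen (set Fs)" for f by (rule module.span_scale[OF module_mult])
  then show False using reg unfolding regular_sequence_def by auto
qed

theorem proposition4p2:
  fixes X :: "('v::finite \<Rightarrow> 'k::{alg_closed_field, field_char_0}) set set"
    and ds :: "nat list" and n m :: nat
  assumes "n \<ge> 1" and "length ds = n" and "m \<ge> 1"
    and "CI_points ds X"
  shows "(\<exists>\<epsilon> \<phi>. minimal_graded_free_resolution (fat_points_ideal X m) n (HH ds m) \<epsilon> \<phi>) \<and>
         (\<forall>i. hilbert_function (fat_points_ideal X m) i =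
            (\<Sum>as\<in>LL n m. hilbert_function (vanishing_ideal X) (i - weighted_degree ds as)))"
proof -
  obtain Fs :: "('v, 'k) mpoly_ring list" where Fs: "length Fs = n"
    "\<And>i. i < n \<Longrightarrow> Fs ! i \<in> homog_part (int (ds ! i))"
    "regular_sequence Fs" "vanishing_ideal X = ideal_gen (set Fs)"
    using assms unfolding CI_points_def by auto
  interpret graded_ci X Fs n ds
    using assms Fs by unfold_locales (auto simp: CI_points_def)
  interpret quasi_regular n F "(!) ds"
  proof
    show "ds ! s > 0" if "s < n" for s
      using regular_sequence_degrees_pos[of Fs s "ds ! s"] Fs that by simp
    show "g \<in> lin_ideal j F" if "j < n" "F j * g \<in> lin_ideal j F" for j g
    proof -
      have I: "ideal_gen (set (take j Fs)) = lin_ideal j F" using ideal_gen_take[of j Fs] that(1) Fs(1) by simp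
      have "j < length Fs" using that(1) Fs(1) by simp
      then show ?thesis using Fs(3) that(2) unfolding regular_sequence_def I[symmetric] by blast
    qed
    show "c u \<in> lin_ideal n F"
      if "(\<Sum>a\<in>exponents n p. c a * monomial_in n F a) = 0" "u \<in> exponents n p" for p c u
    proof -
      \<comment> \<open>The sum is 0, and 0 lies in the ideal of every fat point scheme, in
        particular for multiplicity \<open>Suc p\<close>.\<close>
      have "c u \<in> vanishing_ideal X"
        using that by (intro coefficients_in_ideal[of c p]) (simp_all add: fat_points_ideal_eq)
      then show ?thesis using ideal_gen_take[of n Fs] Fs(1,4) by simp
    qed
  qed (use Fs in simp)
  have "\<forall>i. \<exists>\<beta>. bij_betw \<beta> (fst (HH ds m i)) (cells n m i) \<and>
      (\<forall>(ls, as)\<in>fst (HH ds m i). fst (\<beta> (ls, as)) = exponent_of as)"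
    using HH_bij[OF assms(3), of ds] assms(2) by blast
  from choice[OF this] obtain \<beta> where \<beta>: "\<forall>i. bij_betw (\<beta> i) (fst (HH ds m i)) (cells n m i) \<and>
      (\<forall>(ls, as)\<in>fst (HH ds m i). fst (\<beta> i (ls, as)) = exponent_of as)" ..
  interpret koszul_resolution n F "(!) ds" m "HH ds m" \<beta>
  proof
    show "bij_betw (\<beta> i) (fst (HH ds m i)) (cells n m i)" for i using \<beta> by blast
    show "snd (HH ds m i) j = weight n ((!) ds) (fst (\<beta> i j))" if j: "j \<in> fst (HH ds m i)" for i j
    proof -
      obtain ls as where p: "j = (ls, as)" by (metis surj_pair)
      have "length as = length ds" using j fst_HH[OF assms(3), of ds i] by (simp add: p)
      then have "weighted_degree ds as = weight n ((!) ds) (exponent_of as)"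
        using weight_exponent_of[of as ds] assms(2) by simp
      moreover have "fst (\<beta> i j) = exponent_of as" using \<beta> j p by blast
      ultimately show ?thesis by (simp add: p HH_def Let_def)
    qed
  qed (use assms in simp)
  have "hilbert_function (fat_points_ideal X m) i =
      (\<Sum>as\<in>LL n m. hilbert_function (vanishing_ideal X) (i - weighted_degree ds as))" for i
  proof -
    have "hilbert_function (fat_points_ideal X m) i =
        (\<Sum>a\<in>exponents_below n m. hilbert_function (vanishing_ideal X) (i - weight n ((!) ds) a))"
      by (simp add: fat_points_ideal_eq hilbert_function_monomial_ideal)
    also have "\<dots> = (\<Sum>as\<in>LL n m. hilbert_function (vanishing_ideal X) (i - weight n ((!) ds) (exponent_of as)))"
      by (rule sum.reindex_bij_betw[OF LL_bij, symmetric])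
    also have "\<dots> = (\<Sum>as\<in>LL n m. hilbert_function (vanishing_ideal X) (i - weighted_degree ds as))"
      using weight_exponent_of[of _ ds] assms(2) by (intro sum.cong) (auto simp: LL_def)
    finally show ?thesis .
  qed
  moreover have "minimal_graded_free_resolution (fat_points_ideal X m) n (HH ds m) augmentation differential"
    unfolding fat_points_ideal_eq by (rule minimal_resolution)
  ultimately show ?thesis by blast
qed

end
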